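(* Let $A$ be a unital separable $C^*$-algebra, let $S\subset A$ be an operator system with $C^*(S)=A$, and let $\varphi,\psi\in\mathcal E(A)$. Then $$\varphi\preceq_{\mathrm S}\psi\quad\Longrightarrow\quad\varphi\preceq_{\mathrm{ISD}}\psi\quad\Longrightarrow\quad\varphi\preceq_{\mathrm D}\psi .$$
   Context: An operator system in $A$ is a unital self-adjoint linear subspace of $A$; $C^*(S)$ is the $C^*$-subalgebra generated by $S$. $\mathcal E(A)$ is the state space of $A$ with the weak-$*$ topology. UCP means unital completely positive. For $\varphi\in\mathcal E(A)$, $(\pi_\varphi,H_\varphi,\xi_\varphi)$ denotes its GNS representation. All relations below are associated with the pair $(S,A)$. Dilation order: $\varphi\preceq_{\mathrm D}\psi$ if there exists a UCP map $\Phi:A\to B(H_\varphi)$ with $\Phi(s)=\pi_\varphi(s)$ for all $s\in S$ and $\psi(a)=\langle\Phi(a)\xi_\varphi,\xi_\varphi\rangle$ for all $a\in A$. Strong dilation relation: $\varphi\preceq_{\mathrm S}\psi$ if there exists such a UCP map $\Phi$ with range contained in the bicommutant $\pi_\varphi(A)''$. Barycenter: for a Borel probability measure $\mu$ on $\mathcal E(A)$, $\mathfrak b(\mu)\in\mathcal E(A)$ is $\mathfrak b(\mu)(a)=\int_{\mathcal E(A)}\alpha(a)\,d\mu(\alpha)$, $a\in A$. $\bar\mu$ denotes the completion of $\mu$. Integral subdivision relation: $\varphi\preceq_{\mathrm{ISD}}\psi$ if for every Borel probability measure $\mu$ on $\mathcal E(A)$ with $\mathfrak b(\mu)=\varphi$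 there is a family of states $\alpha\mapsto\psi_\alpha\in\mathcal E(A)$ ($\alpha\in\mathcal E(A)$) such that $\alpha\mapsto\psi_\alpha(a)$ is $\bar\mu$-measurable for every $a\in A$, $\alpha\preceq_{\mathrm D}\psi_\alpha$ for $\bar\mu$-almost every $\alpha$, and $\psi(a)=\int_{\mathcal E(A)}\psi_\alpha(a)\,d\bar\mu(\alpha)$ for all $a\in A$. *)

theory Defs
  imports "HOL-Probability.Probability_Measure"
begin

text \<open>
  The class \<^class>\<open>real_normed_algebra_1\<close> demands \<open>norm 1 = 1\<close>, which excludes
  only the zero algebra, an algebra without states.
\<close>

class unital_cstar_algebra = real_normed_algebra_1 + banach +
  fixes scaleC :: "complex \<Rightarrow> 'a \<Rightarrow> 'a"  (infixr "*\<^sub>C" 75)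
    and cstar :: "'a \<Rightarrow> 'a"  ("_\<^sup>\<star>" [1000] 1000)
  assumes scaleC_of_real: "complex_of_real r *\<^sub>C x = r *\<^sub>R x"
    and scaleC_add_right: "c *\<^sub>C (x + y) = c *\<^sub>C x + c *\<^sub>C y"
    and scaleC_add_left: "(c + d) *\<^sub>C x = c *\<^sub>C x + d *\<^sub>C x"
    and scaleC_scaleC: "c *\<^sub>C (d *\<^sub>C x) = (c * d) *\<^sub>C x"
    and mult_scaleC_left: "(c *\<^sub>C x) * y = c *\<^sub>C (x * y)"
    and mult_scaleC_right: "x * (c *\<^sub>C y) = c *\<^sub>C (x * y)"
    and norm_scaleC: "norm (c *\<^sub>C x) = cmod c * norm x"
    and cstar_cstar: "x\<^sup>\<star>\<^sup>\<star> = x"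
    and cstar_add: "(x + y)\<^sup>\<star> = x\<^sup>\<star> + y\<^sup>\<star>"
    and cstar_scaleC: "(c *\<^sub>C x)\<^sup>\<star> = cnj c *\<^sub>C x\<^sup>\<star>"
    and cstar_mult: "(x * y)\<^sup>\<star> = y\<^sup>\<star> * x\<^sup>\<star>"
    and cstar_identity: "norm (x\<^sup>\<star> * x) = (norm x)\<^sup>2"

definition operator_system :: "'a::unital_cstar_algebra set \<Rightarrow> bool" where
  "operator_system S \<longleftrightarrow>
     1 \<in> S \<and> (\<forall>x\<in>S. \<forall>y\<in>S. x + y \<in> S) \<and> (\<forall>c. \<forall>x\<in>S. c *\<^sub>C x \<in> S) \<and> (\<forall>x\<in>S. x\<^sup>\<star> \<in> S)"

definition cstar_subalgebra :: "'a::unital_cstar_algebra set \<Rightarrow> bool" where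
  "cstar_subalgebra B \<longleftrightarrow>
     closed B \<and> 0 \<in> B \<and> (\<forall>x\<in>B. \<forall>y\<in>B. x + y \<in> B \<and> x * y \<in> B) \<and>
     (\<forall>c. \<forall>x\<in>B. c *\<^sub>C x \<in> B) \<and> (\<forall>x\<in>B. x\<^sup>\<star> \<in> B)"

definition generated_cstar_algebra :: "'a::unital_cstar_algebra set \<Rightarrow> 'a set" where
  "generated_cstar_algebra S = cstar_subalgebra hull S"

definition state_space :: "('a::unital_cstar_algebra \<Rightarrow> complex) set" where
  "state_space = {\<phi>. (\<forall>a b. \<phi> (a + b) = \<phi> a + \<phi> b) \<and> (\<forall>c a. \<phi> (c *\<^sub>C a) = c * \<phi> a) \<and>
                     (\<forall>a. \<phi> (a\<^sup>\<star> * a) \<in> \<real>\<^sub>\<ge>\<^sub>0) \<and> \<phi> 1 = 1}"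

text \<open>
  The GNS space depends on the state, so Hilbert spaces are given by explicit carriers. Inner
  products are linear in the first argument. Operators are extensional functions on the carrier, so
  that equality of operators is equality of functions.
\<close>

record 'h hilbert =
  hcarrier :: "'h set"
  hadd :: "'h \<Rightarrow> 'h \<Rightarrow> 'h"
  hscale :: "complex \<Rightarrow> 'h \<Rightarrow> 'h"
  hinner :: "'h \<Rightarrow> 'h \<Rightarrow> complex"

definition hnorm :: "'h hilbert \<Rightarrow> 'h \<Rightarrow> real" where
  "hnorm H x = sqrt (Re (hinner H x x))"

definition bounded_operators :: "'h hilbert \<Rightarrow> ('h \<Rightarrow> 'h) set" where
  "bounded_operators H = {T \<in> hcarrier H \<rightarrow>\<^sub>E hcarrier H.
     (\<forall>x\<in>hcarrier H. \<forall>y\<in>hcarrier H. T (hadd H x y) = hadd H (T x) (T y)) \<and>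
     (\<forall>c. \<forall>x\<in>hcarrier H. T (hscale H c x) = hscale H c (T x)) \<and>
     (\<exists>K. \<forall>x\<in>hcarrier H. hnorm H (T x) \<le> K * hnorm H x)}"

definition commutant :: "'h hilbert \<Rightarrow> ('h \<Rightarrow> 'h) set \<Rightarrow> ('h \<Rightarrow> 'h) set" where
  "commutant H M =
     {T \<in> bounded_operators H. \<forall>R\<in>M. \<forall>x\<in>hcarrier H. T (R x) = R (T x)}"

definition bicommutant :: "'h hilbert \<Rightarrow> ('h \<Rightarrow> 'h) set \<Rightarrow> ('h \<Rightarrow> 'h) set" where
  "bicommutant H M = commutant H (commutant H M)"

text \<open>
  Elements of \<open>M\<^sub>n(A)\<close> and \<open>M\<^sub>n(B(H))\<close> are functions of two indices, of which only the entries
  below \<open>n\<close> matter. A positive element of \<open>M\<^sub>n(A)\<close> is one of the form \<open>Y\<^sup>* Y\<close>; a positive element of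
  \<open>M\<^sub>n(B(H)) = B(H\<^sup>n)\<close> is a positive operator on \<open>H\<^sup>n\<close>.
\<close>

definition positive_matrix :: "nat \<Rightarrow> (nat \<Rightarrow> nat \<Rightarrow> 'a::unital_cstar_algebra) \<Rightarrow> bool" where
  "positive_matrix n X \<longleftrightarrow>
     (\<exists>Y. \<forall>i<n. \<forall>j<n. X i j = (\<Sum>k<n. (Y k i)\<^sup>\<star> * Y k j))"

definition positive_operator_matrix ::
  "'h hilbert \<Rightarrow> nat \<Rightarrow> (nat \<Rightarrow> nat \<Rightarrow> 'h \<Rightarrow> 'h) \<Rightarrow> bool" where
  "positive_operator_matrix H n T \<longleftrightarrow>
     (\<forall>h. (\<forall>i<n. h i \<in> hcarrier H) \<longrightarrow>
        (\<Sum>i<n. \<Sum>j<n. hinner H (T i j (h j)) (h i)) \<in> \<real>\<^sub>\<ge>\<^sub>0)"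

definition completely_positive ::
  "'h hilbert \<Rightarrow> ('a::unital_cstar_algebra \<Rightarrow> 'h \<Rightarrow> 'h) \<Rightarrow> bool" where
  "completely_positive H \<Phi> \<longleftrightarrow>
     (\<forall>n X. positive_matrix n X \<longrightarrow> positive_operator_matrix H n (\<lambda>i j. \<Phi> (X i j)))"

definition ucp :: "'h hilbert \<Rightarrow> ('a::unital_cstar_algebra \<Rightarrow> 'h \<Rightarrow> 'h) \<Rightarrow> bool" where
  "ucp H \<Phi> \<longleftrightarrow>
     (\<forall>a. \<Phi> a \<in> bounded_operators H) \<and>
     (\<forall>a b. \<forall>x\<in>hcarrier H. \<Phi> (a + b) x = hadd H (\<Phi> a x) (\<Phi> b x)) \<and>
     (\<forall>c a. \<forall>x\<in>hcarrier H. \<Phi> (c *\<^sub>C a) x = hscale H c (\<Phi> a x)) \<and>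
     (\<forall>x\<in>hcarrier H. \<Phi> 1 x = x) \<and>
     completely_positive H \<Phi>"

text \<open>
  The GNS space is the completion of \<open>A / {a. \<phi> (a\<^sup>* a) = 0}\<close>. Quotient and completion are taken in
  one step: its points are the classes of sequences in \<open>A\<close> that are Cauchy for the seminorm of \<open>\<phi>\<close>,
  modulo sequences tending to zero in this seminorm.
\<close>

definition gns_seminorm :: "('a::unital_cstar_algebra \<Rightarrow> complex) \<Rightarrow> 'a \<Rightarrow> real" where
  "gns_seminorm \<phi> a = sqrt (Re (\<phi> (a\<^sup>\<star> * a)))"

definition gns_cauchy :: "('a::unital_cstar_algebra \<Rightarrow> complex) \<Rightarrow> (nat \<Rightarrow> 'a) \<Rightarrow> bool" where
  "gns_cauchy \<phi> x \<longleftrightarrow> (\<forall>e>0. \<exists>N. \<forall>m\<ge>N. \<forall>n\<ge>N. gns_seminorm \<phi> (x m - x n) < e)"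

definition gns_rel ::
  "('a::unital_cstar_algebra \<Rightarrow> complex) \<Rightarrow> ((nat \<Rightarrow> 'a) \<times> (nat \<Rightarrow> 'a)) set" where
  "gns_rel \<phi> = {(x, y). gns_cauchy \<phi> x \<and> gns_cauchy \<phi> y \<and>
                        (\<lambda>n. gns_seminorm \<phi> (x n - y n)) \<longlonglongrightarrow> 0}"

definition gns_class ::
  "('a::unital_cstar_algebra \<Rightarrow> complex) \<Rightarrow> (nat \<Rightarrow> 'a) \<Rightarrow> (nat \<Rightarrow> 'a) set" where
  "gns_class \<phi> x = gns_rel \<phi> `` {x}"

definition gns_repr :: "(nat \<Rightarrow> 'a) set \<Rightarrow> nat \<Rightarrow> 'a" where
  "gns_repr U = (SOME x. x \<in> U)"

definition gns_space ::
  "('a::unital_cstar_algebra \<Rightarrow> complex) \<Rightarrow> (nat \<Rightarrow> 'a) set hilbert" where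
  "gns_space \<phi> =
     \<lparr> hcarrier = {x. gns_cauchy \<phi> x} // gns_rel \<phi>,
       hadd = (\<lambda>U V. gns_class \<phi> (\<lambda>n. gns_repr U n + gns_repr V n)),
       hscale = (\<lambda>c U. gns_class \<phi> (\<lambda>n. c *\<^sub>C gns_repr U n)),
       hinner = (\<lambda>U V. lim (\<lambda>n. \<phi> ((gns_repr V n)\<^sup>\<star> * gns_repr U n))) \<rparr>"

definition gns_rep ::
  "('a::unital_cstar_algebra \<Rightarrow> complex) \<Rightarrow> 'a \<Rightarrow> (nat \<Rightarrow> 'a) set \<Rightarrow> (nat \<Rightarrow> 'a) set" where
  "gns_rep \<phi> a = (\<lambda>U\<in>hcarrier (gns_space \<phi>). gns_class \<phi> (\<lambda>n. a * gns_repr U n))"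

definition gns_vector :: "('a::unital_cstar_algebra \<Rightarrow> complex) \<Rightarrow> (nat \<Rightarrow> 'a) set" where
  "gns_vector \<phi> = gns_class \<phi> (\<lambda>n. 1)"

definition dilation_map ::
  "'a::unital_cstar_algebra set \<Rightarrow> ('a \<Rightarrow> complex) \<Rightarrow> ('a \<Rightarrow> complex) \<Rightarrow>
   ('a \<Rightarrow> (nat \<Rightarrow> 'a) set \<Rightarrow> (nat \<Rightarrow> 'a) set) \<Rightarrow> bool" where
  "dilation_map S \<phi> \<psi> \<Phi> \<longleftrightarrow>
     ucp (gns_space \<phi>) \<Phi> \<and> (\<forall>s\<in>S. \<Phi> s = gns_rep \<phi> s) \<and>
     (\<forall>a. \<psi> a = hinner (gns_space \<phi>) (\<Phi> a (gns_vector \<phi>)) (gns_vector \<phi>))"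

definition dilation_order ::
  "'a::unital_cstar_algebra set \<Rightarrow> ('a \<Rightarrow> complex) \<Rightarrow> ('a \<Rightarrow> complex) \<Rightarrow> bool" where
  "dilation_order S \<phi> \<psi> \<longleftrightarrow> (\<exists>\<Phi>. dilation_map S \<phi> \<psi> \<Phi>)"

definition strong_dilation ::
  "'a::unital_cstar_algebra set \<Rightarrow> ('a \<Rightarrow> complex) \<Rightarrow> ('a \<Rightarrow> complex) \<Rightarrow> bool" where
  "strong_dilation S \<phi> \<psi> \<longleftrightarrow>
     (\<exists>\<Phi>. dilation_map S \<phi> \<psi> \<Phi> \<and> range \<Phi> \<subseteq> bicommutant (gns_space \<phi>) (range (gns_rep \<phi>)))"

text \<open>
  The topology of the type \<^typ>\<open>'a \<Rightarrow> complex\<close> is that of pointwise convergence, which restricts to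
  the weak-* topology on states. The trace of its Borel sets is the Borel sigma-algebra of the
  subspace.
\<close>

definition state_borel :: "('a::unital_cstar_algebra \<Rightarrow> complex) measure" where
  "state_borel = restrict_space borel state_space"

definition borel_prob_on_states :: "('a::unital_cstar_algebra \<Rightarrow> complex) measure \<Rightarrow> bool" where
  "borel_prob_on_states \<mu> \<longleftrightarrow> prob_space \<mu> \<and> sets \<mu> = sets state_borel"

definition barycenter :: "('a::unital_cstar_algebra \<Rightarrow> complex) measure \<Rightarrow> 'a \<Rightarrow> complex" where
  "barycenter \<mu> a = (LINT \<alpha>|\<mu>. \<alpha> a)"

definition integral_subdivision ::
  "'a::unital_cstar_algebra set \<Rightarrow> ('a \<Rightarrow> complex) \<Rightarrow> ('a \<Rightarrow> complex) \<Rightarrow> bool" where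
  "integral_subdivision S \<phi> \<psi> \<longleftrightarrow>
     (\<forall>\<mu>. borel_prob_on_states \<mu> \<and> barycenter \<mu> = \<phi> \<longrightarrow>
        (\<exists>\<Psi>. (\<forall>\<alpha>\<in>state_space. \<Psi> \<alpha> \<in> state_space) \<and>
             (\<forall>a. (\<lambda>\<alpha>. \<Psi> \<alpha> a) \<in> borel_measurable (completion \<mu>)) \<and>
             (AE \<alpha> in completion \<mu>. dilation_order S \<alpha> (\<Psi> \<alpha>)) \<and>
             (\<forall>a. \<psi> a = (LINT \<alpha>|completion \<mu>. \<Psi> \<alpha> a))))"

end

(*
  For the second implication test the subdivision on the point mass at \<phi>.

  For the first, let \<Phi> be the given map and \<mu> a measure with barycenter \<phi>. For a Borel set E the
  functional a \<mapsto> \<integral>\<^sub>E \<alpha>(a) d\<mu>(\<alpha>) is dominated by \<phi>, so it is implemented by an operator 0 \<le> T\<^sub>E \<le> 1 in the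
  commutant of \<pi>\<^sub>\<phi>(A), which by hypothesis commutes with \<Phi>. Hence E \<mapsto> \<langle>T\<^sub>E \<Phi>(a) c\<xi>, d\<xi>\<rangle> is a complex
  measure which is completely positive as a function of (a, c, d); it has a density F\<^sub>\<alpha>(a, c, d) with
  respect to \<mu>. On a countable dense *-closed subset of A, almost every F\<^sub>\<alpha> is sesquilinear, completely
  positive, bounded, and given by \<alpha>(d* s c) for a = s in S. Such a kernel extends by continuity to a UCP
  map on the GNS space of \<alpha> which dilates \<pi>\<^sub>\<alpha> on S, and \<psi>\<^sub>\<alpha>(a) = F\<^sub>\<alpha>(a, 1, 1).
*)

theory Submission
  imports Defs "HOL-Probability.Giry_Monad"
begin

text \<open>The GNS spaces vary with \<alpha>, so a measurable family of operators on them cannot be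
  written down directly. The kernel avoids this: c and d range over A itself, whose elements have a
  class in every GNS space, and \<open>dense_kernel\<close> turns the scalars found at one \<alpha>
  back into operators. A density is determined only up to a null set, so only countably many
  relations can be imposed at once. Separability gives a countable D, stable under the operations of
  A and under a countable dense set L of scalars, such that S \<inter> D is dense in S; the
  condition on S thus survives the extension by continuity. The bound of the kernel rests on
  positivity through a discriminant argument, which is therefore stated for scalars in a dense set.
  The delicate point is positivity over a set E, where an operator matrix is multiplied by an
  operator commuting with it. Finally, \<psi>_\<alpha> is chosen separately at each \<alpha>, so it
  agrees only almost everywhere with a measurable function; this is where the completion of \<mu>
  enters.\<close>

lemma scaleC_one [simp]: "1 *\<^sub>C x = (x::'a::unital_cstar_algebra)"
  using scaleC_of_real[of 1 x] by simp

lemma scaleC_zero_left [simp]: "0 *\<^sub>C x = (0::'a::unital_cstar_algebra)"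
  using scaleC_of_real[of 0 x] by simp

lemma scaleC_zero_right [simp]: "c *\<^sub>C 0 = (0::'a::unital_cstar_algebra)"
  using scaleC_add_right[of c 0 0] by simp

lemma scaleC_minus_one: "(- 1) *\<^sub>C x = - (x::'a::unital_cstar_algebra)"
  using scaleC_of_real[of "-1" x] by simp

text \<open>Bilinearity over the reals is the setting of the library's limit and difference rules;
  the limit rule later extends homogeneity from a dense set of scalars to all of them.\<close>

lemma bounded_bilinear_scaleC: "bounded_bilinear ((*\<^sub>C) :: complex \<Rightarrow> 'a \<Rightarrow> 'a::unital_cstar_algebra)"
proof
  fix c d :: complex and x y :: 'a and r :: real
  show "(c + d) *\<^sub>C x = c *\<^sub>C x + d *\<^sub>C x" by (rule scaleC_add_left)
  show "c *\<^sub>C (x + y) = c *\<^sub>C x + c *\<^sub>C y" by (rule scaleC_add_right)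
  show "(r *\<^sub>R c) *\<^sub>C x = r *\<^sub>R (c *\<^sub>C x)"
    by (metis scaleC_of_real scaleC_scaleC scaleR_conv_of_real)
  show "c *\<^sub>C (r *\<^sub>R x) = r *\<^sub>R (c *\<^sub>C x)"
    by (metis mult.commute scaleC_of_real scaleC_scaleC)
  show "\<exists>K. \<forall>a b. norm ((a::complex) *\<^sub>C (b::'a)) \<le> norm a * norm b * K"
    by (intro exI[of _ 1]) (simp add: norm_scaleC)
qed

lemmas tendsto_scaleC = bounded_bilinear.tendsto[OF bounded_bilinear_scaleC]
lemmas scaleC_diff_right = bounded_bilinear.diff_right[OF bounded_bilinear_scaleC]

lemma cstar_zero [simp]: "0\<^sup>\<star> = (0::'a::unital_cstar_algebra)"
  using cstar_add[of 0 "0::'a"] by simp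

lemma cstar_minus: "(- x)\<^sup>\<star> = - (x::'a::unital_cstar_algebra)\<^sup>\<star>"
  by (metis add_eq_0_iff cstar_add cstar_zero right_minus)

lemma cstar_one [simp]: "1\<^sup>\<star> = (1::'a::unital_cstar_algebra)"
proof -
  have "(1\<^sup>\<star> * 1)\<^sup>\<star> = 1\<^sup>\<star> * (1::'a)" by (simp only: cstar_mult cstar_cstar)
  then have "(1::'a) = 1\<^sup>\<star>" by (simp only: mult_1_right cstar_cstar)
  then show ?thesis by (rule sym)
qed

text \<open>The C*-identity and submultiplicativity bound the square of norm y by the product of the
  norms of y* and y; one factor cancels, and x and its adjoint give the two inequalities.\<close>

lemma norm_cstar [simp]: "norm ((x::'a::unital_cstar_algebra)\<^sup>\<star>) = norm x"
proof -
  have le: "norm y \<le> norm (y\<^sup>\<star>)" for y :: 'a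
  proof (cases "y = 0")
    case False
    have "norm y * norm y \<le> norm (y\<^sup>\<star>) * norm y"
      using norm_mult_ineq[of "y\<^sup>\<star>" y] by (simp add: cstar_identity power2_eq_square)
    with False show ?thesis by simp
  qed simp
  from le[of x] le[of "x\<^sup>\<star>"] show ?thesis by (simp add: cstar_cstar)
qed

lemma bounded_linear_cstar: "bounded_linear (cstar :: 'a \<Rightarrow> 'a::unital_cstar_algebra)"
proof
  fix x y :: 'a and r :: real
  show "(x + y)\<^sup>\<star> = x\<^sup>\<star> + y\<^sup>\<star>" by (rule cstar_add)
  show "(r *\<^sub>R x)\<^sup>\<star> = r *\<^sub>R x\<^sup>\<star>"
    by (metis complex_cnj_complex_of_real cstar_scaleC scaleC_of_real)
  show "\<exists>K. \<forall>x::'a. norm (x\<^sup>\<star>) \<le> norm x * K"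
    by (intro exI[of _ 1]) simp
qed

lemmas tendsto_cstar = bounded_linear.tendsto[OF bounded_linear_cstar]

lemma cstar_power: "(x ^ n)\<^sup>\<star> = ((x::'a::unital_cstar_algebra)\<^sup>\<star>) ^ n"
  by (induction n) (simp_all add: cstar_mult power_commutes)

text \<open>The square root of \<open>1 - x\<close> is given by the binomial series.\<close>

lemma one_minus_eq_cstar_mult:
  fixes x :: "'a::unital_cstar_algebra"
  assumes "x\<^sup>\<star> = x" and "norm x < 1"
  obtains y where "1 - x = y\<^sup>\<star> * y"
proof -
  let ?c = "\<lambda>n. (1/2 :: real) gchoose n"
  let ?f = "\<lambda>n. ?c n *\<^sub>R (- x) ^ n"
  have "ereal (norm x) < 1" using assms(2) by simp
  also have "1 \<le> conv_radius ?c" by (simp add: conv_radius_gchoose)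
  finally have "ereal (norm x) < conv_radius ?c" .
  then have "summable (\<lambda>n. norm (?c n * norm x ^ n))"
    by (intro abs_summable_in_conv_radius) simp
  then have norm_summable: "summable (\<lambda>n. norm (?f n))"
    by (rule summable_comparison_test'[where N = 0])
      (auto simp: abs_mult norm_power_ineq intro!: mult_left_mono order_trans[OF norm_power_ineq])
  then have f: "summable ?f" by (rule summable_norm_cancel)
  let ?y = "suminf ?f"
  have "?y\<^sup>\<star> = (\<Sum>n. (?f n)\<^sup>\<star>)"
    using bounded_linear.suminf[OF bounded_linear_cstar f] by simp
  also have "\<dots> = ?y"
    using assms(1)
    by (simp add: linear_scale[OF bounded_linear.linear[OF bounded_linear_cstar]] cstar_power cstar_minus)
  finally have star: "?y\<^sup>\<star> = ?y" .
  \<comment> \<open>Vandermonde's convolution: the Cauchy square of the series for exponent 1/2 is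
    the series for exponent 1, whose coefficients vanish beyond k = 1.\<close>
  have conv: "(\<Sum>i\<le>k. ?f i * ?f (k - i)) = (1 gchoose k) *\<^sub>R (- x) ^ k" for k
  proof -
    have "(\<Sum>i\<le>k. ?f i * ?f (k - i)) = (\<Sum>i\<le>k. (?c i * ?c (k - i)) *\<^sub>R (- x) ^ k)"
      by (intro sum.cong) (auto simp: power_add[symmetric] mult.commute)
    also have "\<dots> = (\<Sum>i=0..k. ?c i * ?c (k - i)) *\<^sub>R (- x) ^ k"
      by (simp add: scaleR_sum_left atMost_atLeast0)
    also have "\<dots> = (1 gchoose k) *\<^sub>R (- x) ^ k"
      by (subst gbinomial_Vandermonde) simp
    finally show ?thesis .
  qed
  have "(\<lambda>k. (1 gchoose k) *\<^sub>R (- x) ^ k) sums (?y * ?y)"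
    using Cauchy_product_sums[OF norm_summable norm_summable] by (simp only: conv)
  moreover have "(\<lambda>k. (1 gchoose k) *\<^sub>R (- x) ^ k) sums (\<Sum>k\<in>{0,1}. (1 gchoose k) *\<^sub>R (- x) ^ k)"
  proof (rule sums_finite)
    fix k :: nat assume "k \<notin> {0,1}"
    then have "1 < k" by auto
    then have "(1 gchoose k) = (0::real)"
      using binomial_gbinomial[of 1 k, where ?'a = real] by (simp add: binomial_eq_0)
    then show "(1 gchoose k) *\<^sub>R (- x) ^ k = 0" by simp
  qed simp
  ultimately have "?y * ?y = 1 - x"
    by (auto dest: sums_unique2)
  with star show ?thesis by (intro that[of ?y]) simp
qed

text \<open>Discriminant argument behind all instances of the Cauchy--Schwarz inequality.\<close>

lemma quadratic_form_nonneg: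
  fixes p q r r' :: complex
  assumes dense: "closure L = UNIV"
    and q: "q \<in> \<real>\<^sub>\<ge>\<^sub>0" and p: "p \<in> \<real>\<^sub>\<ge>\<^sub>0"
    and form: "\<And>l. l \<in> L \<Longrightarrow> p + cnj l * r + l * r' + cnj l * l * q \<in> \<real>\<^sub>\<ge>\<^sub>0"
  shows "r' = cnj r" and "(cmod r)\<^sup>2 \<le> Re p * Re q"
proof -
  let ?g = "\<lambda>l. p + cnj l * r + l * r' + cnj l * l * q"
  \<comment> \<open>The nonnegative reals form a closed set, so the hypothesis for l in L extends to
    every complex l. The kernels used later are homogeneous only over such an L.\<close>
  have all: "?g l \<in> \<real>\<^sub>\<ge>\<^sub>0" for l
  proof -
    have "closed (?g -` \<real>\<^sub>\<ge>\<^sub>0)"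
      by (intro closed_vimage closed_nonneg_Reals_complex continuous_intros)
    then have "closure L \<subseteq> ?g -` \<real>\<^sub>\<ge>\<^sub>0"
      using form by (intro closure_minimal) auto
    then show ?thesis using dense by blast
  qed
  obtain p' where p': "p = complex_of_real p'" "p' \<ge> 0"
    using p by (metis nonneg_Reals_cases)
  obtain q' where q': "q = complex_of_real q'" "q' \<ge> 0"
    using q by (metis nonneg_Reals_cases)
  \<comment> \<open>The form is real at l = 1 and at l = i; the two vanishing imaginary parts are
    the two components of r' = cnj r.\<close>
  have "Im r + Im r' = 0"
    using all[of 1] by (simp add: p' q' complex_nonneg_Reals_iff)
  moreover have "Re r' = Re r"
    using all[of \<i>] by (simp add: p' q' complex_nonneg_Reals_iff)
  ultimately show r': "r' = cnj r" by (simp add: complex_eq_iff)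
  \<comment> \<open>Along l = - t r with t real the form becomes a real quadratic polynomial in
    t.\<close>
  have ineq: "p' - 2 * t * (cmod r)\<^sup>2 + t\<^sup>2 * (cmod r)\<^sup>2 * q' \<ge> 0" for t
  proof -
    have "?g (- of_real t * r) =
      of_real (p' - 2 * t * (cmod r)\<^sup>2 + t\<^sup>2 * (cmod r)\<^sup>2 * q')"
    proof -
      have "?g (- of_real t * r) =
        of_real p' - 2 * of_real t * (r * cnj r) + (of_real t)\<^sup>2 * (r * cnj r) * of_real q'"
        by (simp add: r' p' q' algebra_simps power2_eq_square)
      then show ?thesis by (simp only: complex_norm_square[symmetric]) simp
    qed
    with all[of "- of_real t * r"] show ?thesis
      by (metis nonneg_Reals_of_real_iff)
  qed
  show "(cmod r)\<^sup>2 \<le> Re p * Re q"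
  \<comment> \<open>For q' = 0 the polynomial is affine in t, and if r were nonzero the chosen t
    would give it the value -1. Otherwise it is evaluated at its minimum t = 1 / q'.\<close>
  proof (cases "q' = 0")
    case True
    have "(cmod r)\<^sup>2 = 0"
    proof (rule ccontr)
      assume "(cmod r)\<^sup>2 \<noteq> 0"
      then have "2 * ((p' + 1) / (2 * (cmod r)\<^sup>2)) * (cmod r)\<^sup>2 = p' + 1" by simp
      with ineq[of "(p' + 1) / (2 * (cmod r)\<^sup>2)"] True show False by simp
    qed
    then show ?thesis using True p' q' by simp
  next
    case False
    with q' have "q' > 0" by simp
    with ineq[of "1 / q'"] show ?thesis
      by (simp add: p' q' power2_eq_square field_simps)
  qed
qed

lemma sum_in_nonneg_Reals:
  "(\<And>i. i \<in> I \<Longrightarrow> f i \<in> \<real>\<^sub>\<ge>\<^sub>0) \<Longrightarrow> (\<Sum>i\<in>I. f i) \<in> (\<real>\<^sub>\<ge>\<^sub>0 :: complex set)"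
  by (induction I rule: infinite_finite_induct) auto

section \<open>Positive functionals\<close>

text \<open>Normalization is left out because the integrals of states over a Borel set and the
  functionals a \<mapsto> \<omega>(c* a c) are positive but in general not states.\<close>

definition positive_functional :: "('a::unital_cstar_algebra \<Rightarrow> complex) \<Rightarrow> bool" where
  "positive_functional \<omega> \<longleftrightarrow> (\<forall>a b. \<omega> (a + b) = \<omega> a + \<omega> b) \<and> (\<forall>c a. \<omega> (c *\<^sub>C a) = c * \<omega> a) \<and>
     (\<forall>a. \<omega> (a\<^sup>\<star> * a) \<in> \<real>\<^sub>\<ge>\<^sub>0)"

lemma state_space_iff: "\<phi> \<in> state_space \<longleftrightarrow> positive_functional \<phi> \<and> \<phi> 1 = 1"
  by (auto simp: state_space_def positive_functional_def)

context
  fixes \<omega> :: "'a::unital_cstar_algebra \<Rightarrow> complex"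
  assumes \<omega>: "positive_functional \<omega>"
begin

lemma pf_add: "\<omega> (a + b) = \<omega> a + \<omega> b"
  and pf_scaleC: "\<omega> (c *\<^sub>C a) = c * \<omega> a"
  and pf_nonneg: "\<omega> (a\<^sup>\<star> * a) \<in> \<real>\<^sub>\<ge>\<^sub>0"
  using \<omega> by (auto simp: positive_functional_def)

lemma pf_zero [simp]: "\<omega> 0 = 0"
  using pf_scaleC[of 0 0] by simp

lemma pf_minus: "\<omega> (- a) = - \<omega> a"
  using pf_scaleC[of "-1" a] by (simp add: scaleC_minus_one)

lemma pf_diff: "\<omega> (a - b) = \<omega> a - \<omega> b"
  using pf_add[of a "- b"] by (simp add: pf_minus)

lemma pf_scaleR: "\<omega> (r *\<^sub>R a) = of_real r * \<omega> a"
  by (metis pf_scaleC scaleC_of_real)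

lemma pf_Re_nonneg: "0 \<le> Re (\<omega> (a\<^sup>\<star> * a))"
  and pf_square_real: "\<omega> (a\<^sup>\<star> * a) = of_real (Re (\<omega> (a\<^sup>\<star> * a)))"
  using pf_nonneg[of a] by (auto simp: complex_nonneg_Reals_iff complex_eq_iff)

text \<open>Expanding \<omega> at the square of a + l b gives a form that is nonnegative for every
  complex l; the discriminant argument applies with L the whole plane.\<close>

lemma
  shows pf_cnj: "\<omega> (b\<^sup>\<star> * a) = cnj (\<omega> (a\<^sup>\<star> * b))"
    and pf_Cauchy_Schwarz_square: "(cmod (\<omega> (b\<^sup>\<star> * a)))\<^sup>2 \<le> Re (\<omega> (a\<^sup>\<star> * a)) * Re (\<omega> (b\<^sup>\<star> * b))"
proof -
  have "\<omega> (a\<^sup>\<star> * a) + cnj l * \<omega> (b\<^sup>\<star> * a) + l * \<omega> (a\<^sup>\<star> * b) + cnj l * l * \<omega> (b\<^sup>\<star> * b) \<in> \<real>\<^sub>\<ge>\<^sub>0" for l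
  proof -
    have "\<omega> ((a + l *\<^sub>C b)\<^sup>\<star> * (a + l *\<^sub>C b)) =
      \<omega> (a\<^sup>\<star> * a) + cnj l * \<omega> (b\<^sup>\<star> * a) + l * \<omega> (a\<^sup>\<star> * b) + cnj l * l * \<omega> (b\<^sup>\<star> * b)"
      by (simp add: cstar_add cstar_scaleC distrib_left distrib_right mult_scaleC_left mult_scaleC_right
        pf_add pf_scaleC scaleC_scaleC)
    then show ?thesis using pf_nonneg[of "a + l *\<^sub>C b"] by simp
  qed
  from quadratic_form_nonneg[OF _ pf_nonneg pf_nonneg this, of UNIV]
  show "\<omega> (b\<^sup>\<star> * a) = cnj (\<omega> (a\<^sup>\<star> * b))"
    and "(cmod (\<omega> (b\<^sup>\<star> * a)))\<^sup>2 \<le> Re (\<omega> (a\<^sup>\<star> * a)) * Re (\<omega> (b\<^sup>\<star> * b))"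
    by auto
qed

lemma pf_one_nonneg: "0 \<le> Re (\<omega> 1)"
  using pf_Re_nonneg[of 1] by simp

text \<open>For t > norm a the element 1 - a/t is of the form y* y by the binomial square root, so
  \<omega>(a) <= t \<omega>(1); then t decreases to norm a. The continuity of positive functionals
  comes from here.\<close>

lemma pf_selfadjoint_bound:
  assumes "a\<^sup>\<star> = a"
  shows "Re (\<omega> a) \<le> norm a * Re (\<omega> 1)"
proof (rule dense_ge)
  have *: "Re (\<omega> a) \<le> t * Re (\<omega> 1)" if "norm a < t" for t
  proof -
    have t: "t > 0" using that norm_ge_zero[of a] by linarith
    have "((1/t) *\<^sub>R a)\<^sup>\<star> = (1/t) *\<^sub>R a"
      using assms linear_scale[OF bounded_linear.linear[OF bounded_linear_cstar]] by metis
    moreover have "norm ((1/t) *\<^sub>R a) < 1" using t that by simp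
    ultimately obtain y where y: "1 - (1/t) *\<^sub>R a = y\<^sup>\<star> * y"
      by (rule one_minus_eq_cstar_mult)
    have "0 \<le> Re (\<omega> (1 - (1/t) *\<^sub>R a))" unfolding y by (rule pf_Re_nonneg)
    then show ?thesis using t by (simp add: pf_diff pf_scaleR field_simps)
  qed
  fix z assume z: "norm a * Re (\<omega> 1) < z"
  \<comment> \<open>If \<omega>(1) = 0, any t above norm a gives the claim; otherwise t = z /
    \<omega>(1) is still above norm a.\<close>
  show "Re (\<omega> a) \<le> z"
  proof (cases "Re (\<omega> 1) = 0")
    case True
    with *[of "norm a + 1"] z show ?thesis by simp
  next
    case False
    with pf_one_nonneg have "Re (\<omega> 1) > 0" by simp
    with *[of "z / Re (\<omega> 1)"] z show ?thesis by (simp add: field_simps)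
  qed
qed

lemma pf_square_bound: "Re (\<omega> (a\<^sup>\<star> * a)) \<le> (norm a)\<^sup>2 * Re (\<omega> 1)"
  using pf_selfadjoint_bound[of "a\<^sup>\<star> * a"] by (simp add: cstar_mult cstar_cstar cstar_identity)

lemma pf_bound: "cmod (\<omega> a) \<le> norm a * Re (\<omega> 1)"
proof (rule power2_le_imp_le)
  have "(cmod (\<omega> a))\<^sup>2 \<le> Re (\<omega> (a\<^sup>\<star> * a)) * Re (\<omega> 1)"
    using pf_Cauchy_Schwarz_square[of 1 a] by simp
  also have "\<dots> \<le> (norm a)\<^sup>2 * Re (\<omega> 1) * Re (\<omega> 1)"
    by (intro mult_right_mono pf_square_bound pf_one_nonneg)
  finally show "(cmod (\<omega> a))\<^sup>2 \<le> (norm a * Re (\<omega> 1))\<^sup>2"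
    by (simp add: power2_eq_square algebra_simps)
qed (simp add: pf_one_nonneg)

lemma pf_tendsto:
  assumes "x \<longlonglongrightarrow> a"
  shows "(\<lambda>k. \<omega> (x k)) \<longlonglongrightarrow> \<omega> a"
proof -
  have "(\<lambda>k. norm (x k - a) * Re (\<omega> 1)) \<longlonglongrightarrow> 0 * Re (\<omega> 1)"
    using assms by (intro tendsto_mult tendsto_const tendsto_norm_zero LIM_zero)
  then have lim: "(\<lambda>k. norm (x k - a) * Re (\<omega> 1)) \<longlonglongrightarrow> 0" by simp
  have "\<forall>k. cmod (\<omega> (x k) - \<omega> a) \<le> norm (x k - a) * Re (\<omega> 1)"
    using pf_bound[of "x _ - a"] by (simp add: pf_diff)
  then have "(\<lambda>k. \<omega> (x k) - \<omega> a) \<longlonglongrightarrow> 0"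
    by (rule Lim_null_comparison[OF always_eventually lim])
  then show ?thesis by (rule LIM_zero_cancel)
qed

text \<open>For \<phi> conjugated by b, the square bound of this functional is the boundedness of
  left multiplication in the GNS seminorm.\<close>

lemma positive_functional_conjugate: "positive_functional (\<lambda>a. \<omega> (c\<^sup>\<star> * a * c))"
  unfolding positive_functional_def
proof (intro conjI allI)
  show "\<omega> (c\<^sup>\<star> * (a\<^sup>\<star> * a) * c) \<in> \<real>\<^sub>\<ge>\<^sub>0" for a
    using pf_nonneg[of "a * c"] by (simp add: cstar_mult mult.assoc)
qed (simp_all add: distrib_left distrib_right pf_add mult_scaleC_left mult_scaleC_right pf_scaleC)

end

section \<open>The GNS space\<close>

locale gns_functional =
  fixes \<phi> :: "'a::unital_cstar_algebra \<Rightarrow> complex"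
  assumes positive: "positive_functional \<phi>"
begin

abbreviation seminorm :: "'a \<Rightarrow> real" where "seminorm \<equiv> gns_seminorm \<phi>"
abbreviation H where "H \<equiv> gns_space \<phi>"
abbreviation cls where "cls \<equiv> gns_class \<phi>"
abbreviation vec :: "'a \<Rightarrow> (nat \<Rightarrow> 'a) set" where "vec d \<equiv> cls (\<lambda>_. d)"

lemma seminorm_nonneg [simp]: "0 \<le> seminorm a"
  by (simp add: gns_seminorm_def pf_Re_nonneg[OF positive])

lemma seminorm_square: "(seminorm a)\<^sup>2 = Re (\<phi> (a\<^sup>\<star> * a))"
  by (simp add: gns_seminorm_def pf_Re_nonneg[OF positive])

lemma Cauchy_Schwarz: "cmod (\<phi> (b\<^sup>\<star> * a)) \<le> seminorm a * seminorm b"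
  by (rule power2_le_imp_le)
    (simp_all add: power_mult_distrib seminorm_square pf_Cauchy_Schwarz_square[OF positive])

lemma seminorm_scaleC: "seminorm (c *\<^sub>C a) = cmod c * seminorm a"
proof -
  have "\<phi> ((c *\<^sub>C a)\<^sup>\<star> * (c *\<^sub>C a)) = of_real ((cmod c)\<^sup>2) * \<phi> (a\<^sup>\<star> * a)"
    by (simp only: cstar_scaleC mult_scaleC_left mult_scaleC_right scaleC_scaleC
        pf_scaleC[OF positive] complex_norm_square mult.commute)
  then show ?thesis
    by (simp add: gns_seminorm_def real_sqrt_mult)
qed

lemma seminorm_minus [simp]: "seminorm (- a) = seminorm a"
  using seminorm_scaleC[of "-1" a] by (simp add: scaleC_minus_one)

lemma seminorm_zero [simp]: "seminorm 0 = 0"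
  using seminorm_scaleC[of 0 0] by simp

lemma seminorm_minus_commute: "seminorm (a - b) = seminorm (b - a)"
  using seminorm_minus[of "a - b"] by simp

lemma seminorm_triangle: "seminorm (a + b) \<le> seminorm a + seminorm b"
proof (rule power2_le_imp_le)
  have "(seminorm (a + b))\<^sup>2 = (seminorm a)\<^sup>2 + (seminorm b)\<^sup>2 + 2 * Re (\<phi> (b\<^sup>\<star> * a))"
    using pf_cnj[OF positive, of a b]
    by (simp add: seminorm_square cstar_add distrib_left distrib_right pf_add[OF positive])
  also have "Re (\<phi> (b\<^sup>\<star> * a)) \<le> seminorm a * seminorm b"
    using Cauchy_Schwarz[of b a] complex_Re_le_cmod[of "\<phi> (b\<^sup>\<star> * a)"] by linarith
  finally show "(seminorm (a + b))\<^sup>2 \<le> (seminorm a + seminorm b)\<^sup>2"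
    by (simp add: power2_sum)
qed simp

lemma seminorm_triangle_diff: "seminorm (a - c) \<le> seminorm (a - b) + seminorm (b - c)"
  using seminorm_triangle[of "a - b" "b - c"] by simp

lemma seminorm_diff_ineq: "\<bar>seminorm a - seminorm b\<bar> \<le> seminorm (a - b)"
  using seminorm_triangle[of "a - b" b] seminorm_triangle[of "b - a" a]
  by (simp add: seminorm_minus_commute)

lemma seminorm_mult: "seminorm (a * b) \<le> norm a * seminorm b"
proof (rule power2_le_imp_le)
  show "(seminorm (a * b))\<^sup>2 \<le> (norm a * seminorm b)\<^sup>2"
    using pf_square_bound[OF positive_functional_conjugate[OF positive, of b], of a]
    by (simp add: power_mult_distrib seminorm_square cstar_mult mult.assoc)
qed simp

lemma seminorm_le_norm: "seminorm a \<le> norm a * sqrt (Re (\<phi> 1))"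
  using real_sqrt_le_mono[OF pf_square_bound[OF positive, of a]]
  by (simp add: gns_seminorm_def real_sqrt_mult)

lemma gns_cauchy_const [simp]: "gns_cauchy \<phi> (\<lambda>_. a)"
  by (simp add: gns_cauchy_def)

lemma gns_cauchy_add:
  assumes "gns_cauchy \<phi> x" "gns_cauchy \<phi> y"
  shows "gns_cauchy \<phi> (\<lambda>k. x k + y k)"
  unfolding gns_cauchy_def
proof (intro allI impI)
  fix e :: real assume "e > 0"
  then obtain N N' where
    N: "\<And>m n. m \<ge> N \<Longrightarrow> n \<ge> N \<Longrightarrow> seminorm (x m - x n) < e / 2" and
    N': "\<And>m n. m \<ge> N' \<Longrightarrow> n \<ge> N' \<Longrightarrow> seminorm (y m - y n) < e / 2"
    using assms unfolding gns_cauchy_def by (meson half_gt_zero)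
  have "seminorm (x m + y m - (x n + y n)) < e" if "m \<ge> max N N'" "n \<ge> max N N'" for m n
    using N[of m n] N'[of m n] that seminorm_triangle[of "x m - x n" "y m - y n"]
    by (simp add: add_diff_add)
  then show "\<exists>N. \<forall>m\<ge>N. \<forall>n\<ge>N. seminorm (x m + y m - (x n + y n)) < e" by blast
qed

lemma gns_cauchy_mono:
  assumes "gns_cauchy \<phi> x" and "\<And>m n. seminorm (y m - y n) \<le> K * seminorm (x m - x n)"
  shows "gns_cauchy \<phi> y"
  unfolding gns_cauchy_def
proof (intro allI impI)
  fix e :: real assume e: "e > 0"
  \<comment> \<open>Positive and above K, so that e / K' is positive whatever K is.\<close>
  define K' where "K' = \<bar>K\<bar> + 1"
  have K': "K' > 0" "K \<le> K'" by (auto simp: K'_def)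
  obtain N where N: "\<And>m n. m \<ge> N \<Longrightarrow> n \<ge> N \<Longrightarrow> seminorm (x m - x n) < e / K'"
    using assms(1) e K' unfolding gns_cauchy_def by (meson divide_pos_pos)
  have "seminorm (y m - y n) < e" if "m \<ge> N" "n \<ge> N" for m n
  proof -
    have "seminorm (y m - y n) \<le> K' * seminorm (x m - x n)"
      using assms(2)[of m n] mult_right_mono[OF K'(2) seminorm_nonneg] by (rule order_trans)
    also have "\<dots> < e" using N[OF that] K' by (simp add: field_simps)
    finally show ?thesis .
  qed
  then show "\<exists>N. \<forall>m\<ge>N. \<forall>n\<ge>N. seminorm (y m - y n) < e" by blast
qed

lemma gns_cauchy_scaleC: "gns_cauchy \<phi> x \<Longrightarrow> gns_cauchy \<phi> (\<lambda>k. c *\<^sub>C x k)"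
  by (erule gns_cauchy_mono[where K = "cmod c"])
    (simp add: scaleC_diff_right[symmetric] seminorm_scaleC)

lemma gns_cauchy_mult: "gns_cauchy \<phi> x \<Longrightarrow> gns_cauchy \<phi> (\<lambda>k. a * x k)"
  by (erule gns_cauchy_mono[where K = "norm a"])
    (simp add: right_diff_distrib[symmetric] seminorm_mult)

lemma gns_cauchy_minus: "gns_cauchy \<phi> x \<Longrightarrow> gns_cauchy \<phi> (\<lambda>k. - x k)"
  using gns_cauchy_scaleC[of x "-1"] by (simp add: scaleC_minus_one)

lemma gns_cauchy_diff:
  "gns_cauchy \<phi> x \<Longrightarrow> gns_cauchy \<phi> y \<Longrightarrow> gns_cauchy \<phi> (\<lambda>k. x k - y k)"
  using gns_cauchy_add[OF _ gns_cauchy_minus, of x y] by simp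

lemma gns_cauchy_bounded:
  assumes "gns_cauchy \<phi> x"
  obtains M where "M > 0" "\<And>k. seminorm (x k) \<le> M"
proof -
  have "Cauchy (\<lambda>k. seminorm (x k))"
  proof (rule metric_CauchyI)
    fix e :: real assume "e > 0"
    with assms obtain N where "\<forall>m\<ge>N. \<forall>n\<ge>N. seminorm (x m - x n) < e"
      unfolding gns_cauchy_def by meson
    then have "\<forall>m\<ge>N. \<forall>n\<ge>N. dist (seminorm (x m)) (seminorm (x n)) < e"
      unfolding dist_real_def by (meson seminorm_diff_ineq order_le_less_trans)
    then show "\<exists>N. \<forall>m\<ge>N. \<forall>n\<ge>N. dist (seminorm (x m)) (seminorm (x n)) < e" ..
  qed
  then have "Bseq (\<lambda>k. seminorm (x k))" by (rule Cauchy_Bseq)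
  then obtain M where "M > 0" "\<And>k. norm (seminorm (x k)) \<le> M" unfolding Bseq_def by blast
  then show ?thesis using that[of M] by simp
qed

lemma seminorm_null_comparison:
  assumes "\<And>k. seminorm (z k) \<le> g k" and "g \<longlonglongrightarrow> 0"
  shows "(\<lambda>k. seminorm (z k)) \<longlonglongrightarrow> 0"
  by (rule Lim_null_comparison[OF always_eventually assms(2)]) (simp add: assms(1))

lemma gns_relI:
  "gns_cauchy \<phi> x \<Longrightarrow> gns_cauchy \<phi> y \<Longrightarrow> (\<lambda>k. seminorm (x k - y k)) \<longlonglongrightarrow> 0 \<Longrightarrow> (x, y) \<in> gns_rel \<phi>"
  by (simp add: gns_rel_def)

lemma sym_gns_rel: "sym (gns_rel \<phi>)"
proof (rule symI)
  fix x y assume "(x, y) \<in> gns_rel \<phi>"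
  moreover have "(\<lambda>k. seminorm (y k - x k)) = (\<lambda>k. seminorm (x k - y k))"
    by (rule ext) (rule seminorm_minus_commute)
  ultimately show "(y, x) \<in> gns_rel \<phi>" by (simp add: gns_rel_def)
qed

lemma trans_gns_rel: "trans (gns_rel \<phi>)"
proof (rule transI)
  fix x y z assume xy: "(x, y) \<in> gns_rel \<phi>" and yz: "(y, z) \<in> gns_rel \<phi>"
  let ?g = "\<lambda>k. seminorm (x k - y k) + seminorm (y k - z k)"
  have "(\<lambda>k. seminorm (x k - y k)) \<longlonglongrightarrow> 0" "(\<lambda>k. seminorm (y k - z k)) \<longlonglongrightarrow> 0"
    using xy yz unfolding gns_rel_def by blast+
  then have "?g \<longlonglongrightarrow> 0 + 0" by (rule tendsto_add)
  then have "?g \<longlonglongrightarrow> 0" by simp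
  with seminorm_triangle_diff have "(\<lambda>k. seminorm (x k - z k)) \<longlonglongrightarrow> 0"
    by (rule seminorm_null_comparison)
  with xy yz show "(x, z) \<in> gns_rel \<phi>" unfolding gns_rel_def by blast
qed

lemma equiv_gns_rel: "equiv {x. gns_cauchy \<phi> x} (gns_rel \<phi>)"
proof (rule equivI)
  show "gns_rel \<phi> \<subseteq> {x. gns_cauchy \<phi> x} \<times> {x. gns_cauchy \<phi> x}"
    unfolding gns_rel_def by blast
  show "refl_on {x. gns_cauchy \<phi> x} (gns_rel \<phi>)"
    unfolding refl_on_def gns_rel_def by simp
qed (rule sym_gns_rel trans_gns_rel)+

lemma cls_eqI:
  "gns_cauchy \<phi> x \<Longrightarrow> gns_cauchy \<phi> y \<Longrightarrow> (\<lambda>k. seminorm (x k - y k)) \<longlonglongrightarrow> 0 \<Longrightarrow> cls x = cls y"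
  unfolding gns_class_def by (rule equiv_class_eq[OF equiv_gns_rel gns_relI])

lemma carrier_eq: "hcarrier H = cls ` {x. gns_cauchy \<phi> x}"
  by (auto simp: gns_space_def quotient_def gns_class_def)

lemma cls_carrier [intro, simp]: "gns_cauchy \<phi> x \<Longrightarrow> cls x \<in> hcarrier H"
  by (auto simp: carrier_eq)

lemma carrierE:
  assumes "U \<in> hcarrier H"
  obtains x where "gns_cauchy \<phi> x" "U = cls x"
  using assms by (auto simp: carrier_eq)

text \<open>\<open>gns_space\<close> defines its operations on representatives picked by Hilbert
  choice. This relation lets each operation be recomputed on whichever sequence names the
  class.\<close>

lemma repr_rel: "gns_cauchy \<phi> x \<Longrightarrow> (x, gns_repr (cls x)) \<in> gns_rel \<phi>"
proof -
  assume "gns_cauchy \<phi> x"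
  then have "x \<in> cls x"
    unfolding gns_class_def by (intro equiv_class_self[OF equiv_gns_rel]) simp
  then have "gns_repr (cls x) \<in> cls x" unfolding gns_repr_def by (rule someI[of "\<lambda>z. z \<in> cls x"])
  then show ?thesis by (simp add: gns_class_def)
qed

lemma
  assumes "gns_cauchy \<phi> x"
  shows repr_cauchy: "gns_cauchy \<phi> (gns_repr (cls x))"
    and repr_diff: "(\<lambda>k. seminorm (gns_repr (cls x) k - x k)) \<longlonglongrightarrow> 0"
  using repr_rel[OF assms] symD[OF sym_gns_rel repr_rel[OF assms]]
  by (auto simp: gns_rel_def)

lemma add_cls:
  assumes "gns_cauchy \<phi> x" "gns_cauchy \<phi> y"
  shows "hadd H (cls x) (cls y) = cls (\<lambda>k. x k + y k)"
proof -
  let ?x = "gns_repr (cls x)" and ?y = "gns_repr (cls y)"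
  have "(\<lambda>k. seminorm (?x k - x k) + seminorm (?y k - y k)) \<longlonglongrightarrow> 0 + 0"
    by (intro tendsto_add repr_diff assms)
  then have "(\<lambda>k. seminorm (?x k - x k) + seminorm (?y k - y k)) \<longlonglongrightarrow> 0" by simp
  moreover have "seminorm (?x k + ?y k - (x k + y k)) \<le>
      seminorm (?x k - x k) + seminorm (?y k - y k)" for k
    using seminorm_triangle[of "?x k - x k" "?y k - y k"] by (simp add: add_diff_add)
  ultimately have lim: "(\<lambda>k. seminorm (?x k + ?y k - (x k + y k))) \<longlonglongrightarrow> 0"
    by (rule seminorm_null_comparison[rotated])
  have "hadd H (cls x) (cls y) = cls (\<lambda>k. ?x k + ?y k)" by (simp add: gns_space_def)
  also have "\<dots> = cls (\<lambda>k. x k + y k)"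
    by (rule cls_eqI[OF _ _ lim]; intro gns_cauchy_add repr_cauchy assms)
  finally show ?thesis .
qed

lemma scale_cls:
  assumes "gns_cauchy \<phi> x"
  shows "hscale H c (cls x) = cls (\<lambda>k. c *\<^sub>C x k)"
proof -
  let ?x = "gns_repr (cls x)"
  have "(\<lambda>k. cmod c * seminorm (?x k - x k)) \<longlonglongrightarrow> cmod c * 0"
    by (intro tendsto_mult tendsto_const repr_diff assms)
  then have lim: "(\<lambda>k. seminorm (c *\<^sub>C ?x k - c *\<^sub>C x k)) \<longlonglongrightarrow> 0"
    by (simp add: scaleC_diff_right[symmetric] seminorm_scaleC)
  have "hscale H c (cls x) = cls (\<lambda>k. c *\<^sub>C ?x k)" by (simp add: gns_space_def)
  also have "\<dots> = cls (\<lambda>k. c *\<^sub>C x k)"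
    by (rule cls_eqI[OF _ _ lim]; intro gns_cauchy_scaleC repr_cauchy assms)
  finally show ?thesis .
qed

lemma rep_cls:
  assumes "gns_cauchy \<phi> x"
  shows "gns_rep \<phi> a (cls x) = cls (\<lambda>k. a * x k)"
proof -
  let ?x = "gns_repr (cls x)"
  have "(\<lambda>k. norm a * seminorm (?x k - x k)) \<longlonglongrightarrow> norm a * 0"
    by (intro tendsto_mult tendsto_const repr_diff assms)
  then have "(\<lambda>k. norm a * seminorm (?x k - x k)) \<longlonglongrightarrow> 0" by simp
  moreover have "seminorm (a * ?x k - a * x k) \<le> norm a * seminorm (?x k - x k)" for k
    using seminorm_mult[of a "?x k - x k"] by (simp add: right_diff_distrib)
  ultimately have lim: "(\<lambda>k. seminorm (a * ?x k - a * x k)) \<longlonglongrightarrow> 0"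
    by (rule seminorm_null_comparison[rotated])
  have "gns_rep \<phi> a (cls x) = cls (\<lambda>k. a * ?x k)"
    using assms by (simp add: gns_rep_def)
  also have "\<dots> = cls (\<lambda>k. a * x k)"
    by (rule cls_eqI[OF _ _ lim]; intro gns_cauchy_mult repr_cauchy assms)
  finally show ?thesis .
qed

lemma add_closed: "U \<in> hcarrier H \<Longrightarrow> V \<in> hcarrier H \<Longrightarrow> hadd H U V \<in> hcarrier H"
  by (elim carrierE) (auto simp: add_cls intro!: gns_cauchy_add)

lemma scale_closed: "U \<in> hcarrier H \<Longrightarrow> hscale H c U \<in> hcarrier H"
  by (elim carrierE) (auto simp: scale_cls intro!: gns_cauchy_scaleC)

lemma rep_closed: "U \<in> hcarrier H \<Longrightarrow> gns_rep \<phi> a U \<in> hcarrier H"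
  by (elim carrierE) (auto simp: rep_cls intro!: gns_cauchy_mult)

end

subsection \<open>Bounded sesquilinear forms\<close>

text \<open>A form on A rather than on the completion, controlled by the seminorm so that it passes
  to classes. The inner product, the functionals dominated by \<phi> and the extended kernels are
  all instances, so one construction of limits and operators serves them all.\<close>

definition bounded_form ::
  "('a::unital_cstar_algebra \<Rightarrow> complex) \<Rightarrow> real \<Rightarrow> ('a \<Rightarrow> 'a \<Rightarrow> complex) \<Rightarrow> bool" where
  "bounded_form \<phi> K B \<longleftrightarrow> K \<ge> 0 \<and>
     (\<forall>c c' d. B (c + c') d = B c d + B c' d) \<and> (\<forall>l c d. B (l *\<^sub>C c) d = l * B c d) \<and>
     (\<forall>c d d'. B c (d + d') = B c d + B c d') \<and> (\<forall>l c d. B c (l *\<^sub>C d) = cnj l * B c d) \<and>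
     (\<forall>c d. cmod (B c d) \<le> K * gns_seminorm \<phi> c * gns_seminorm \<phi> d)"

text \<open>Same shape as \<open>hinner\<close> in \<open>gns_space\<close>, so that the inner
  product is by definition the extension of the form \<phi>(d* c).\<close>

definition form_lim :: "('a \<Rightarrow> 'a \<Rightarrow> complex) \<Rightarrow> (nat \<Rightarrow> 'a) set \<Rightarrow> (nat \<Rightarrow> 'a) set \<Rightarrow> complex" where
  "form_lim B U V = lim (\<lambda>k. B (gns_repr U k) (gns_repr V k))"

context gns_functional
begin

context
  fixes K B assumes B: "bounded_form \<phi> K B"
begin

lemma form_add_left: "B (c + c') d = B c d + B c' d"
  and form_scale_left: "B (l *\<^sub>C c) d = l * B c d"
  and form_add_right: "B c (d + d') = B c d + B c d'"
  and form_scale_right: "B c (l *\<^sub>C d) = cnj l * B c d"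
  and form_bound: "cmod (B c d) \<le> K * seminorm c * seminorm d"
  and form_K: "0 \<le> K"
  using B by (auto simp: bounded_form_def)

lemma form_diff_left: "B (c - c') d = B c d - B c' d"
  using form_add_left[of "c - c'" c' d] by (simp add: algebra_simps)

lemma form_diff_right: "B c (d - d') = B c d - B c d'"
  using form_add_right[of c "d - d'" d'] by (simp add: algebra_simps)

lemma form_difference_bound:
  "cmod (B c d - B c' d') \<le> K * (seminorm (c - c') * seminorm d + seminorm c' * seminorm (d - d'))"
proof -
  have "B c d - B c' d' = B (c - c') d + B c' (d - d')"
    by (simp add: form_diff_left form_diff_right)
  then have "cmod (B c d - B c' d') \<le> cmod (B (c - c') d) + cmod (B c' (d - d'))"
    by (simp add: norm_triangle_ineq)
  also have "\<dots> \<le> K * seminorm (c - c') * seminorm d + K * seminorm c' * seminorm (d - d')"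
    by (intro add_mono form_bound)
  finally show ?thesis by (simp add: algebra_simps)
qed

lemma form_convergent:
  assumes "gns_cauchy \<phi> x" "gns_cauchy \<phi> y"
  shows "convergent (\<lambda>k. B (x k) (y k))"
proof -
  obtain M where M: "M > 0" "\<And>k. seminorm (x k) \<le> M"
    using gns_cauchy_bounded[OF assms(1)] by blast
  obtain M' where M': "M' > 0" "\<And>k. seminorm (y k) \<le> M'"
    using gns_cauchy_bounded[OF assms(2)] by blast
  have "Cauchy (\<lambda>k. B (x k) (y k))"
  proof (rule metric_CauchyI)
    fix e :: real assume e: "e > 0"
    \<comment> \<open>The summand 1 keeps the denominator positive when K = 0.\<close>
    define \<delta> where "\<delta> = e / (K * (M + M') + 1)"
    have pos: "K * (M + M') + 1 > 0" using form_K M M' by (intro add_nonneg_pos) auto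
    then have \<delta>: "\<delta> > 0" "K * (M + M') * \<delta> < e"
      using e by (auto simp: \<delta>_def field_simps)
    obtain N N' where
      N: "\<And>m n. m \<ge> N \<Longrightarrow> n \<ge> N \<Longrightarrow> seminorm (x m - x n) < \<delta>" and
      N': "\<And>m n. m \<ge> N' \<Longrightarrow> n \<ge> N' \<Longrightarrow> seminorm (y m - y n) < \<delta>"
      using assms \<delta>(1) unfolding gns_cauchy_def by meson
    have "dist (B (x m) (y m)) (B (x n) (y n)) < e" if "m \<ge> max N N'" "n \<ge> max N N'" for m n
    proof -
      have "dist (B (x m) (y m)) (B (x n) (y n)) \<le>
          K * (seminorm (x m - x n) * seminorm (y m) + seminorm (x n) * seminorm (y m - y n))"
        unfolding dist_norm by (rule form_difference_bound)
      also have "\<dots> \<le> K * (\<delta> * M' + M * \<delta>)"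
        using that N[of m n] N'[of m n] M M' \<delta>
        by (intro mult_left_mono add_mono mult_mono form_K) (auto intro: less_imp_le)
      finally show ?thesis using \<delta> by (simp add: algebra_simps)
    qed
    then show "\<exists>N. \<forall>m\<ge>N. \<forall>n\<ge>N. dist (B (x m) (y m)) (B (x n) (y n)) < e" by blast
  qed
  then show ?thesis by (rule Cauchy_convergent)
qed

text \<open>Independence of the representatives: along a sequence and along the chosen member of its
  class the values of B differ by a null sequence, since representing sequences have bounded
  seminorm.\<close>

lemma form_lim_cls:
  assumes "gns_cauchy \<phi> x" "gns_cauchy \<phi> y"
  shows "(\<lambda>k. B (x k) (y k)) \<longlonglongrightarrow> form_lim B (cls x) (cls y)"
proof -
  let ?x = "gns_repr (cls x)" and ?y = "gns_repr (cls y)"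
  obtain M where M: "M > 0" "\<And>k. seminorm (?x k) \<le> M"
    using gns_cauchy_bounded[OF repr_cauchy[OF assms(1)]] by blast
  obtain M' where M': "M' > 0" "\<And>k. seminorm (y k) \<le> M'"
    using gns_cauchy_bounded[OF assms(2)] by blast
  have lim: "(\<lambda>k. B (?x k) (?y k)) \<longlonglongrightarrow> form_lim B (cls x) (cls y)"
    unfolding form_lim_def
    using form_convergent[OF repr_cauchy repr_cauchy, OF assms] by (simp add: convergent_LIMSEQ_iff)
  have "(\<lambda>k. K * (seminorm (?x k - x k) * M' + M * seminorm (?y k - y k))) \<longlonglongrightarrow> K * (0 * M' + M * 0)"
    by (intro tendsto_mult tendsto_add tendsto_const repr_diff assms)
  then have null: "(\<lambda>k. K * (seminorm (?x k - x k) * M' + M * seminorm (?y k - y k))) \<longlonglongrightarrow> 0"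
    by simp
  have "cmod (B (x k) (y k) - B (?x k) (?y k)) \<le>
      K * (seminorm (?x k - x k) * M' + M * seminorm (?y k - y k))" for k
  proof -
    have "cmod (B (x k) (y k) - B (?x k) (?y k)) \<le>
        K * (seminorm (x k - ?x k) * seminorm (y k) + seminorm (?x k) * seminorm (y k - ?y k))"
      by (rule form_difference_bound)
    also have "\<dots> \<le> K * (seminorm (?x k - x k) * M' + M * seminorm (?y k - y k))"
      using M M'
      by (intro mult_left_mono add_mono mult_mono form_K)
        (auto simp: seminorm_minus_commute[of "x k"] seminorm_minus_commute[of "y k"] intro: less_imp_le)
    finally show ?thesis .
  qed
  then have "(\<lambda>k. B (x k) (y k) - B (?x k) (?y k)) \<longlonglongrightarrow> 0"
    by (intro Lim_null_comparison[OF always_eventually null] allI)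
  from tendsto_add[OF this lim] show ?thesis by simp
qed

lemma form_lim_vec: "form_lim B (vec c) (vec d) = B c d"
  using form_lim_cls[of "\<lambda>_. c" "\<lambda>_. d"] by (simp add: LIMSEQ_const_iff)

text \<open>Classes of constant sequences are dense; through this limit, identities checked against
  every \<open>vec d\<close> extend to the whole space.\<close>

lemma form_lim_vec_limit:
  assumes "U \<in> hcarrier H" "gns_cauchy \<phi> y"
  shows "(\<lambda>l. form_lim B U (vec (y l))) \<longlonglongrightarrow> form_lim B U (cls y)"
proof -
  obtain x where x: "gns_cauchy \<phi> x" "U = cls x" using assms(1) by (rule carrierE)
  obtain M where M: "M > 0" "\<And>k. seminorm (x k) \<le> M"
    using gns_cauchy_bounded[OF x(1)] by blast
  show ?thesis
  proof (rule metric_LIMSEQ_I)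
    fix e :: real assume e: "e > 0"
    define \<delta> where "\<delta> = e / (K * M + 1)"
    have pos: "K * M + 1 > 0" using form_K M by (intro add_nonneg_pos) auto
    then have \<delta>: "\<delta> > 0" "K * M * \<delta> < e"
      using e by (auto simp: \<delta>_def field_simps)
    obtain N where N: "\<And>m n. m \<ge> N \<Longrightarrow> n \<ge> N \<Longrightarrow> seminorm (y m - y n) < \<delta>"
      using assms(2) \<delta>(1) unfolding gns_cauchy_def by meson
    have "dist (form_lim B U (vec (y l))) (form_lim B U (cls y)) < e" if l: "l \<ge> N" for l
    proof -
      \<comment> \<open>With l fixed, the constant sequence y l is compared with the diagonal
        sequence; for k, l \<ge> N the difference costs at most K M \<delta>.\<close>
      have "(\<lambda>k. B (x k) (y l) - B (x k) (y k)) \<longlonglongrightarrow> form_lim B U (vec (y l)) - form_lim B U (cls y)"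
        unfolding x(2) by (intro tendsto_diff form_lim_cls x assms gns_cauchy_const)
      then have "(\<lambda>k. cmod (B (x k) (y l) - B (x k) (y k))) \<longlonglongrightarrow>
          dist (form_lim B U (vec (y l))) (form_lim B U (cls y))"
        unfolding dist_norm by (rule tendsto_norm)
      then have "dist (form_lim B U (vec (y l))) (form_lim B U (cls y)) \<le> K * M * \<delta>"
      proof (rule LIMSEQ_le_const2, intro exI[of _ N] allI impI)
        fix k assume "k \<ge> N"
        have "cmod (B (x k) (y l) - B (x k) (y k)) \<le> K * seminorm (x k) * seminorm (y l - y k)"
          using form_bound[of "x k" "y l - y k"] by (simp add: form_diff_right)
        also have "\<dots> \<le> K * M * \<delta>"
          using M N[OF l \<open>k \<ge> N\<close>] \<delta> form_K by (intro mult_mono) (auto intro: less_imp_le)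
        finally show "cmod (B (x k) (y l) - B (x k) (y k)) \<le> K * M * \<delta>" .
      qed
      with \<delta> show ?thesis by simp
    qed
    then show "\<exists>N. \<forall>l\<ge>N. dist (form_lim B U (vec (y l))) (form_lim B U (cls y)) < e" by blast
  qed
qed

lemma form_lim_add_left:
  assumes "U \<in> hcarrier H" "V \<in> hcarrier H" "W \<in> hcarrier H"
  shows "form_lim B (hadd H U V) W = form_lim B U W + form_lim B V W"
proof -
  obtain x y z where *: "gns_cauchy \<phi> x" "U = cls x" "gns_cauchy \<phi> y" "V = cls y"
    "gns_cauchy \<phi> z" "W = cls z"
    using assms by (auto elim!: carrierE)
  have "(\<lambda>k. B (x k + y k) (z k)) \<longlonglongrightarrow> form_lim B (cls (\<lambda>k. x k + y k)) (cls z)"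
    by (intro form_lim_cls gns_cauchy_add *)
  moreover have "(\<lambda>k. B (x k + y k) (z k)) \<longlonglongrightarrow> form_lim B U W + form_lim B V W"
    unfolding form_add_left * by (intro tendsto_add form_lim_cls *)
  ultimately show ?thesis unfolding * add_cls[OF *(1,3)] by (rule LIMSEQ_unique)
qed

lemma form_lim_scale_left:
  assumes "U \<in> hcarrier H" "W \<in> hcarrier H"
  shows "form_lim B (hscale H c U) W = c * form_lim B U W"
proof -
  obtain x z where *: "gns_cauchy \<phi> x" "U = cls x" "gns_cauchy \<phi> z" "W = cls z"
    using assms by (auto elim!: carrierE)
  have "(\<lambda>k. B (c *\<^sub>C x k) (z k)) \<longlonglongrightarrow> form_lim B (cls (\<lambda>k. c *\<^sub>C x k)) (cls z)"
    by (intro form_lim_cls gns_cauchy_scaleC *)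
  moreover have "(\<lambda>k. B (c *\<^sub>C x k) (z k)) \<longlonglongrightarrow> c * form_lim B U W"
    unfolding form_scale_left * by (intro tendsto_intros form_lim_cls *)
  ultimately show ?thesis unfolding * scale_cls[OF *(1)] by (rule LIMSEQ_unique)
qed

end

lemma inner_form: "bounded_form \<phi> 1 (\<lambda>c d. \<phi> (d\<^sup>\<star> * c))"
  using Cauchy_Schwarz
  by (simp add: bounded_form_def distrib_left distrib_right cstar_add cstar_scaleC mult_scaleC_left
      mult_scaleC_right pf_add[OF positive] pf_scaleC[OF positive])

lemma inner_eq: "hinner H U V = form_lim (\<lambda>c d. \<phi> (d\<^sup>\<star> * c)) U V"
  by (simp add: gns_space_def form_lim_def)

lemmas inner_add_left = form_lim_add_left[OF inner_form, folded inner_eq]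
lemmas inner_scale_left = form_lim_scale_left[OF inner_form, folded inner_eq]
lemmas inner_cls = form_lim_cls[OF inner_form, folded inner_eq]
lemmas inner_vec_limit = form_lim_vec_limit[OF inner_form, folded inner_eq]

lemma inner_cnj:
  assumes "U \<in> hcarrier H" "V \<in> hcarrier H"
  shows "hinner H V U = cnj (hinner H U V)"
proof -
  obtain x y where *: "gns_cauchy \<phi> x" "U = cls x" "gns_cauchy \<phi> y" "V = cls y"
    using assms by (auto elim!: carrierE)
  have "(\<lambda>k. cnj (\<phi> ((y k)\<^sup>\<star> * x k))) \<longlonglongrightarrow> cnj (hinner H U V)"
    unfolding * by (intro tendsto_cnj inner_cls *)
  moreover have "(\<lambda>k. cnj (\<phi> ((y k)\<^sup>\<star> * x k))) \<longlonglongrightarrow> hinner H V U"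
    unfolding * pf_cnj[OF positive, symmetric] by (intro inner_cls *)
  ultimately show ?thesis using LIMSEQ_unique by blast
qed

lemma inner_self:
  assumes "gns_cauchy \<phi> x"
  shows "(\<lambda>k. (seminorm (x k))\<^sup>2) \<longlonglongrightarrow> Re (hinner H (cls x) (cls x))"
  using tendsto_Re[OF inner_cls[OF assms assms]] by (simp add: seminorm_square)

lemma inner_nonneg:
  assumes "U \<in> hcarrier H"
  shows "hinner H U U \<in> \<real>\<^sub>\<ge>\<^sub>0"
proof -
  obtain x where *: "gns_cauchy \<phi> x" "U = cls x" using assms by (rule carrierE)
  show ?thesis unfolding *
    by (rule Lim_in_closed_set[OF closed_nonneg_Reals_complex _ _ inner_cls[OF *(1) *(1)]])
      (auto simp: pf_nonneg[OF positive])
qed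

lemma hnorm_cls:
  assumes "gns_cauchy \<phi> x"
  shows "(\<lambda>k. seminorm (x k)) \<longlonglongrightarrow> hnorm H (cls x)"
  using tendsto_real_sqrt[OF inner_self[OF assms]] by (simp add: hnorm_def)

lemma hnorm_vec: "hnorm H (vec c) = seminorm c"
  using hnorm_cls[of "\<lambda>_. c"] by (simp add: LIMSEQ_const_iff)

text \<open>The difference of the two vectors is orthogonal to the dense set of all
  \<open>vec d\<close>, hence to itself, so its norm is 0. Equations between operators are reduced
  to scalar ones this way.\<close>

lemma carrier_eqI:
  assumes U: "U \<in> hcarrier H" and V: "V \<in> hcarrier H"
    and eq: "\<And>d. hinner H U (vec d) = hinner H V (vec d)"
  shows "U = V"
proof -
  obtain x y where *: "gns_cauchy \<phi> x" "U = cls x" "gns_cauchy \<phi> y" "V = cls y"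
    using U V by (auto elim!: carrierE)
  let ?z = "\<lambda>k. x k - y k"
  have z: "gns_cauchy \<phi> ?z" by (intro gns_cauchy_diff *)
  have "hinner H (cls ?z) (vec d) = 0" for d
  proof -
    have "(\<lambda>k. \<phi> (d\<^sup>\<star> * x k) - \<phi> (d\<^sup>\<star> * y k)) \<longlonglongrightarrow> hinner H U (vec d) - hinner H V (vec d)"
      unfolding * by (intro tendsto_diff inner_cls gns_cauchy_const *)
    then have "(\<lambda>k. \<phi> (d\<^sup>\<star> * ?z k)) \<longlonglongrightarrow> 0"
      by (simp add: eq right_diff_distrib pf_diff[OF positive])
    with inner_cls[OF z gns_cauchy_const, of d] show ?thesis by (rule LIMSEQ_unique)
  qed
  with inner_vec_limit[OF cls_carrier[OF z] z] have "hinner H (cls ?z) (cls ?z) = 0"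
    by (simp add: LIMSEQ_const_iff)
  with hnorm_cls[OF z] have "(\<lambda>k. seminorm (x k - y k)) \<longlonglongrightarrow> 0"
    by (simp add: hnorm_def)
  then show ?thesis unfolding *(2,4) by (rule cls_eqI[OF *(1,3)])
qed

lemma inner_rep:
  assumes "U \<in> hcarrier H"
  shows "hinner H (gns_rep \<phi> a U) (vec d) = hinner H U (vec (a\<^sup>\<star> * d))"
proof -
  obtain x where *: "gns_cauchy \<phi> x" "U = cls x" using assms by (rule carrierE)
  have "(\<lambda>k. \<phi> (d\<^sup>\<star> * (a * x k))) \<longlonglongrightarrow> hinner H (gns_rep \<phi> a U) (vec d)"
    unfolding * rep_cls[OF *(1)] by (intro inner_cls gns_cauchy_const gns_cauchy_mult *)
  moreover have "(\<lambda>k. \<phi> ((a\<^sup>\<star> * d)\<^sup>\<star> * x k)) \<longlonglongrightarrow> hinner H U (vec (a\<^sup>\<star> * d))"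
    unfolding * by (intro inner_cls gns_cauchy_const *)
  moreover have "(a\<^sup>\<star> * d)\<^sup>\<star> * x k = d\<^sup>\<star> * (a * x k)" for k
    by (simp add: cstar_mult cstar_cstar mult.assoc)
  ultimately show ?thesis using LIMSEQ_unique by auto
qed

end

context gns_functional
begin

lemma seminorm_add_square:
  "(seminorm (a + b))\<^sup>2 = (seminorm a)\<^sup>2 + 2 * Re (\<phi> (b\<^sup>\<star> * a)) + (seminorm b)\<^sup>2"
  using pf_cnj[OF positive, of a b]
  by (simp add: seminorm_square cstar_add distrib_left distrib_right pf_add[OF positive])

lemma seminorm_parallelogram:
  "(seminorm (a + b))\<^sup>2 + (seminorm (a - b))\<^sup>2 = 2 * (seminorm a)\<^sup>2 + 2 * (seminorm b)\<^sup>2"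
  using seminorm_add_square[of a b] seminorm_add_square[of a "- b"]
  by (simp add: cstar_minus pf_minus[OF positive])

text \<open>
  The Riesz representation theorem. A minimising sequence of \<open>\<parallel>d\<parallel>\<^sup>2 - 2 Re (L d)\<close> is Cauchy by the
  parallelogram law, and its class represents \<open>L\<close>.
\<close>

lemma riesz:
  assumes L_add: "\<And>d d'. L (d + d') = L d + L d'"
    and L_scale: "\<And>l d. L (l *\<^sub>C d) = cnj l * L d"
    and L_bound: "\<And>d. cmod (L d) \<le> K * seminorm d"
  obtains z where "gns_cauchy \<phi> z" and "\<And>d. (\<lambda>n. \<phi> (d\<^sup>\<star> * z n)) \<longlonglongrightarrow> L d"
proof -
  define J where "J d = (seminorm d)\<^sup>2 - 2 * Re (L d)" for d
  \<comment> \<open>Completing the square: J d \<ge> (seminorm d - K)^2 - K^2.\<close>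
  have J_lower: "- K\<^sup>2 \<le> J d" for d
  proof -
    have "Re (L d) \<le> K * seminorm d"
      using complex_Re_le_cmod[of "L d"] L_bound[of d] by linarith
    moreover have "0 \<le> (seminorm d - K)\<^sup>2" by simp
    ultimately show ?thesis by (simp add: J_def power2_diff mult.commute)
  qed
  then have bdd: "bdd_below (range J)" by (rule bdd_belowI2)
  define m where "m = Inf (range J)"
  have m: "m \<le> J d" for d unfolding m_def by (rule cInf_lower[OF _ bdd]) simp
  have "\<exists>d. J d < m + 1 / Suc n" for n
    using cInf_lessD[of "range J" "m + 1 / Suc n"] by (auto simp: m_def)
  then obtain z where z: "\<And>n. J (z n) < m + 1 / Suc n" by metis
  have J_mid: "(seminorm (a - b))\<^sup>2 = 2 * J a + 2 * J b - 4 * J ((1/2) *\<^sub>C (a + b))" for a b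
    using seminorm_parallelogram[of a b]
    by (simp add: J_def L_scale L_add seminorm_scaleC power_divide field_simps)
  have small: "(seminorm (z i - z j))\<^sup>2 < 2 / Suc i + 2 / Suc j" for i j
    unfolding J_mid using z[of i] z[of j] m[of "(1/2) *\<^sub>C (z i + z j)"] by simp
  have cauchy: "gns_cauchy \<phi> z"
    unfolding gns_cauchy_def
  proof (intro allI impI)
    fix e :: real assume e: "e > 0"
    then obtain N :: nat where N: "4 / e\<^sup>2 < Suc N"
      by (meson less_SucI of_nat_less_iff reals_Archimedean2 less_trans lessI)
    have "seminorm (z i - z j) < e" if "i \<ge> N" "j \<ge> N" for i j
    proof -
      have "(seminorm (z i - z j))\<^sup>2 < 2 / Suc i + 2 / Suc j" by (rule small)
      also have "\<dots> \<le> 2 / Suc N + 2 / Suc N"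
        using that by (intro add_mono divide_left_mono) auto
      also have "\<dots> = 4 / Suc N" by simp
      also have "\<dots> < e\<^sup>2" using N e by (simp add: field_simps)
      finally show ?thesis using e by (simp add: power2_less_imp_less)
    qed
    then show "\<exists>N. \<forall>m\<ge>N. \<forall>n\<ge>N. seminorm (z m - z n) < e" by blast
  qed
  have "(\<lambda>n. \<phi> (d\<^sup>\<star> * z n)) \<longlonglongrightarrow> L d" for d
  proof -
    let ?w = "\<lambda>n. \<phi> (d\<^sup>\<star> * z n) - L d"
    define q where "q = (seminorm d)\<^sup>2"
    \<comment> \<open>Step length for the variation of z n in the direction of d. The best value
      would be 1 / q; this one is also defined for q = 0, and t q \<le> 1 leaves at least half of
      the first order gain.\<close>
    define t where "t = 1 / (1 + q)"
    have q: "q \<ge> 0" by (simp add: q_def)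
    then have t: "t > 0" "t * q \<le> 1" by (auto simp: t_def field_simps)
    \<comment> \<open>Up to a factor 2, \<open>?w n\<close> is the derivative of J at z n in the
      direction of d. As J (z n) is within 1 / Suc n of the infimum, a step against it cannot lower
      J by more than that.\<close>
    have bound: "(cmod (?w n))\<^sup>2 \<le> (1 + q) * (1 / Suc n)" for n
    proof -
      let ?s = "(cmod (?w n))\<^sup>2"
      define l where "l = - of_real t * ?w n"
      have l: "Re (cnj l * ?w n) = - t * ?s" "(cmod l)\<^sup>2 = t\<^sup>2 * ?s"
        by (simp_all add: l_def norm_mult power_mult_distrib cmod_power2)
          (simp add: power2_eq_square algebra_simps)
      have "J (z n + l *\<^sub>C d) = J (z n) + 2 * Re (cnj l * ?w n) + (cmod l)\<^sup>2 * q"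
        by (simp add: J_def seminorm_add_square L_add L_scale cstar_scaleC mult_scaleC_left
            pf_scaleC[OF positive] seminorm_scaleC power_mult_distrib q_def algebra_simps)
      also have "\<dots> = J (z n) - 2 * t * ?s + t * (t * q) * ?s"
        unfolding l by (simp add: power2_eq_square)
      also have "\<dots> \<le> J (z n) - 2 * t * ?s + t * 1 * ?s"
        using t by (intro add_left_mono mult_right_mono mult_left_mono) auto
      finally have "m \<le> J (z n) - t * ?s" using m[of "z n + l *\<^sub>C d"] by simp
      with z[of n] have "t * ?s \<le> 1 / Suc n" by simp
      then have "(1 + q) * (t * ?s) \<le> (1 + q) * (1 / Suc n)"
        using q by (intro mult_left_mono) auto
      then show ?thesis using q by (simp add: t_def)
    qed
    have "(\<lambda>n. (1 + q) * (1 / real (Suc n))) \<longlonglongrightarrow> (1 + q) * 0"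
      by (intro tendsto_mult tendsto_const LIMSEQ_Suc[OF lim_1_over_n])
    then have lim: "(\<lambda>n. (1 + q) * (1 / real (Suc n))) \<longlonglongrightarrow> 0" by simp
    have "(\<lambda>n. (cmod (?w n))\<^sup>2) \<longlonglongrightarrow> 0"
      by (rule Lim_null_comparison[OF always_eventually lim]) (use bound in auto)
    from tendsto_real_sqrt[OF this] have "(\<lambda>n. cmod (?w n)) \<longlonglongrightarrow> 0" by simp
    then have "?w \<longlonglongrightarrow> 0" by (rule tendsto_norm_zero_cancel)
    then show ?thesis by (simp add: LIM_zero_iff)
  qed
  with cauchy show ?thesis by (rule that)
qed

subsection \<open>The operator of a bounded form\<close>

lemma hnorm_square: "U \<in> hcarrier H \<Longrightarrow> (hnorm H U)\<^sup>2 = Re (hinner H U U)"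
  and hnorm_nonneg: "U \<in> hcarrier H \<Longrightarrow> 0 \<le> hnorm H U"
  using inner_nonneg[of U] by (auto simp: hnorm_def complex_nonneg_Reals_iff)

text \<open>The Riesz vector of the functional d \<mapsto> B(U, d), unique by
  \<open>carrier_eqI\<close>. Restriction to the carrier makes the operator extensional, as
  \<open>bounded_operators\<close> demands.\<close>

definition form_operator ::
  "('a \<Rightarrow> 'a \<Rightarrow> complex) \<Rightarrow> (nat \<Rightarrow> 'a) set \<Rightarrow> (nat \<Rightarrow> 'a) set" where
  "form_operator B = (\<lambda>U\<in>hcarrier H. SOME W. W \<in> hcarrier H \<and>
     (\<forall>d. hinner H W (vec d) = form_lim B U (vec d)))"

context
  fixes K B assumes B: "bounded_form \<phi> K B"
begin

lemma form_lim_bound: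
  assumes "U \<in> hcarrier H" "V \<in> hcarrier H"
  shows "cmod (form_lim B U V) \<le> K * hnorm H U * hnorm H V"
proof -
  obtain x y where *: "gns_cauchy \<phi> x" "U = cls x" "gns_cauchy \<phi> y" "V = cls y"
    using assms by (auto elim!: carrierE)
  have "(\<lambda>k. cmod (B (x k) (y k))) \<longlonglongrightarrow> cmod (form_lim B U V)"
    unfolding * by (intro tendsto_norm form_lim_cls[OF B] *)
  moreover have "(\<lambda>k. K * seminorm (x k) * seminorm (y k)) \<longlonglongrightarrow> K * hnorm H U * hnorm H V"
    unfolding * by (intro tendsto_mult tendsto_const hnorm_cls *)
  ultimately show ?thesis
    by (rule LIMSEQ_le) (use form_bound[OF B] in auto)
qed

lemma
  assumes U: "U \<in> hcarrier H"
  shows form_lim_vec_add: "form_lim B U (vec (d + d')) = form_lim B U (vec d) + form_lim B U (vec d')"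
    and form_lim_vec_scale: "form_lim B U (vec (l *\<^sub>C d)) = cnj l * form_lim B U (vec d)"
proof -
  obtain x where x: "gns_cauchy \<phi> x" "U = cls x" using U by (rule carrierE)
  note lim = form_lim_cls[OF B x(1) gns_cauchy_const, folded x(2)]
  show "form_lim B U (vec (d + d')) = form_lim B U (vec d) + form_lim B U (vec d')"
    using tendsto_add[OF lim[of d] lim[of d']] lim[of "d + d'"]
    unfolding form_add_right[OF B] by (rule LIMSEQ_unique[rotated])
  show "form_lim B U (vec (l *\<^sub>C d)) = cnj l * form_lim B U (vec d)"
    using tendsto_mult_left[OF lim[of d], of "cnj l"] lim[of "l *\<^sub>C d"]
    unfolding form_scale_right[OF B] by (rule LIMSEQ_unique[rotated])
qed

lemma form_operator_exists:
  assumes U: "U \<in> hcarrier H"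
  shows "\<exists>W. W \<in> hcarrier H \<and> (\<forall>d. hinner H W (vec d) = form_lim B U (vec d))"
proof -
  let ?L = "\<lambda>d. form_lim B U (vec d)"
  have "cmod (?L d) \<le> K * hnorm H U * seminorm d" for d
    using form_lim_bound[OF U, of "vec d"] by (simp add: hnorm_vec)
  then obtain z where z: "gns_cauchy \<phi> z" "\<And>d. (\<lambda>n. \<phi> (d\<^sup>\<star> * z n)) \<longlonglongrightarrow> ?L d"
    using riesz[of ?L "K * hnorm H U"] form_lim_vec_add[OF U] form_lim_vec_scale[OF U] by blast
  have "hinner H (cls z) (vec d) = ?L d" for d
    using inner_cls[OF z(1) gns_cauchy_const] z(2) by (rule LIMSEQ_unique)
  with z(1) show ?thesis by blast
qed

lemma form_operator_closed: "U \<in> hcarrier H \<Longrightarrow> form_operator B U \<in> hcarrier H"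
  and form_operator_vec:
    "U \<in> hcarrier H \<Longrightarrow> hinner H (form_operator B U) (vec d) = form_lim B U (vec d)"
  using someI_ex[OF form_operator_exists] by (auto simp: form_operator_def)

lemma form_operator_inner:
  assumes "U \<in> hcarrier H" "V \<in> hcarrier H"
  shows "hinner H (form_operator B U) V = form_lim B U V"
proof -
  obtain y where y: "gns_cauchy \<phi> y" "V = cls y" using assms(2) by (rule carrierE)
  from inner_vec_limit[OF form_operator_closed[OF assms(1)] y(1)] form_lim_vec_limit[OF B assms(1) y(1)]
  show ?thesis unfolding form_operator_vec[OF assms(1)] y(2) by (rule LIMSEQ_unique)
qed

lemma form_operator_bounded: "form_operator B \<in> bounded_operators H"
proof -
  note cl = form_operator_closed add_closed scale_closed
  have "form_operator B (hadd H U V) = hadd H (form_operator B U) (form_operator B V)"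
    if "U \<in> hcarrier H" "V \<in> hcarrier H" for U V
    by (rule carrier_eqI)
      (simp_all add: cl that form_operator_vec inner_add_left form_lim_add_left[OF B])
  moreover have "form_operator B (hscale H c U) = hscale H c (form_operator B U)"
    if "U \<in> hcarrier H" for c U
    by (rule carrier_eqI)
      (simp_all add: cl that form_operator_vec inner_scale_left form_lim_scale_left[OF B])
  moreover have "hnorm H (form_operator B U) \<le> K * hnorm H U" if U: "U \<in> hcarrier H" for U
  proof -
    let ?W = "form_operator B U"
    have W: "?W \<in> hcarrier H" by (rule form_operator_closed[OF U])
    \<comment> \<open>W tested against itself: its squared norm is the form at (U, W), and one
      factor of the norm of W cancels.\<close>
    have "(hnorm H ?W)\<^sup>2 \<le> cmod (form_lim B U ?W)"
      using complex_Re_le_cmod[of "form_lim B U ?W"]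
      by (simp add: hnorm_square[OF W] form_operator_inner[OF U W])
    also have "\<dots> \<le> K * hnorm H U * hnorm H ?W" by (rule form_lim_bound[OF U W])
    finally have le: "hnorm H ?W * hnorm H ?W \<le> K * hnorm H U * hnorm H ?W"
      by (simp add: power2_eq_square)
    show ?thesis
    proof (cases "hnorm H ?W = 0")
      case True
      then show ?thesis using form_K[OF B] hnorm_nonneg[OF U] by simp
    next
      case False
      then show ?thesis using le hnorm_nonneg[OF W] by simp
    qed
  qed
  moreover have "form_operator B \<in> hcarrier H \<rightarrow>\<^sub>E hcarrier H"
    by (rule PiE_I) (simp_all add: form_operator_closed, simp add: form_operator_def)
  ultimately show ?thesis unfolding bounded_operators_def by blast
qed

end

subsection \<open>Products of commuting positive operators\<close>

lemma inner_add_right: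
  assumes "U \<in> hcarrier H" "V \<in> hcarrier H" "W \<in> hcarrier H"
  shows "hinner H W (hadd H U V) = hinner H W U + hinner H W V"
  using assms by (simp add: inner_cnj[of _ W] add_closed inner_add_left)

lemma inner_scale_right:
  assumes "U \<in> hcarrier H" "W \<in> hcarrier H"
  shows "hinner H W (hscale H c U) = cnj c * hinner H W U"
  using assms by (simp add: inner_cnj[of _ W] scale_closed inner_scale_left)

lemma inner_Cauchy_Schwarz:
  "U \<in> hcarrier H \<Longrightarrow> V \<in> hcarrier H \<Longrightarrow> cmod (hinner H U V) \<le> hnorm H U * hnorm H V"
  using form_lim_bound[OF inner_form] by (simp add: inner_eq)

definition hdiff :: "(nat \<Rightarrow> 'a) set \<Rightarrow> (nat \<Rightarrow> 'a) set \<Rightarrow> (nat \<Rightarrow> 'a) set" where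
  "hdiff U V = hadd H U (hscale H (-1) V)"

lemma diff_closed: "U \<in> hcarrier H \<Longrightarrow> V \<in> hcarrier H \<Longrightarrow> hdiff U V \<in> hcarrier H"
  by (simp add: hdiff_def add_closed scale_closed)

lemma inner_diff_left:
  "U \<in> hcarrier H \<Longrightarrow> V \<in> hcarrier H \<Longrightarrow> W \<in> hcarrier H \<Longrightarrow>
    hinner H (hdiff U V) W = hinner H U W - hinner H V W"
  by (simp add: hdiff_def scale_closed inner_add_left inner_scale_left)

lemma inner_diff_right:
  "U \<in> hcarrier H \<Longrightarrow> V \<in> hcarrier H \<Longrightarrow> W \<in> hcarrier H \<Longrightarrow>
    hinner H W (hdiff U V) = hinner H W U - hinner H W V"
  by (simp add: hdiff_def scale_closed inner_add_right inner_scale_right)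

lemma
  assumes "T \<in> bounded_operators H" and "U \<in> hcarrier H"
  shows operator_closed: "T U \<in> hcarrier H"
    and operator_diff: "V \<in> hcarrier H \<Longrightarrow> T (hdiff U V) = hdiff (T U) (T V)"
  using assms by (auto simp: bounded_operators_def hdiff_def scale_closed)

text \<open>The inequality 0 <= T <= 1 in terms of the quadratic form. Linearity enters through
  symmetry, which moves T onto the other argument, where the inner product is additive.\<close>

definition positive_contraction :: "((nat \<Rightarrow> 'a) set \<Rightarrow> (nat \<Rightarrow> 'a) set) \<Rightarrow> bool" where
  "positive_contraction T \<longleftrightarrow> (\<forall>U\<in>hcarrier H. T U \<in> hcarrier H) \<and>
     (\<forall>U\<in>hcarrier H. \<forall>V\<in>hcarrier H. hinner H (T U) V = hinner H U (T V)) \<and>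
     (\<forall>U\<in>hcarrier H. 0 \<le> Re (hinner H (T U) U) \<and> Re (hinner H (T U) U) \<le> Re (hinner H U U))"

text \<open>This is T^2 <= T. Cauchy-Schwarz for the form <T U, V> at U and Y = T U bounds the
  fourth power of the norm of Y by <T U, U> <T Y, Y>, and T <= 1 bounds the last factor by the
  square of that norm, which cancels.\<close>

lemma positive_contraction_square:
  assumes T: "positive_contraction T" and U: "U \<in> hcarrier H"
  shows "(hnorm H (T U))\<^sup>2 \<le> Re (hinner H (T U) U)"
proof -
  have cl: "\<And>V. V \<in> hcarrier H \<Longrightarrow> T V \<in> hcarrier H"
    and sym: "\<And>V W. V \<in> hcarrier H \<Longrightarrow> W \<in> hcarrier H \<Longrightarrow> hinner H (T V) W = hinner H V (T W)"
    using T by (auto simp: positive_contraction_def)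
  have nonneg: "hinner H (T V) V \<in> \<real>\<^sub>\<ge>\<^sub>0" if "V \<in> hcarrier H" for V
  proof -
    have "hinner H (T V) V = cnj (hinner H (T V) V)"
      using that by (metis cl inner_cnj sym)
    then have "Im (hinner H (T V) V) = 0" by (simp add: complex_eq_iff)
    with T that show ?thesis by (auto simp: positive_contraction_def complex_nonneg_Reals_iff)
  qed
  let ?Y = "T U"
  let ?s = "(hnorm H ?Y)\<^sup>2"
  have Y: "?Y \<in> hcarrier H" by (rule cl[OF U])
  have "hinner H (T U) U + cnj l * hinner H (T U) ?Y + l * hinner H (T ?Y) U
      + cnj l * l * hinner H (T ?Y) ?Y \<in> \<real>\<^sub>\<ge>\<^sub>0" for l
  proof -
    let ?W = "hadd H U (hscale H l ?Y)"
    have W: "?W \<in> hcarrier H" by (simp add: U Y add_closed scale_closed)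
    have "hinner H (T ?W) ?W = hinner H ?W (T U) + cnj l * hinner H ?W (T ?Y)"
      by (simp add: U Y W cl sym inner_add_right inner_scale_right scale_closed)
    also have "\<dots> = hinner H U (T U) + l * hinner H ?Y (T U) +
        cnj l * (hinner H U (T ?Y) + l * hinner H ?Y (T ?Y))"
      by (simp add: U Y cl inner_add_left inner_scale_left scale_closed)
    also have "\<dots> = hinner H (T U) U + cnj l * hinner H (T U) ?Y + l * hinner H (T ?Y) U
      + cnj l * l * hinner H (T ?Y) ?Y"
      using sym[OF U U] sym[OF U Y] sym[OF Y U] sym[OF Y Y] by (simp add: algebra_simps)
    finally show ?thesis using nonneg[OF W] by simp
  qed
  from quadratic_form_nonneg(2)[OF _ nonneg[OF Y] nonneg[OF U] this, of UNIV]
  have "(cmod (hinner H ?Y ?Y))\<^sup>2 \<le> Re (hinner H (T U) U) * Re (hinner H (T ?Y) ?Y)" by simp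
  also have "\<dots> \<le> Re (hinner H (T U) U) * ?s"
    using T U Y unfolding positive_contraction_def hnorm_square[OF Y] by (intro mult_left_mono) blast+
  finally have "(cmod (hinner H ?Y ?Y))\<^sup>2 \<le> Re (hinner H (T U) U) * ?s" .
  moreover have "cmod (hinner H ?Y ?Y) = ?s"
    using inner_nonneg[OF Y] by (simp add: hnorm_square[OF Y] cmod_eq_Re complex_nonneg_Reals_iff)
  ultimately have "?s * ?s \<le> Re (hinner H (T U) U) * ?s" by (simp add: power2_eq_square)
  moreover have "?s = 0 \<or> ?s > 0" by simp
  ultimately show ?thesis
    using nonneg[OF U] by (metis complex_nonneg_Reals_iff mult_right_le_imp_le)
qed

fun deflation :: "((nat \<Rightarrow> 'a) set \<Rightarrow> (nat \<Rightarrow> 'a) set) \<Rightarrow> nat \<Rightarrow> (nat \<Rightarrow> 'a) set \<Rightarrow> (nat \<Rightarrow> 'a) set" where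
  "deflation T 0 = T"
| "deflation T (Suc k) = (\<lambda>U. hdiff (deflation T k U) (deflation T k (deflation T k U)))"

lemma deflation_inner:
  assumes "positive_contraction (deflation T k)" "U \<in> hcarrier H" "V \<in> hcarrier H"
  shows "hinner H (deflation T (Suc k) U) V =
    hinner H (deflation T k U) V - hinner H (deflation T k U) (deflation T k V)"
  using assms by (simp add: positive_contraction_def inner_diff_left)

text \<open>With R^2 <= R for the current operator, R - R^2 is positive, and it stays below R and so
  below 1.\<close>

lemma positive_contraction_deflation:
  assumes "positive_contraction T"
  shows "positive_contraction (deflation T k)"
proof (induction k)
  case (Suc k)
  let ?R = "deflation T k"
  have cl: "\<And>V. V \<in> hcarrier H \<Longrightarrow> ?R V \<in> hcarrier H"
    and sym: "\<And>V W. V \<in> hcarrier H \<Longrightarrow> W \<in> hcarrier H \<Longrightarrow> hinner H (?R V) W = hinner H V (?R W)"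
    and le: "\<And>V. V \<in> hcarrier H \<Longrightarrow> Re (hinner H (?R V) V) \<le> Re (hinner H V V)"
    using Suc by (auto simp: positive_contraction_def)
  have "hinner H (deflation T (Suc k) U) V = hinner H U (deflation T (Suc k) V)"
    if "U \<in> hcarrier H" "V \<in> hcarrier H" for U V
    using that by (simp add: cl sym inner_diff_left inner_diff_right)
  moreover have "Re (hinner H (deflation T (Suc k) U) U) = Re (hinner H (?R U) U) - (hnorm H (?R U))\<^sup>2"
    if "U \<in> hcarrier H" for U
    using that by (simp only: deflation_inner[OF Suc that that] hnorm_square[OF cl[OF that]] minus_complex.sel)
  ultimately show ?case
    unfolding positive_contraction_def
    using positive_contraction_square[OF Suc] le
    by (auto simp: cl diff_closed intro: order_trans[OF _ le] simp del: deflation.simps(1))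
qed (simp add: assms)

lemma deflation_commute:
  assumes "positive_contraction T" and P: "P \<in> bounded_operators H"
    and comm: "\<And>U. U \<in> hcarrier H \<Longrightarrow> P (T U) = T (P U)"
  shows "U \<in> hcarrier H \<Longrightarrow> P (deflation T k U) = deflation T k (P U)"
proof (induction k arbitrary: U)
  case (Suc k)
  have cl: "\<And>V. V \<in> hcarrier H \<Longrightarrow> deflation T k V \<in> hcarrier H"
    using positive_contraction_deflation[OF assms(1)] by (auto simp: positive_contraction_def)
  show ?case
    using Suc by (simp add: operator_diff[OF P] cl)
qed (simp add: comm)

text \<open>
  F. Riesz: with \<open>R\<^sub>0 = T\<close> and \<open>R\<^sub>k\<^sub>+\<^sub>1 = R\<^sub>k - R\<^sub>k\<^sup>2\<close> one has \<open>T = \<Sum>\<^sub>k R\<^sub>k\<^sup>2\<close> strongly, hence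
  \<open>P T = \<Sum>\<^sub>k R\<^sub>k P R\<^sub>k\<close>, and no square root of \<open>T\<close> is needed.
\<close>

lemma positive_operator_matrix_commuting:
  assumes T: "positive_contraction T"
    and P: "\<And>i j. i < n \<Longrightarrow> j < n \<Longrightarrow> P i j \<in> bounded_operators H"
    and comm: "\<And>i j U. i < n \<Longrightarrow> j < n \<Longrightarrow> U \<in> hcarrier H \<Longrightarrow> P i j (T U) = T (P i j U)"
    and pos: "positive_operator_matrix H n P"
  shows "positive_operator_matrix H n (\<lambda>i j U. P i j (T U))"
  unfolding positive_operator_matrix_def
proof (intro allI impI)
  fix h assume h: "\<forall>i<n. h i \<in> hcarrier H"
  let ?R = "deflation T"
  define Q where "Q k = (\<Sum>i<n. \<Sum>j<n. hinner H (P i j (?R k (h j))) (h i))" for k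
  have R: "positive_contraction (?R k)" for k by (rule positive_contraction_deflation[OF T])
  have cl: "\<And>V k. V \<in> hcarrier H \<Longrightarrow> ?R k V \<in> hcarrier H"
    and sym: "\<And>V W k. V \<in> hcarrier H \<Longrightarrow> W \<in> hcarrier H \<Longrightarrow> hinner H (?R k V) W = hinner H V (?R k W)"
    using R by (auto simp: positive_contraction_def)
  \<comment> \<open>P commutes with R_k and R_k is symmetric, so the terms with R_k^2 are those of P
    at the vectors R_k h_i, where positivity of P applies.\<close>
  have step: "Q k - Q (Suc k) \<in> \<real>\<^sub>\<ge>\<^sub>0" for k
  proof -
    have "hinner H (P i j (?R k (h j))) (h i) - hinner H (P i j (?R (Suc k) (h j))) (h i) =
        hinner H (P i j (?R k (h j))) (?R k (h i))" if "i < n" "j < n" for i j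
    proof -
      note Pij = P[OF that] and hi = h[rule_format, OF that(1)] and hj = h[rule_format, OF that(2)]
      have "P i j (?R k (?R k (h j))) = ?R k (P i j (?R k (h j)))"
        by (rule deflation_commute[OF T Pij comm[OF that] cl[OF hj]])
      then show ?thesis
        by (simp add: operator_diff[OF Pij] operator_closed[OF Pij] cl hi hj inner_diff_left sym
            del: deflation.simps(1))
    qed
    then have "Q k - Q (Suc k) = (\<Sum>i<n. \<Sum>j<n. hinner H (P i j (?R k (h j))) (?R k (h i)))"
      unfolding Q_def sum_subtractf[symmetric] by (intro sum.cong refl) auto
    also have "\<dots> \<in> \<real>\<^sub>\<ge>\<^sub>0"
      using pos h cl unfolding positive_operator_matrix_def by auto
    finally show ?thesis .
  qed
  \<comment> \<open>The squared norms telescope, so their sum is at most <T U, U> and they tend to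
    0; by boundedness of P the sums Q k vanish in the limit.\<close>
  have null: "(\<lambda>k. hnorm H (?R k U)) \<longlonglongrightarrow> 0" if U: "U \<in> hcarrier H" for U
  proof -
    have "(\<Sum>k<m. (hnorm H (?R k U))\<^sup>2) = Re (hinner H (?R 0 U) U) - Re (hinner H (?R m U) U)" for m
    proof (induction m)
      case (Suc m)
      have "Re (hinner H (?R (Suc m) U) U) = Re (hinner H (?R m U) U) - (hnorm H (?R m U))\<^sup>2"
        by (simp only: deflation_inner[OF R U U] hnorm_square[OF cl[OF U]] minus_complex.sel)
      then show ?case using Suc by simp
    qed simp
    moreover have "0 \<le> Re (hinner H (?R m U) U)" for m
      using R U unfolding positive_contraction_def by blast
    ultimately have "(\<Sum>k<m. (hnorm H (?R k U))\<^sup>2) \<le> Re (hinner H (?R 0 U) U)" for m by simp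
    then have "summable (\<lambda>k. (hnorm H (?R k U))\<^sup>2)"
      by (intro summableI_nonneg_bounded) auto
    then have "(\<lambda>k. (hnorm H (?R k U))\<^sup>2) \<longlonglongrightarrow> 0" by (rule summable_LIMSEQ_zero)
    from tendsto_real_sqrt[OF this] show ?thesis
      by (simp add: hnorm_nonneg[OF cl[OF U]])
  qed
  have "(\<lambda>k. hinner H (P i j (?R k (h j))) (h i)) \<longlonglongrightarrow> 0" if "i < n" "j < n" for i j
  proof -
    note Pij = P[OF that] and hi = h[rule_format, OF that(1)] and hj = h[rule_format, OF that(2)]
    obtain K where K: "\<And>U. U \<in> hcarrier H \<Longrightarrow> hnorm H (P i j U) \<le> K * hnorm H U"
      using Pij unfolding bounded_operators_def by blast
    have "cmod (hinner H (P i j (?R k (h j))) (h i)) \<le> K * hnorm H (?R k (h j)) * hnorm H (h i)" for k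
    proof -
      have "cmod (hinner H (P i j (?R k (h j))) (h i)) \<le> hnorm H (P i j (?R k (h j))) * hnorm H (h i)"
        by (intro inner_Cauchy_Schwarz operator_closed[OF Pij] cl hi hj)
      also have "\<dots> \<le> K * hnorm H (?R k (h j)) * hnorm H (h i)"
        by (intro mult_right_mono K cl hj hnorm_nonneg[OF hi])
      finally show ?thesis .
    qed
    note bound = this
    have "(\<lambda>k. K * hnorm H (?R k (h j)) * hnorm H (h i)) \<longlonglongrightarrow> K * 0 * hnorm H (h i)"
      by (intro tendsto_mult tendsto_const null hj)
    then have lim: "(\<lambda>k. K * hnorm H (?R k (h j)) * hnorm H (h i)) \<longlonglongrightarrow> 0" by simp
    show ?thesis
      by (rule Lim_null_comparison[OF always_eventually lim]) (use bound in blast)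
  qed
  then have "Q \<longlonglongrightarrow> (\<Sum>i<n. \<Sum>j<n. 0)"
    unfolding Q_def by (intro tendsto_sum) auto
  then have "Q \<longlonglongrightarrow> 0" by simp
  then have "(\<lambda>k. Q 0 - Q k) \<longlonglongrightarrow> Q 0 - 0" by (intro tendsto_diff tendsto_const)
  moreover have "Q 0 - Q k \<in> \<real>\<^sub>\<ge>\<^sub>0" for k
  proof (induction k)
    case (Suc k)
    from nonneg_Reals_add_I[OF Suc step[of k]] show ?case by simp
  qed simp
  ultimately have "Q 0 \<in> \<real>\<^sub>\<ge>\<^sub>0"
    using Lim_in_closed_set[OF closed_nonneg_Reals_complex, of "\<lambda>k. Q 0 - Q k" sequentially] by simp
  then show "(\<Sum>i<n. \<Sum>j<n. hinner H (P i j (T (h j))) (h i)) \<in> \<real>\<^sub>\<ge>\<^sub>0"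
    by (simp add: Q_def)
qed

end

section \<open>Extending a completely positive kernel from a dense subset\<close>

text \<open>Differences replace sums: a nonempty set closed under them is an additive group, and the
  kernel estimates compare values through differences. The scalars are confined to L so that D can
  be countable.\<close>

definition star_closed :: "complex set \<Rightarrow> 'a::unital_cstar_algebra set \<Rightarrow> bool" where
  "star_closed L D \<longleftrightarrow> 1 \<in> D \<and> (\<forall>a\<in>D. \<forall>b\<in>D. a - b \<in> D \<and> a * b \<in> D) \<and>
     (\<forall>l\<in>L. \<forall>a\<in>D. l *\<^sub>C a \<in> D) \<and> (\<forall>a\<in>D. a\<^sup>\<star> \<in> D)"

text \<open>A snapshot of the densities at one \<alpha>. Beyond sesquilinearity and positivity,
  \<open>F_one\<close> ties the kernel to the inner product of \<alpha>, \<open>F_square\<close>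
  leads to boundedness, and \<open>F_S\<close> is the dilation condition on the part of S inside
  D.\<close>

locale dense_kernel = gns_functional \<alpha> for \<alpha> :: "'a::unital_cstar_algebra \<Rightarrow> complex" +
  fixes S D :: "'a set" and L :: "complex set" and F :: "'a \<Rightarrow> 'a \<Rightarrow> 'a \<Rightarrow> complex"
  assumes normalized: "\<alpha> 1 = 1"
    and D_closed: "star_closed L D"
    and D_dense: "closure D = UNIV" and L_dense: "closure L = UNIV"
    and S_dense: "S \<subseteq> closure (S \<inter> D)"
    and F_diff1: "\<And>a a' c d. a \<in> D \<Longrightarrow> a' \<in> D \<Longrightarrow> c \<in> D \<Longrightarrow> d \<in> D \<Longrightarrow> F (a - a') c d = F a c d - F a' c d"
    and F_diff2: "\<And>a c c' d. a \<in> D \<Longrightarrow> c \<in> D \<Longrightarrow> c' \<in> D \<Longrightarrow> d \<in> D \<Longrightarrow> F a (c - c') d = F a c d - F a c' d"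
    and F_diff3: "\<And>a c d d'. a \<in> D \<Longrightarrow> c \<in> D \<Longrightarrow> d \<in> D \<Longrightarrow> d' \<in> D \<Longrightarrow> F a c (d - d') = F a c d - F a c d'"
    and F_scale1: "\<And>l a c d. l \<in> L \<Longrightarrow> a \<in> D \<Longrightarrow> c \<in> D \<Longrightarrow> d \<in> D \<Longrightarrow> F (l *\<^sub>C a) c d = l * F a c d"
    and F_scale2: "\<And>l a c d. l \<in> L \<Longrightarrow> a \<in> D \<Longrightarrow> c \<in> D \<Longrightarrow> d \<in> D \<Longrightarrow> F a (l *\<^sub>C c) d = l * F a c d"
    and F_scale3: "\<And>l a c d. l \<in> L \<Longrightarrow> a \<in> D \<Longrightarrow> c \<in> D \<Longrightarrow> d \<in> D \<Longrightarrow> F a c (l *\<^sub>C d) = cnj l * F a c d"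
    and F_pos: "\<And>(n::nat) y c. (\<And>i. i < n \<Longrightarrow> y i \<in> D \<and> c i \<in> D) \<Longrightarrow>
      (\<Sum>i<n. \<Sum>j<n. F ((y i)\<^sup>\<star> * y j) (c j) (c i)) \<in> \<real>\<^sub>\<ge>\<^sub>0"
    and F_square: "\<And>a c. a \<in> D \<Longrightarrow> c \<in> D \<Longrightarrow> Re (F (a\<^sup>\<star> * a) c c) \<le> (norm a)\<^sup>2 * Re (\<alpha> (c\<^sup>\<star> * c))"
    and F_one: "\<And>c d. c \<in> D \<Longrightarrow> d \<in> D \<Longrightarrow> F 1 c d = \<alpha> (d\<^sup>\<star> * c)"
    and F_S: "\<And>s c d. s \<in> S \<Longrightarrow> s \<in> D \<Longrightarrow> c \<in> D \<Longrightarrow> d \<in> D \<Longrightarrow> F s c d = \<alpha> (d\<^sup>\<star> * (s * c))"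
begin

lemma D_one: "1 \<in> D" and D_diff: "a \<in> D \<Longrightarrow> b \<in> D \<Longrightarrow> a - b \<in> D"
  and D_scale: "l \<in> L \<Longrightarrow> a \<in> D \<Longrightarrow> l *\<^sub>C a \<in> D"
  and D_mult: "a \<in> D \<Longrightarrow> b \<in> D \<Longrightarrow> a * b \<in> D" and D_star: "a \<in> D \<Longrightarrow> a\<^sup>\<star> \<in> D"
  using D_closed by (auto simp: star_closed_def)

text \<open>Positivity at two points yields a Cauchy-Schwarz inequality with the factors F(1, d, d)
  and F(a* a, c, c); these are controlled by \<open>F_one\<close> and
  \<open>F_square\<close>.\<close>

lemma kernel_bound:
  assumes D: "a \<in> D" "c \<in> D" "d \<in> D"
  shows "cmod (F a c d) \<le> norm a * seminorm c * seminorm d"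
proof -
  note cl = D D_one D_scale D_mult D_star
  have q: "F (a\<^sup>\<star> * a) c c \<in> \<real>\<^sub>\<ge>\<^sub>0"
    using F_pos[of "Suc 0" "\<lambda>_. a" "\<lambda>_. c"] D by simp
  have p: "F 1 d d \<in> \<real>\<^sub>\<ge>\<^sub>0"
    using F_pos[of "Suc 0" "\<lambda>_. 1" "\<lambda>_. d"] D D_one by simp
  have form: "F 1 d d + cnj l * F (a\<^sup>\<star>) d c + l * F a c d + cnj l * l * F (a\<^sup>\<star> * a) c c \<in> \<real>\<^sub>\<ge>\<^sub>0"
    if l: "l \<in> L" for l
  proof -
    \<comment> \<open>The points (a, l c) and (1, d): the mixed terms are F(a, c, d) and F(a*, d,
      c), weighted by l and its conjugate.\<close>
    let ?y = "\<lambda>i::nat. if i = 0 then a else 1" and ?c = "\<lambda>i::nat. if i = 0 then l *\<^sub>C c else d"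
    have "(\<Sum>i<2. \<Sum>j<2. F ((?y i)\<^sup>\<star> * ?y j) (?c j) (?c i)) \<in> \<real>\<^sub>\<ge>\<^sub>0"
      by (rule F_pos) (simp add: cl l)
    moreover have "(\<Sum>i<2. \<Sum>j<2. F ((?y i)\<^sup>\<star> * ?y j) (?c j) (?c i)) =
        F 1 d d + cnj l * F (a\<^sup>\<star>) d c + l * F a c d + cnj l * l * F (a\<^sup>\<star> * a) c c"
      by (simp add: numeral_2_eq_2 F_scale2 F_scale3 cl l)
    ultimately show ?thesis by simp
  qed
  note r = quadratic_form_nonneg[OF L_dense q p form]
  have "(cmod (F a c d))\<^sup>2 = (cmod (F (a\<^sup>\<star>) d c))\<^sup>2"
    using r(1) by simp
  also have "\<dots> \<le> Re (F 1 d d) * Re (F (a\<^sup>\<star> * a) c c)" by (rule r(2))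
  also have "\<dots> \<le> Re (F 1 d d) * ((norm a)\<^sup>2 * Re (\<alpha> (c\<^sup>\<star> * c)))"
    using p by (intro mult_left_mono F_square D) (simp add: complex_nonneg_Reals_iff)
  also have "\<dots> = (norm a * seminorm c * seminorm d)\<^sup>2"
    by (simp add: F_one D power_mult_distrib seminorm_square)
  finally show ?thesis by (rule power2_le_imp_le) simp
qed

lemma seminorm_le: "seminorm a \<le> norm a"
  using seminorm_le_norm[of a] by (simp add: normalized)

lemma kernel_difference_bound:
  assumes "a \<in> D" "c \<in> D" "d \<in> D" "a' \<in> D" "c' \<in> D" "d' \<in> D"
  shows "cmod (F a c d - F a' c' d') \<le>
    norm (a - a') * norm c * norm d + norm a' * norm (c - c') * norm d + norm a' * norm c' * norm (d - d')"
proof -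
  have bd: "cmod (F a c d) \<le> norm a * norm c * norm d" if "a \<in> D" "c \<in> D" "d \<in> D" for a c d
    using kernel_bound[OF that]
    by (rule order_trans) (intro mult_mono seminorm_le mult_nonneg_nonneg order_refl; simp)
  have "F a c d - F a' c' d' = F (a - a') c d + F a' (c - c') d + F a' c' (d - d')"
    using assms by (simp add: F_diff1 F_diff2 F_diff3)
  also have "cmod \<dots> \<le> cmod (F (a - a') c d) + cmod (F a' (c - c') d) + cmod (F a' c' (d - d'))"
    by (intro norm_triangle_mono order_refl)
  also have "\<dots> \<le> norm (a - a') * norm c * norm d + norm a' * norm (c - c') * norm d
      + norm a' * norm c' * norm (d - d')"
    using assms by (intro add_mono bd D_diff)
  finally show ?thesis .
qed

text \<open>One estimate for two purposes: comparing two subsequences of an approximation proves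
  convergence, and comparing two approximations proves that the limit does not depend on
  them.\<close>

lemma kernel_difference_null:
  assumes D: "\<And>k::nat. a k \<in> D \<and> c k \<in> D \<and> d k \<in> D" "\<And>k. a' k \<in> D \<and> c' k \<in> D \<and> d' k \<in> D"
    and lim: "a \<longlonglongrightarrow> a0" "c \<longlonglongrightarrow> c0" "d \<longlonglongrightarrow> d0" "a' \<longlonglongrightarrow> a0" "c' \<longlonglongrightarrow> c0" "d' \<longlonglongrightarrow> d0"
  shows "(\<lambda>k. F (a k) (c k) (d k) - F (a' k) (c' k) (d' k)) \<longlonglongrightarrow> 0"
proof -
  let ?g = "\<lambda>k. norm (a k - a' k) * norm (c k) * norm (d k)
    + norm (a' k) * norm (c k - c' k) * norm (d k) + norm (a' k) * norm (c' k) * norm (d k - d' k)"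
  have "?g \<longlonglongrightarrow> norm (a0 - a0) * norm c0 * norm d0 + norm a0 * norm (c0 - c0) * norm d0
      + norm a0 * norm c0 * norm (d0 - d0)"
    by (intro tendsto_add tendsto_mult tendsto_norm tendsto_diff lim)
  then have "?g \<longlonglongrightarrow> 0" by simp
  moreover have "\<forall>k. cmod (F (a k) (c k) (d k) - F (a' k) (c' k) (d' k)) \<le> ?g k"
    using D by (intro allI kernel_difference_bound) auto
  ultimately show ?thesis by (rule Lim_null_comparison[OF always_eventually, rotated])
qed

definition approx :: "'a \<Rightarrow> nat \<Rightarrow> 'a" where
  "approx a = (SOME x. (\<forall>k. x k \<in> D) \<and> x \<longlonglongrightarrow> a)"

lemma approx_D: "approx a k \<in> D" and approx_lim: "approx a \<longlonglongrightarrow> a"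
proof -
  have "a \<in> closure D" by (simp add: D_dense)
  then have "\<exists>x. (\<forall>k. x k \<in> D) \<and> x \<longlonglongrightarrow> a" by (simp add: closure_sequential)
  from someI_ex[OF this] show "approx a k \<in> D" "approx a \<longlonglongrightarrow> a"
    by (simp_all add: approx_def)
qed

definition ext :: "'a \<Rightarrow> 'a \<Rightarrow> 'a \<Rightarrow> complex" where
  "ext a c d = lim (\<lambda>k. F (approx a k) (approx c k) (approx d k))"

lemma kernel_convergent: "convergent (\<lambda>k. F (approx a k) (approx c k) (approx d k))"
proof (rule ccontr)
  let ?X = "\<lambda>k. F (approx a k) (approx c k) (approx d k)"
  assume "\<not> convergent ?X"
  then have "\<not> Cauchy ?X" by (simp add: Cauchy_convergent_iff)
  then obtain e where e: "e > 0" "\<And>N. \<exists>m\<ge>N. \<exists>n\<ge>N. \<not> dist (?X m) (?X n) < e"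
    unfolding Cauchy_def by blast
  \<comment> \<open>Without the Cauchy property the values stay e apart along two index sequences
    tending to infinity, although the approximations along both have the same limits.\<close>
  then obtain p q where pq: "\<And>N. p N \<ge> N" "\<And>N. q N \<ge> N" "\<And>N. \<not> dist (?X (p N)) (?X (q N)) < e"
    by metis
  have "filterlim p at_top sequentially" "filterlim q at_top sequentially"
    using pq(1,2) by (auto intro!: filterlim_at_top_mono[OF filterlim_ident] always_eventually)
  then have sub: "(\<lambda>N. approx b (p N)) \<longlonglongrightarrow> b" "(\<lambda>N. approx b (q N)) \<longlonglongrightarrow> b" for b
    using filterlim_compose[OF approx_lim[of b]] by auto
  have "(\<lambda>N. ?X (p N) - ?X (q N)) \<longlonglongrightarrow> 0"
    by (rule kernel_difference_null[OF _ _ sub(1) sub(1) sub(1) sub(2) sub(2) sub(2)])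
      (simp_all add: approx_D)
  then obtain N where "norm (?X (p N) - ?X (q N) - 0) < e"
    using e(1) by (meson LIMSEQ_iff order_refl)
  with pq(3)[of N] show False by (simp add: dist_norm)
qed

text \<open>The extension may be computed along any sequences from D. Constant ones show that it
  extends F, and every algebraic rule passes over by uniqueness of limits.\<close>

lemma ext_lim:
  assumes D: "\<And>k::nat. a k \<in> D" "\<And>k. c k \<in> D" "\<And>k. d k \<in> D"
    and lim: "a \<longlonglongrightarrow> a0" "c \<longlonglongrightarrow> c0" "d \<longlonglongrightarrow> d0"
  shows "(\<lambda>k. F (a k) (c k) (d k)) \<longlonglongrightarrow> ext a0 c0 d0"
proof -
  have "(\<lambda>k. F (approx a0 k) (approx c0 k) (approx d0 k)) \<longlonglongrightarrow> ext a0 c0 d0"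
    unfolding ext_def using kernel_convergent by (simp add: convergent_LIMSEQ_iff)
  moreover have "(\<lambda>k. F (a k) (c k) (d k) - F (approx a0 k) (approx c0 k) (approx d0 k)) \<longlonglongrightarrow> 0"
    by (rule kernel_difference_null[OF _ _ lim approx_lim approx_lim approx_lim])
      (simp_all add: approx_D D)
  ultimately show ?thesis using tendsto_add by fastforce
qed

lemmas ext_approx = ext_lim[OF approx_D approx_D approx_D approx_lim approx_lim approx_lim]

lemma ext_D: "a \<in> D \<Longrightarrow> c \<in> D \<Longrightarrow> d \<in> D \<Longrightarrow> ext a c d = F a c d"
  using ext_lim[of "\<lambda>_. a" "\<lambda>_. c" "\<lambda>_. d"] by (simp add: LIMSEQ_const_iff)

lemma ext_diff1: "ext (a - a') c d = ext a c d - ext a' c d"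
proof (rule LIMSEQ_unique)
  show "(\<lambda>k. F (approx a k - approx a' k) (approx c k) (approx d k)) \<longlonglongrightarrow> ext (a - a') c d"
    by (intro ext_lim tendsto_diff approx_lim approx_D D_diff)
  show "(\<lambda>k. F (approx a k - approx a' k) (approx c k) (approx d k)) \<longlonglongrightarrow> ext a c d - ext a' c d"
    by (simp only: F_diff1 approx_D) (intro tendsto_diff ext_approx)
qed

lemma ext_diff2: "ext a (c - c') d = ext a c d - ext a c' d"
proof (rule LIMSEQ_unique)
  show "(\<lambda>k. F (approx a k) (approx c k - approx c' k) (approx d k)) \<longlonglongrightarrow> ext a (c - c') d"
    by (intro ext_lim tendsto_diff approx_lim approx_D D_diff)
  show "(\<lambda>k. F (approx a k) (approx c k - approx c' k) (approx d k)) \<longlonglongrightarrow> ext a c d - ext a c' d"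
    by (simp only: F_diff2 approx_D) (intro tendsto_diff ext_approx)
qed

lemma ext_diff3: "ext a c (d - d') = ext a c d - ext a c d'"
proof (rule LIMSEQ_unique)
  show "(\<lambda>k. F (approx a k) (approx c k) (approx d k - approx d' k)) \<longlonglongrightarrow> ext a c (d - d')"
    by (intro ext_lim tendsto_diff approx_lim approx_D D_diff)
  show "(\<lambda>k. F (approx a k) (approx c k) (approx d k - approx d' k)) \<longlonglongrightarrow> ext a c d - ext a c d'"
    by (simp only: F_diff3 approx_D) (intro tendsto_diff ext_approx)
qed

lemma ext_add:
  shows "ext (a + a') c d = ext a c d + ext a' c d"
    and "ext a (c + c') d = ext a c d + ext a c' d"
    and "ext a c (d + d') = ext a c d + ext a c d'"
  using ext_diff1[of "a + a'" a' c d] ext_diff2[of a "c + c'" c' d] ext_diff3[of a c "d + d'" d']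
  by (simp_all add: algebra_simps)

lemma ext_scale:
  shows "ext (l *\<^sub>C a) c d = l * ext a c d"
    and "ext a (l *\<^sub>C c) d = l * ext a c d"
    and "ext a c (l *\<^sub>C d) = cnj l * ext a c d"
proof -
  \<comment> \<open>Homogeneity is known for scalars in L only, so the scalar is approximated
    together with the arguments.\<close>
  obtain z :: "nat \<Rightarrow> complex" where z: "\<And>k. z k \<in> L" "z \<longlonglongrightarrow> l"
    using L_dense closure_sequential[of l L] by auto
  have "(\<lambda>k. F (z k *\<^sub>C approx a k) (approx c k) (approx d k)) \<longlonglongrightarrow> ext (l *\<^sub>C a) c d"
    by (intro ext_lim tendsto_scaleC approx_lim approx_D D_scale z)
  moreover have "(\<lambda>k. F (z k *\<^sub>C approx a k) (approx c k) (approx d k)) \<longlonglongrightarrow> l * ext a c d"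
    by (simp only: F_scale1 approx_D z) (intro tendsto_mult ext_approx z)
  ultimately show "ext (l *\<^sub>C a) c d = l * ext a c d" by (rule LIMSEQ_unique)
  have "(\<lambda>k. F (approx a k) (z k *\<^sub>C approx c k) (approx d k)) \<longlonglongrightarrow> ext a (l *\<^sub>C c) d"
    by (intro ext_lim tendsto_scaleC approx_lim approx_D D_scale z)
  moreover have "(\<lambda>k. F (approx a k) (z k *\<^sub>C approx c k) (approx d k)) \<longlonglongrightarrow> l * ext a c d"
    by (simp only: F_scale2 approx_D z) (intro tendsto_mult ext_approx z)
  ultimately show "ext a (l *\<^sub>C c) d = l * ext a c d" by (rule LIMSEQ_unique)
  have "(\<lambda>k. F (approx a k) (approx c k) (z k *\<^sub>C approx d k)) \<longlonglongrightarrow> ext a c (l *\<^sub>C d)"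
    by (intro ext_lim tendsto_scaleC approx_lim approx_D D_scale z)
  moreover have "(\<lambda>k. F (approx a k) (approx c k) (z k *\<^sub>C approx d k)) \<longlonglongrightarrow> cnj l * ext a c d"
    by (simp only: F_scale3 approx_D z) (intro tendsto_mult tendsto_cnj ext_approx z)
  ultimately show "ext a c (l *\<^sub>C d) = cnj l * ext a c d" by (rule LIMSEQ_unique)
qed

lemma seminorm_lim:
  assumes "x \<longlonglongrightarrow> a"
  shows "(\<lambda>k. seminorm (x k)) \<longlonglongrightarrow> seminorm a"
proof -
  have lim: "(\<lambda>k. norm (x k - a)) \<longlonglongrightarrow> 0"
    using assms by (simp add: LIM_zero tendsto_norm_zero)
  have "(\<lambda>k. seminorm (x k) - seminorm a) \<longlonglongrightarrow> 0"
  proof (rule Lim_null_comparison[OF always_eventually lim], intro allI)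
    show "norm (seminorm (x k) - seminorm a) \<le> norm (x k - a)" for k
      using seminorm_diff_ineq[of "x k" a] seminorm_le[of "x k - a"] by simp
  qed
  then show ?thesis by (rule LIM_zero_cancel)
qed

lemma ext_bound: "cmod (ext a c d) \<le> norm a * seminorm c * seminorm d"
proof (rule LIMSEQ_le)
  show "(\<lambda>k. cmod (F (approx a k) (approx c k) (approx d k))) \<longlonglongrightarrow> cmod (ext a c d)"
    by (intro tendsto_norm ext_approx)
  show "(\<lambda>k. norm (approx a k) * seminorm (approx c k) * seminorm (approx d k))
      \<longlonglongrightarrow> norm a * seminorm c * seminorm d"
    by (intro tendsto_mult tendsto_norm approx_lim seminorm_lim)
  show "\<exists>N. \<forall>k\<ge>N. cmod (F (approx a k) (approx c k) (approx d k)) \<le>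
      norm (approx a k) * seminorm (approx c k) * seminorm (approx d k)"
    using kernel_bound approx_D by blast
qed

lemma ext_form: "bounded_form \<alpha> (norm a) (ext a)"
  unfolding bounded_form_def using ext_add ext_scale ext_bound by simp

lemma ext_pos:
  fixes n :: nat
  shows "(\<Sum>i<n. \<Sum>j<n. ext ((y i)\<^sup>\<star> * y j) (c j) (c i)) \<in> \<real>\<^sub>\<ge>\<^sub>0"
proof (rule Lim_in_closed_set[OF closed_nonneg_Reals_complex])
  show "(\<lambda>k. \<Sum>i<n. \<Sum>j<n. F ((approx (y i) k)\<^sup>\<star> * approx (y j) k) (approx (c j) k) (approx (c i) k))
      \<longlonglongrightarrow> (\<Sum>i<n. \<Sum>j<n. ext ((y i)\<^sup>\<star> * y j) (c j) (c i))"
    by (intro tendsto_sum ext_lim tendsto_mult tendsto_cstar approx_lim approx_D D_mult D_star)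
  show "\<forall>\<^sub>F k in sequentially.
      (\<Sum>i<n. \<Sum>j<n. F ((approx (y i) k)\<^sup>\<star> * approx (y j) k) (approx (c j) k) (approx (c i) k)) \<in> \<real>\<^sub>\<ge>\<^sub>0"
    by (intro always_eventually allI F_pos) (simp add: approx_D)
qed simp

lemma ext_one: "ext 1 c d = \<alpha> (d\<^sup>\<star> * c)"
proof (rule LIMSEQ_unique)
  show "(\<lambda>k. F 1 (approx c k) (approx d k)) \<longlonglongrightarrow> ext 1 c d"
    by (intro ext_lim D_one approx_D tendsto_const approx_lim)
  have "(\<lambda>k. \<alpha> ((approx d k)\<^sup>\<star> * approx c k)) \<longlonglongrightarrow> \<alpha> (d\<^sup>\<star> * c)"
    by (intro pf_tendsto tendsto_mult tendsto_cstar approx_lim positive)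
  then show "(\<lambda>k. F 1 (approx c k) (approx d k)) \<longlonglongrightarrow> \<alpha> (d\<^sup>\<star> * c)"
    by (simp only: F_one approx_D)
qed

lemma ext_S:
  assumes "s \<in> S"
  shows "ext s c d = \<alpha> (d\<^sup>\<star> * (s * c))"
proof -
  \<comment> \<open>The approximation must stay inside S, where \<open>F_S\<close> applies; the
    sequence \<open>approx s\<close> might leave it.\<close>
  have "s \<in> closure (S \<inter> D)" using assms S_dense by blast
  then obtain t where "\<forall>k. t k \<in> S \<inter> D" and lim: "t \<longlonglongrightarrow> s"
    unfolding closure_sequential by blast
  then have t: "t k \<in> S" "t k \<in> D" for k by auto
  show ?thesis
  proof (rule LIMSEQ_unique)
    show "(\<lambda>k. F (t k) (approx c k) (approx d k)) \<longlonglongrightarrow> ext s c d"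
      by (intro ext_lim t lim approx_D approx_lim)
    have "(\<lambda>k. \<alpha> ((approx d k)\<^sup>\<star> * (t k * approx c k))) \<longlonglongrightarrow> \<alpha> (d\<^sup>\<star> * (s * c))"
      by (intro pf_tendsto tendsto_mult tendsto_cstar approx_lim lim positive)
    then show "(\<lambda>k. F (t k) (approx c k) (approx d k)) \<longlonglongrightarrow> \<alpha> (d\<^sup>\<star> * (s * c))"
      by (simp only: F_S t approx_D)
  qed
qed

lemma form_lim_eqI:
  assumes B: "bounded_form \<alpha> K B" and U: "U \<in> hcarrier H" and V: "V \<in> hcarrier H"
    and lim: "\<And>x y. gns_cauchy \<alpha> x \<Longrightarrow> gns_cauchy \<alpha> y \<Longrightarrow> U = cls x \<Longrightarrow> V = cls y \<Longrightarrow>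
      (\<lambda>k. B (x k) (y k)) \<longlonglongrightarrow> z"
  shows "form_lim B U V = z"
proof -
  obtain x y where *: "gns_cauchy \<alpha> x" "U = cls x" "gns_cauchy \<alpha> y" "V = cls y"
    using U V by (auto elim!: carrierE)
  from form_lim_cls[OF B *(1,3)] lim[OF *(1,3,2,4)] show ?thesis
    unfolding *(2,4) by (rule LIMSEQ_unique)
qed

definition dilation :: "'a \<Rightarrow> (nat \<Rightarrow> 'a) set \<Rightarrow> (nat \<Rightarrow> 'a) set" where
  "dilation a = form_operator (ext a)"

lemma dilation_closed: "U \<in> hcarrier H \<Longrightarrow> dilation a U \<in> hcarrier H"
  and dilation_inner: "U \<in> hcarrier H \<Longrightarrow> V \<in> hcarrier H \<Longrightarrow> hinner H (dilation a U) V = form_lim (ext a) U V"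
  unfolding dilation_def by (rule form_operator_closed[OF ext_form] form_operator_inner[OF ext_form]; assumption)+

text \<open>A positive matrix is a sum over the rows of Y, and \<open>ext_pos\<close> applies to
  each row after the sums are exchanged. Closedness of the nonnegative reals carries the result from
  representing sequences to their classes.\<close>

lemma dilation_completely_positive: "completely_positive H dilation"
  unfolding completely_positive_def positive_operator_matrix_def
proof (intro allI impI)
  fix n h and X :: "nat \<Rightarrow> nat \<Rightarrow> 'a"
  assume "positive_matrix n X" and h: "\<forall>i<n. h i \<in> hcarrier H"
  then obtain Y where Y: "\<And>i j. i < n \<Longrightarrow> j < n \<Longrightarrow> X i j = (\<Sum>k<n. (Y k i)\<^sup>\<star> * Y k j)"
    unfolding positive_matrix_def by blast
  have "\<forall>i. \<exists>x. i < n \<longrightarrow> gns_cauchy \<alpha> x \<and> h i = cls x"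
    using h carrierE by metis
  then obtain x where x: "\<And>i. i < n \<Longrightarrow> gns_cauchy \<alpha> (x i)" "\<And>i. i < n \<Longrightarrow> h i = cls (x i)" by metis
  let ?Q = "\<lambda>m. \<Sum>i<n. \<Sum>j<n. ext (X i j) (x j m) (x i m)"
  have ext_sum: "ext (\<Sum>k\<in>I. f k) c d = (\<Sum>k\<in>I. ext (f k) c d)" for I :: "nat set" and f c d
  proof (induction I rule: infinite_finite_induct)
    case (infinite I) then show ?case using ext_diff1[of 0 0 c d] by simp
  next
    case empty then show ?case using ext_diff1[of 0 0 c d] by simp
  qed (simp add: ext_add)
  have Q: "?Q m \<in> \<real>\<^sub>\<ge>\<^sub>0" for m
  proof -
    have "?Q m = (\<Sum>i<n. \<Sum>j<n. \<Sum>k<n. ext ((Y k i)\<^sup>\<star> * Y k j) (x j m) (x i m))"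
      by (intro sum.cong refl) (simp add: Y ext_sum)
    also have "\<dots> = (\<Sum>i<n. \<Sum>k<n. \<Sum>j<n. ext ((Y k i)\<^sup>\<star> * Y k j) (x j m) (x i m))"
      by (intro sum.cong refl sum.swap)
    also have "\<dots> = (\<Sum>k<n. \<Sum>i<n. \<Sum>j<n. ext ((Y k i)\<^sup>\<star> * Y k j) (x j m) (x i m))"
      by (rule sum.swap)
    also have "\<dots> \<in> \<real>\<^sub>\<ge>\<^sub>0"
      by (rule sum_in_nonneg_Reals) (rule ext_pos)
    finally show ?thesis .
  qed
  have "hinner H (dilation (X i j) (h j)) (h i) = form_lim (ext (X i j)) (cls (x j)) (cls (x i))"
    if "i < n" "j < n" for i j
    using that x h by (simp add: dilation_inner)
  then have "(\<Sum>i<n. \<Sum>j<n. hinner H (dilation (X i j) (h j)) (h i)) =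
      (\<Sum>i<n. \<Sum>j<n. form_lim (ext (X i j)) (cls (x j)) (cls (x i)))"
    by (intro sum.cong refl) auto
  moreover have "(\<Sum>i<n. \<Sum>j<n. form_lim (ext (X i j)) (cls (x j)) (cls (x i))) \<in> \<real>\<^sub>\<ge>\<^sub>0"
  proof (rule Lim_in_closed_set[OF closed_nonneg_Reals_complex])
    show "?Q \<longlonglongrightarrow> (\<Sum>i<n. \<Sum>j<n. form_lim (ext (X i j)) (cls (x j)) (cls (x i)))"
      using x by (intro tendsto_sum form_lim_cls[OF ext_form]) auto
  qed (simp_all add: Q)
  ultimately show "(\<Sum>i<n. \<Sum>j<n. hinner H (dilation (X i j) (h j)) (h i)) \<in> \<real>\<^sub>\<ge>\<^sub>0" by simp
qed

lemma dilation_ucp: "ucp H dilation"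
proof -
  note cl = dilation_closed add_closed scale_closed
  have eqI: "U = V" if "U \<in> hcarrier H" "V \<in> hcarrier H"
      "\<And>d. hinner H U (vec d) = hinner H V (vec d)" for U V
    using carrier_eqI that by blast
  have "dilation (a + b) U = hadd H (dilation a U) (dilation b U)" if U: "U \<in> hcarrier H" for a b U
  proof (rule eqI)
    fix d
    have "form_lim (ext (a + b)) U (vec d) = form_lim (ext a) U (vec d) + form_lim (ext b) U (vec d)"
      by (rule form_lim_eqI[OF ext_form U cls_carrier[OF gns_cauchy_const]])
        (simp add: ext_add tendsto_add form_lim_cls[OF ext_form])
    then show "hinner H (dilation (a + b) U) (vec d) = hinner H (hadd H (dilation a U) (dilation b U)) (vec d)"
      using U by (simp add: dilation_inner inner_add_left cl)
  qed (simp_all add: cl U)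
  moreover have "dilation (l *\<^sub>C a) U = hscale H l (dilation a U)" if U: "U \<in> hcarrier H" for a l U
  proof (rule eqI)
    fix d
    have "form_lim (ext (l *\<^sub>C a)) U (vec d) = l * form_lim (ext a) U (vec d)"
      by (rule form_lim_eqI[OF ext_form U cls_carrier[OF gns_cauchy_const]])
        (simp add: ext_scale tendsto_mult_left form_lim_cls[OF ext_form])
    then show "hinner H (dilation (l *\<^sub>C a) U) (vec d) = hinner H (hscale H l (dilation a U)) (vec d)"
      using U by (simp add: dilation_inner inner_scale_left cl)
  qed (simp_all add: cl U)
  moreover have "dilation 1 U = U" if U: "U \<in> hcarrier H" for U
  proof (rule eqI)
    fix d
    have "ext 1 = (\<lambda>c d. \<alpha> (d\<^sup>\<star> * c))" by (intro HOL.ext ext_one)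
    then show "hinner H (dilation 1 U) (vec d) = hinner H U (vec d)"
      using dilation_inner[OF U cls_carrier[OF gns_cauchy_const], of 1 d]
      by (simp only: inner_eq)
  qed (simp_all add: cl U)
  moreover have "dilation a \<in> bounded_operators H" for a
    unfolding dilation_def by (rule form_operator_bounded[OF ext_form])
  ultimately show ?thesis
    unfolding ucp_def using dilation_completely_positive by blast
qed

lemma dilation_rep:
  assumes s: "s \<in> S"
  shows "dilation s = gns_rep \<alpha> s"
proof (rule HOL.ext)
  fix U
  show "dilation s U = gns_rep \<alpha> s U"
  proof (cases "U \<in> hcarrier H")
    case U: True
    show ?thesis
    proof (rule carrier_eqI)
      fix d
      have "form_lim (ext s) U (vec d) = hinner H (gns_rep \<alpha> s U) (vec d)"
      proof -
        obtain x where x: "gns_cauchy \<alpha> x" "U = cls x" using U by (rule carrierE)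
        have "(\<lambda>k. \<alpha> (d\<^sup>\<star> * (s * x k))) \<longlonglongrightarrow> form_lim (ext s) U (vec d)"
          using form_lim_cls[OF ext_form x(1) gns_cauchy_const, of s d] by (simp only: ext_S[OF s] x(2))
        moreover have "(\<lambda>k. \<alpha> (d\<^sup>\<star> * (s * x k))) \<longlonglongrightarrow> hinner H (gns_rep \<alpha> s U) (vec d)"
          unfolding x(2) rep_cls[OF x(1)] by (intro inner_cls gns_cauchy_mult gns_cauchy_const x)
        ultimately show ?thesis by (rule LIMSEQ_unique)
      qed
      then show "hinner H (dilation s U) (vec d) = hinner H (gns_rep \<alpha> s U) (vec d)"
        using U by (simp add: dilation_inner)
    qed (simp_all add: U dilation_closed rep_closed)
  qed (simp add: dilation_def form_operator_def gns_rep_def)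
qed

text \<open>The state is a \<mapsto> ext a 1 1, since the cyclic vector is the class of 1. Its
  agreement with F on D ties it to measurable functions of \<alpha>.\<close>

lemma dilation_exists: "\<exists>\<psi>\<in>state_space. dilation_order S \<alpha> \<psi> \<and> (\<forall>a\<in>D. \<psi> a = F a 1 1)"
proof (rule bexI[of _ "\<lambda>a. ext a 1 1"], intro conjI ballI)
  have "dilation_map S \<alpha> (\<lambda>a. ext a 1 1) dilation"
    unfolding dilation_map_def gns_vector_def
    by (simp add: dilation_ucp dilation_rep dilation_inner form_lim_vec[OF ext_form])
  then show "dilation_order S \<alpha> (\<lambda>a. ext a 1 1)" unfolding dilation_order_def by blast
  show "ext a 1 1 = F a 1 1" if "a \<in> D" for a using that by (simp add: ext_D D_one)
  show "(\<lambda>a. ext a 1 1) \<in> state_space"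
    using ext_pos[where n = "Suc 0" and c = "\<lambda>_. 1" and y = "\<lambda>_. _"]
    by (simp add: state_space_def ext_add ext_scale ext_one normalized)
qed

end

section \<open>Dominated functionals and their densities\<close>

context gns_functional
begin

context
  fixes \<omega> :: "'a \<Rightarrow> complex"
  assumes \<omega>: "positive_functional \<omega>" and dominated: "\<And>a. Re (\<omega> (a\<^sup>\<star> * a)) \<le> Re (\<phi> (a\<^sup>\<star> * a))"
begin

abbreviation dominated_form :: "'a \<Rightarrow> 'a \<Rightarrow> complex" where
  "dominated_form \<equiv> \<lambda>c d. \<omega> (d\<^sup>\<star> * c)"

lemma bounded_dominated_form: "bounded_form \<phi> 1 dominated_form"
proof -
  have "cmod (\<omega> (d\<^sup>\<star> * c)) \<le> seminorm c * seminorm d" for c d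
  proof (rule power2_le_imp_le)
    have "(cmod (\<omega> (d\<^sup>\<star> * c)))\<^sup>2 \<le> Re (\<omega> (c\<^sup>\<star> * c)) * Re (\<omega> (d\<^sup>\<star> * d))"
      by (rule pf_Cauchy_Schwarz_square[OF \<omega>])
    also have "\<dots> \<le> (seminorm c)\<^sup>2 * (seminorm d)\<^sup>2"
      unfolding seminorm_square by (intro mult_mono dominated pf_Re_nonneg[OF \<omega>] pf_Re_nonneg[OF positive])
    finally show "(cmod (\<omega> (d\<^sup>\<star> * c)))\<^sup>2 \<le> (seminorm c * seminorm d)\<^sup>2"
      by (simp add: power_mult_distrib)
  qed simp
  then show ?thesis
    by (simp add: bounded_form_def distrib_left distrib_right cstar_add cstar_scaleC mult_scaleC_left
        mult_scaleC_right pf_add[OF \<omega>] pf_scaleC[OF \<omega>])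
qed

text \<open>Symmetry reflects that \<omega> is hermitian; the bounds 0 and 1 are positivity and
  domination, each in the limit along a representing sequence.\<close>

lemma positive_contraction_dominated: "positive_contraction (form_operator dominated_form)"
  unfolding positive_contraction_def
proof (intro conjI ballI)
  note B = bounded_dominated_form
  fix U assume U: "U \<in> hcarrier H"
  show closed: "form_operator dominated_form U \<in> hcarrier H"
    by (rule form_operator_closed[OF B U])
  obtain x where x: "gns_cauchy \<phi> x" "U = cls x" using U by (rule carrierE)
  show "hinner H (form_operator dominated_form U) V = hinner H U (form_operator dominated_form V)"
    if V: "V \<in> hcarrier H" for V
  proof -
    obtain y where y: "gns_cauchy \<phi> y" "V = cls y" using V by (rule carrierE)
    have "(\<lambda>k. cnj (\<omega> ((x k)\<^sup>\<star> * y k))) \<longlonglongrightarrow> cnj (form_lim dominated_form V U)"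
      unfolding x(2) y(2) by (intro tendsto_cnj form_lim_cls[OF B] x y)
    moreover have "(\<lambda>k. cnj (\<omega> ((x k)\<^sup>\<star> * y k))) \<longlonglongrightarrow> form_lim dominated_form U V"
      unfolding x(2) y(2) pf_cnj[OF \<omega>, symmetric] by (intro form_lim_cls[OF B] x y)
    ultimately have "form_lim dominated_form U V = cnj (form_lim dominated_form V U)"
      by (rule LIMSEQ_unique[rotated])
    then show ?thesis
      using U V inner_cnj[OF form_operator_closed[OF B V] U]
      by (simp add: form_operator_inner[OF B])
  qed
  have lim: "(\<lambda>k. Re (\<omega> ((x k)\<^sup>\<star> * x k))) \<longlonglongrightarrow> Re (hinner H (form_operator dominated_form U) U)"
    unfolding form_operator_inner[OF B U U] unfolding x(2)
    by (intro tendsto_Re form_lim_cls[OF B] x)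
  show "0 \<le> Re (hinner H (form_operator dominated_form U) U)"
    by (rule LIMSEQ_le_const[OF lim]) (simp add: pf_Re_nonneg[OF \<omega>])
  show "Re (hinner H (form_operator dominated_form U) U) \<le> Re (hinner H U U)"
    using lim inner_self[OF x(1)] unfolding x(2)
    by (rule LIMSEQ_le) (simp add: seminorm_square dominated)
qed

text \<open>The form satisfies B(a c, d) = B(c, a* d), which is also how left multiplication behaves
  in the inner product, so the operator of B may be exchanged with it.\<close>

lemma dominated_commutant: "form_operator dominated_form \<in> commutant H (range (gns_rep \<phi>))"
proof -
  note B = bounded_dominated_form
  have "form_operator dominated_form (gns_rep \<phi> a U) = gns_rep \<phi> a (form_operator dominated_form U)"
    if U: "U \<in> hcarrier H" for a U
  proof (rule carrier_eqI)
    fix d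
    obtain x where x: "gns_cauchy \<phi> x" "U = cls x" using U by (rule carrierE)
    have "(\<lambda>k. \<omega> (d\<^sup>\<star> * (a * x k))) \<longlonglongrightarrow> form_lim dominated_form (gns_rep \<phi> a U) (vec d)"
      unfolding x(2) rep_cls[OF x(1)] by (intro form_lim_cls[OF B] gns_cauchy_const gns_cauchy_mult x)
    moreover have "(\<lambda>k. \<omega> ((a\<^sup>\<star> * d)\<^sup>\<star> * x k)) \<longlonglongrightarrow> form_lim dominated_form U (vec (a\<^sup>\<star> * d))"
      unfolding x(2) by (intro form_lim_cls[OF B] gns_cauchy_const x)
    moreover have "(a\<^sup>\<star> * d)\<^sup>\<star> * x k = d\<^sup>\<star> * (a * x k)" for k
      by (simp add: cstar_mult cstar_cstar mult.assoc)
    ultimately have "form_lim dominated_form (gns_rep \<phi> a U) (vec d) = form_lim dominated_form U (vec (a\<^sup>\<star> * d))"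
      using LIMSEQ_unique by auto
    then show "hinner H (form_operator dominated_form (gns_rep \<phi> a U)) (vec d) =
        hinner H (gns_rep \<phi> a (form_operator dominated_form U)) (vec d)"
      using U by (simp add: form_operator_vec[OF B] rep_closed form_operator_closed[OF B] inner_rep)
  qed (simp_all add: U rep_closed form_operator_closed[OF B])
  then show ?thesis
    unfolding commutant_def using form_operator_bounded[OF B] by blast
qed

end

text \<open>Geometric decay of the increments makes the associated series of evaluations absolutely
  summable in mean.\<close>

lemma fast_representative:
  assumes "U \<in> hcarrier H"
  obtains x where "gns_cauchy \<phi> x" "U = cls x" "\<And>k. seminorm (x (Suc k) - x k) < (1/2) ^ k"
proof -
  obtain y where y: "gns_cauchy \<phi> y" "U = cls y" using assms by (rule carrierE)
  have "\<forall>k. \<exists>N. \<forall>m\<ge>N. \<forall>n\<ge>N. seminorm (y m - y n) < (1/2) ^ k"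
    using y(1) unfolding gns_cauchy_def by simp
  then obtain r where r: "\<And>k m n. m \<ge> r k \<Longrightarrow> n \<ge> r k \<Longrightarrow> seminorm (y m - y n) < (1/2) ^ k"
    by metis
  \<comment> \<open>Adding up r 0, ..., r k puts both q k and q (Suc k) above r k; the summand k
    makes q tend to infinity.\<close>
  define q where "q k = k + (\<Sum>i\<le>k. r i)" for k
  have q: "q k \<ge> k" "q k \<ge> r k" "q (Suc k) \<ge> r k" for k
    using member_le_sum[of k "{..k}" r] by (auto simp: q_def)
  define x where "x k = y (q k)" for k
  have cauchy: "gns_cauchy \<phi> x"
    unfolding gns_cauchy_def x_def
  proof (intro allI impI)
    fix e :: real assume "e > 0"
    then obtain N where N: "\<forall>m\<ge>N. \<forall>n\<ge>N. seminorm (y m - y n) < e"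
      using y(1) unfolding gns_cauchy_def by blast
    then have "\<forall>m\<ge>N. \<forall>n\<ge>N. seminorm (y (q m) - y (q n)) < e"
      using q(1) by (meson order_trans)
    then show "\<exists>N. \<forall>m\<ge>N. \<forall>n\<ge>N. seminorm (y (q m) - y (q n)) < e" ..
  qed
  moreover have "U = cls x"
    unfolding y(2)
  proof (rule cls_eqI[OF y(1) cauchy], rule LIMSEQ_I)
    fix e :: real assume "e > 0"
    then obtain N where N: "\<forall>m\<ge>N. \<forall>n\<ge>N. seminorm (y m - y n) < e"
      using y(1) unfolding gns_cauchy_def by blast
    then have "\<forall>n\<ge>N. norm (seminorm (y n - x n) - 0) < e"
      unfolding x_def using q(1) by (auto intro: order_trans)
    then show "\<exists>N. \<forall>n\<ge>N. norm (seminorm (y n - x n) - 0) < e" ..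
  qed
  moreover have "seminorm (x (Suc k) - x k) < (1/2) ^ k" for k
    unfolding x_def by (intro r q)
  ultimately show ?thesis by (rule that)
qed

end

section \<open>Almost everywhere statements from integrals over measurable sets\<close>

lemma AE_nonneg_of_set_integral:
  fixes h :: "'b \<Rightarrow> real"
  assumes h: "integrable M h" and pos: "\<And>E. E \<in> sets M \<Longrightarrow> 0 \<le> (LINT x:E|M. h x)"
  shows "AE x in M. 0 \<le> h x"
proof -
  \<comment> \<open>The set where the claim fails: on it -h is positive, yet the integral of -h over
    it is at most 0, which forces it to be null.\<close>
  define E where "E = {x \<in> space M. h x < 0}"
  have [measurable]: "h \<in> borel_measurable M" using h by auto
  have E: "E \<in> sets M" unfolding E_def by measurable
  let ?g = "\<lambda>x. - (indicator E x *\<^sub>R h x)"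
  have g: "integrable M ?g"
    using integrable_mult_indicator[OF E h] by (rule integrable_minus)
  have g_nonneg: "AE x in M. 0 \<le> ?g x"
    by (rule AE_I2) (auto simp: E_def indicator_def)
  have "(LINT x|M. ?g x) \<le> 0"
    using pos[OF E] by (simp add: set_lebesgue_integral_def)
  moreover have "0 \<le> (LINT x|M. ?g x)" by (rule integral_nonneg_AE[OF g_nonneg])
  ultimately have "AE x in M. ?g x = 0"
    using integral_nonneg_eq_0_iff_AE[OF g g_nonneg] by simp
  then show ?thesis
    using AE_space by eventually_elim (auto simp: E_def indicator_def split: if_splits)
qed

lemma
  fixes g :: "'b \<Rightarrow> complex"
  assumes g: "integrable M g"
  shows Re_set_integral: "E \<in> sets M \<Longrightarrow> Re (LINT x:E|M. g x) = (LINT x:E|M. Re (g x))"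
    and Im_set_integral: "E \<in> sets M \<Longrightarrow> Im (LINT x:E|M. g x) = (LINT x:E|M. Im (g x))"
  using integrable_mult_indicator[OF _ g, of E]
  by (simp_all add: set_lebesgue_integral_def flip: integral_Re integral_Im)

text \<open>The imaginary part has integral 0 over every set, so the real case applies to it with
  both signs.\<close>

lemma AE_nonneg_Reals_of_set_integral:
  fixes g :: "'b \<Rightarrow> complex"
  assumes g: "integrable M g" and pos: "\<And>E. E \<in> sets M \<Longrightarrow> (LINT x:E|M. g x) \<in> \<real>\<^sub>\<ge>\<^sub>0"
  shows "AE x in M. g x \<in> \<real>\<^sub>\<ge>\<^sub>0"
proof -
  have re: "0 \<le> (LINT x:E|M. Re (g x))" and im: "(LINT x:E|M. Im (g x)) = 0" if "E \<in> sets M" for E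
    using pos[OF that] g that
    by (simp_all add: complex_nonneg_Reals_iff flip: Re_set_integral Im_set_integral)
  have "0 \<le> (LINT x:E|M. - Im (g x))" if "E \<in> sets M" for E
    using im[OF that] by (simp add: set_lebesgue_integral_def)
  then have "AE x in M. 0 \<le> - Im (g x)"
    using g by (intro AE_nonneg_of_set_integral) auto
  moreover have "AE x in M. 0 \<le> Im (g x)" "AE x in M. 0 \<le> Re (g x)"
    using g re im by (auto intro!: AE_nonneg_of_set_integral)
  ultimately show ?thesis
    by eventually_elim (simp add: complex_nonneg_Reals_iff)
qed

text \<open>Both g - h and h - g have integral 0 over every set, so both are nonnegative almost
  everywhere, which leaves only 0.\<close>

lemma AE_eq_of_set_integral:
  fixes g h :: "'b \<Rightarrow> complex"
  assumes g: "integrable M g" and h: "integrable M h"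
    and eq: "\<And>E. E \<in> sets M \<Longrightarrow> (LINT x:E|M. g x) = (LINT x:E|M. h x)"
  shows "AE x in M. g x = h x"
proof -
  have diff: "(LINT x:E|M. f x - f' x) = (LINT x:E|M. f x) - (LINT x:E|M. f' x)"
    if "E \<in> sets M" "integrable M f" "integrable M f'" for E and f f' :: "'b \<Rightarrow> complex"
    using that by (intro set_integral_diff) (auto simp: set_integrable_def integrable_mult_indicator)
  have "AE x in M. g x - h x \<in> \<real>\<^sub>\<ge>\<^sub>0" "AE x in M. h x - g x \<in> \<real>\<^sub>\<ge>\<^sub>0"
    using g h by (auto intro!: AE_nonneg_Reals_of_set_integral simp: diff eq)
  then show ?thesis
    by eventually_elim (simp add: complex_nonneg_Reals_iff complex_eq_iff)
qed

section \<open>Measures on the state space with a given barycenter\<close>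

locale representing_measure =
  fixes \<mu> :: "('a::unital_cstar_algebra \<Rightarrow> complex) measure" and \<phi> :: "'a \<Rightarrow> complex"
  assumes states: "borel_prob_on_states \<mu>" and bary: "barycenter \<mu> = \<phi>" and state: "\<phi> \<in> state_space"
begin

sublocale prob_space \<mu> using states by (simp add: borel_prob_on_states_def)

sublocale gns_functional \<phi> using state by unfold_locales (simp add: state_space_iff)

lemma space_eq: "space \<mu> = state_space"
proof -
  have "sets \<mu> = sets state_borel" using states by (simp add: borel_prob_on_states_def)
  from sets_eq_imp_space_eq[OF this] show ?thesis by (simp add: state_borel_def space_restrict_space)
qed

lemma measurable_evaluation [measurable]: "(\<lambda>\<alpha>. \<alpha> a) \<in> borel_measurable \<mu>"
proof -
  have "continuous_on UNIV (\<lambda>\<alpha> :: 'a \<Rightarrow> complex. \<alpha> a)" by simp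
  then have "(\<lambda>\<alpha> :: 'a \<Rightarrow> complex. \<alpha> a) \<in> borel_measurable (restrict_space borel state_space)"
    by (intro measurable_restrict_space1 borel_measurable_continuous_onI)
  moreover have "sets \<mu> = sets (restrict_space borel state_space)"
    using states by (simp add: borel_prob_on_states_def state_borel_def)
  ultimately show ?thesis by (simp cong: measurable_cong_sets)
qed

lemma space_positive: "\<alpha> \<in> space \<mu> \<Longrightarrow> positive_functional \<alpha>"
  and space_one: "\<alpha> \<in> space \<mu> \<Longrightarrow> \<alpha> 1 = 1"
  by (simp_all add: space_eq state_space_iff)

lemma evaluation_bound: "\<alpha> \<in> space \<mu> \<Longrightarrow> cmod (\<alpha> a) \<le> norm a"
  using pf_bound[OF space_positive, of \<alpha> a] by (simp add: space_one)

lemma integrable_evaluation: "integrable \<mu> (\<lambda>\<alpha>. \<alpha> a)"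
  by (rule integrable_const_bound[of _ "norm a"]) (auto simp: evaluation_bound)

lemma integral_evaluation: "(LINT \<alpha>|\<mu>. \<alpha> a) = \<phi> a"
  using bary by (auto simp: barycenter_def)

definition restricted :: "('a \<Rightarrow> complex) set \<Rightarrow> 'a \<Rightarrow> complex" where
  "restricted E a = (LINT \<alpha>:E|\<mu>. \<alpha> a)"

context
  fixes E assumes E: "E \<in> sets \<mu>"
begin

lemma set_integrable: "integrable \<mu> f \<Longrightarrow> set_integrable \<mu> E f" for f :: "_ \<Rightarrow> complex"
  unfolding set_integrable_def by (rule integrable_mult_indicator[OF E])

lemma restricted_positive: "positive_functional (restricted E)"
proof -
  have int: "set_integrable \<mu> E (\<lambda>\<alpha>. \<alpha> a)" for a
    by (rule set_integrable[OF integrable_evaluation])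
  have "restricted E (a + b) = (LINT \<alpha>:E|\<mu>. \<alpha> a + \<alpha> b)" for a b
    unfolding restricted_def using sets.sets_into_space[OF E]
    by (intro set_lebesgue_integral_cong E allI impI) (auto intro!: pf_add[OF space_positive])
  then have "restricted E (a + b) = restricted E a + restricted E b" for a b
    by (simp add: int restricted_def)
  moreover have "restricted E (l *\<^sub>C a) = (LINT \<alpha>:E|\<mu>. l * \<alpha> a)" for l a
    unfolding restricted_def using sets.sets_into_space[OF E]
    by (intro set_lebesgue_integral_cong E allI impI) (auto intro!: pf_scaleC[OF space_positive])
  then have "restricted E (l *\<^sub>C a) = l * restricted E a" for l a
    by (simp add: restricted_def)
  moreover have "restricted E (a\<^sup>\<star> * a) \<in> \<real>\<^sub>\<ge>\<^sub>0" for a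
  proof -
    have "restricted E (a\<^sup>\<star> * a) = (LINT \<alpha>:E|\<mu>. complex_of_real (Re (\<alpha> (a\<^sup>\<star> * a))))"
      unfolding restricted_def using sets.sets_into_space[OF E]
      by (intro set_lebesgue_integral_cong E allI impI) (auto intro!: pf_square_real[OF space_positive])
    also have "\<dots> = complex_of_real (LINT \<alpha>:E|\<mu>. Re (\<alpha> (a\<^sup>\<star> * a)))"
      by (rule set_integral_complex_of_real)
    finally have "restricted E (a\<^sup>\<star> * a) = complex_of_real (LINT \<alpha>:E|\<mu>. Re (\<alpha> (a\<^sup>\<star> * a)))" .
    moreover have "0 \<le> (LINT \<alpha>:E|\<mu>. Re (\<alpha> (a\<^sup>\<star> * a)))"
      unfolding set_lebesgue_integral_def
      by (intro integral_nonneg_AE AE_I2) (simp add: pf_Re_nonneg[OF space_positive])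
    ultimately show ?thesis by simp
  qed
  ultimately show ?thesis by (simp add: positive_functional_def)
qed

lemma restricted_dominated: "Re (restricted E (a\<^sup>\<star> * a)) \<le> Re (\<phi> (a\<^sup>\<star> * a))"
proof -
  have "Re (restricted E (a\<^sup>\<star> * a)) = (LINT \<alpha>|\<mu>. indicator E \<alpha> *\<^sub>R Re (\<alpha> (a\<^sup>\<star> * a)))"
    unfolding restricted_def using Re_set_integral[OF integrable_evaluation E]
    by (simp add: set_lebesgue_integral_def)
  also have "\<dots> \<le> (LINT \<alpha>|\<mu>. Re (\<alpha> (a\<^sup>\<star> * a)))"
  proof (rule integral_mono)
    show "integrable \<mu> (\<lambda>\<alpha>. indicator E \<alpha> *\<^sub>R Re (\<alpha> (a\<^sup>\<star> * a)))"
      by (intro integrable_mult_indicator E integrable_Re integrable_evaluation)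
    show "indicator E \<alpha> *\<^sub>R Re (\<alpha> (a\<^sup>\<star> * a)) \<le> Re (\<alpha> (a\<^sup>\<star> * a))" if "\<alpha> \<in> space \<mu>" for \<alpha>
      using pf_Re_nonneg[OF space_positive[OF that], of a] by (simp add: indicator_def)
  qed (intro integrable_Re integrable_evaluation)
  also have "\<dots> = Re (\<phi> (a\<^sup>\<star> * a))"
    by (simp add: integrable_evaluation integral_evaluation)
  finally show ?thesis .
qed

end

text \<open>Cauchy-Schwarz for the state \<alpha> bounds the square of n = |\<alpha>(z)| by
  \<alpha>(z* z), and 2 n t <= t^2 + n^2 makes the bound linear in \<alpha>, so that the barycenter
  can be inserted. A positive t stands in for the seminorm because it is divided by.\<close>

lemma integral_norm_evaluation:
  assumes "seminorm z \<le> t" "t > 0"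
  shows "(LINT \<alpha>|\<mu>. norm (\<alpha> z)) \<le> t"
proof -
  have "(LINT \<alpha>|\<mu>. norm (\<alpha> z)) \<le> (LINT \<alpha>|\<mu>. (t + Re (\<alpha> (z\<^sup>\<star> * z)) / t) / 2)"
  proof (rule integral_mono)
    show "integrable \<mu> (\<lambda>\<alpha>. norm (\<alpha> z))" by (intro integrable_norm integrable_evaluation)
    show "integrable \<mu> (\<lambda>\<alpha>. (t + Re (\<alpha> (z\<^sup>\<star> * z)) / t) / 2)"
      by (intro Bochner_Integration.integrable_divide Bochner_Integration.integrable_add integrable_Re
          integrable_evaluation integrable_const)
    fix \<alpha> assume \<alpha>: "\<alpha> \<in> space \<mu>"
    let ?n = "cmod (\<alpha> z)"
    have "?n\<^sup>2 \<le> Re (\<alpha> (z\<^sup>\<star> * z))"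
      using pf_Cauchy_Schwarz_square[OF space_positive[OF \<alpha>], of 1 z] by (simp add: space_one[OF \<alpha>])
    with sum_squares_bound[of ?n t] have "2 * ?n * t \<le> t * t + Re (\<alpha> (z\<^sup>\<star> * z))"
      by (simp add: power2_eq_square)
    then show "?n \<le> (t + Re (\<alpha> (z\<^sup>\<star> * z)) / t) / 2"
      using assms(2) by (simp add: field_simps)
  qed
  also have "\<dots> = (t + (seminorm z)\<^sup>2 / t) / 2"
    by (simp add: integrable_evaluation integral_evaluation seminorm_square prob_space)
  also have "\<dots> \<le> t"
    using assms power_mono[OF assms(1), of 2] by (simp add: field_simps power2_eq_square)
  finally show ?thesis .
qed

text \<open>
  The series of the increments of a fast representing sequence of \<open>U\<close> converges in \<open>L\<^sup>1(\<mu>)\<close>;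
  this replaces the Radon--Nikodym theorem.
\<close>

lemma density_exists:
  assumes "U \<in> hcarrier H"
  shows "\<exists>f. integrable \<mu> f \<and>
    (\<forall>E\<in>sets \<mu>. (LINT \<alpha>:E|\<mu>. f \<alpha>) = form_lim (\<lambda>c d. restricted E (d\<^sup>\<star> * c)) U (vec d))"
proof -
  obtain x where x: "gns_cauchy \<phi> x" "U = cls x" and
    fast: "\<And>k. seminorm (x (Suc k) - x k) < (1/2) ^ k"
    using fast_representative[OF assms] by blast
  define z where "z k = d\<^sup>\<star> * (x (Suc k) - x k)" for k
  \<comment> \<open>The factor norm d + 1 instead of norm d keeps the bound positive, as
    \<open>integral_norm_evaluation\<close> requires.\<close>
  have L1: "(LINT \<alpha>|\<mu>. norm (\<alpha> (z k))) \<le> (norm d + 1) * (1/2) ^ k" for k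
  proof (rule integral_norm_evaluation)
    have "seminorm (z k) \<le> norm d * seminorm (x (Suc k) - x k)"
      unfolding z_def using seminorm_mult[of "d\<^sup>\<star>" "x (Suc k) - x k"] by simp
    also have "\<dots> \<le> (norm d + 1) * (1/2) ^ k"
      using fast[of k] by (intro mult_mono) auto
    finally show "seminorm (z k) \<le> (norm d + 1) * (1/2) ^ k" .
  qed (simp add: add_nonneg_pos)
  have summable_L1: "summable (\<lambda>k. LINT \<alpha>|\<mu>. norm (\<alpha> (z k)))"
  proof (rule summable_comparison_test')
    show "summable (\<lambda>k. (norm d + 1) * (1/2) ^ k)"
      by (intro summable_mult summable_geometric) simp
    show "norm (LINT \<alpha>|\<mu>. norm (\<alpha> (z k))) \<le> (norm d + 1) * (1/2) ^ k" if "k \<ge> 0" for k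
      using L1[of k] by simp
  qed
  have AE_summable: "AE \<alpha> in \<mu>. summable (\<lambda>k. norm (\<alpha> (z k)))"
  proof -
    have "(\<integral>\<^sup>+\<alpha>. (\<Sum>k. ennreal (norm (\<alpha> (z k)))) \<partial>\<mu>) = (\<Sum>k. \<integral>\<^sup>+\<alpha>. ennreal (norm (\<alpha> (z k))) \<partial>\<mu>)"
      by (rule nn_integral_suminf) measurable
    also have "\<dots> = (\<Sum>k. ennreal (LINT \<alpha>|\<mu>. norm (\<alpha> (z k))))"
      by (intro suminf_cong nn_integral_eq_integral integrable_norm integrable_evaluation AE_I2) simp
    also have "\<dots> \<noteq> \<infinity>"
      using summable_L1 by (subst suminf_ennreal2) auto
    finally have "AE \<alpha> in \<mu>. (\<Sum>k. ennreal (norm (\<alpha> (z k)))) \<noteq> \<infinity>"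
      by (intro nn_integral_noteq_infinite) measurable
    then show ?thesis
      by eventually_elim (auto intro!: summable_suminf_not_top)
  qed
  \<comment> \<open>Wherever the series converges, this is the limit of the evaluations of \<alpha>
    at d* x k, written as a telescoping sum.\<close>
  define f :: "('a \<Rightarrow> complex) \<Rightarrow> complex" where "f \<alpha> = \<alpha> (d\<^sup>\<star> * x 0) + (\<Sum>k. \<alpha> (z k))" for \<alpha>
  have sum_int: "integrable \<mu> (\<lambda>\<alpha>. \<Sum>k. \<alpha> (z k))"
    by (rule integrable_suminf[OF integrable_evaluation AE_summable summable_L1])
  have "(LINT \<alpha>:E|\<mu>. f \<alpha>) = form_lim (\<lambda>c d. restricted E (d\<^sup>\<star> * c)) U (vec d)" if E: "E \<in> sets \<mu>" for E
  proof -
    let ?B = "\<lambda>c d. restricted E (d\<^sup>\<star> * c)"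
    note \<omega> = restricted_positive[OF E]
    note B = bounded_dominated_form[OF \<omega> restricted_dominated[OF E]]
    have "(\<lambda>k. LINT \<alpha>|\<mu>. indicator E \<alpha> *\<^sub>R \<alpha> (z k)) sums (LINT \<alpha>|\<mu>. (\<Sum>k. indicator E \<alpha> *\<^sub>R \<alpha> (z k)))"
    proof (rule sums_integral)
      show "integrable \<mu> (\<lambda>\<alpha>. indicator E \<alpha> *\<^sub>R \<alpha> (z k))" for k
        by (intro integrable_mult_indicator E integrable_evaluation)
      show "AE \<alpha> in \<mu>. summable (\<lambda>k. norm (indicator E \<alpha> *\<^sub>R \<alpha> (z k)))"
        using AE_summable by eventually_elim (auto simp: indicator_def)
      show "summable (\<lambda>k. LINT \<alpha>|\<mu>. norm (indicator E \<alpha> *\<^sub>R \<alpha> (z k)))"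
      proof (rule summable_comparison_test'[OF summable_L1])
        fix k :: nat assume "k \<ge> 0"
        have "(LINT \<alpha>|\<mu>. norm (indicator E \<alpha> *\<^sub>R \<alpha> (z k))) \<le> (LINT \<alpha>|\<mu>. norm (\<alpha> (z k)))"
          by (intro integral_mono integrable_norm integrable_mult_indicator E integrable_evaluation)
            (simp add: indicator_def)
        then show "norm (LINT \<alpha>|\<mu>. norm (indicator E \<alpha> *\<^sub>R \<alpha> (z k))) \<le> (LINT \<alpha>|\<mu>. norm (\<alpha> (z k)))"
          by simp
      qed
    qed
    moreover have "(\<Sum>k. indicator E \<alpha> *\<^sub>R \<alpha> (z k)) = indicator E \<alpha> *\<^sub>R (\<Sum>k. \<alpha> (z k))" for \<alpha>
      by (simp add: indicator_def)
    ultimately have "(\<lambda>k. restricted E (z k)) sums (LINT \<alpha>:E|\<mu>. \<Sum>k. \<alpha> (z k))"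
      by (simp add: restricted_def set_lebesgue_integral_def)
    \<comment> \<open>The same series summed a second way: the functional of E telescopes along x,
      and its values converge to the extended form.\<close>
    moreover have "(\<lambda>k. restricted E (z k)) sums (form_lim ?B U (vec d) - restricted E (d\<^sup>\<star> * x 0))"
    proof -
      have "(\<lambda>k. restricted E (d\<^sup>\<star> * x k)) \<longlonglongrightarrow> form_lim ?B U (vec d)"
        unfolding x(2) by (intro form_lim_cls[OF B] x gns_cauchy_const)
      from telescope_sums[OF this] show ?thesis
        by (simp add: z_def right_diff_distrib pf_diff[OF \<omega>])
    qed
    ultimately have "(LINT \<alpha>:E|\<mu>. \<Sum>k. \<alpha> (z k)) = form_lim ?B U (vec d) - restricted E (d\<^sup>\<star> * x 0)"
      by (rule sums_unique2)
    moreover have "(LINT \<alpha>:E|\<mu>. f \<alpha>) = restricted E (d\<^sup>\<star> * x 0) + (LINT \<alpha>:E|\<mu>. \<Sum>k. \<alpha> (z k))"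
      unfolding f_def restricted_def
      by (intro set_integral_add set_integrable[OF E] integrable_evaluation sum_int)
    ultimately show ?thesis by simp
  qed
  moreover have "integrable \<mu> f"
    unfolding f_def by (intro Bochner_Integration.integrable_add integrable_evaluation sum_int)
  ultimately show ?thesis by blast
qed

end

section \<open>Disintegration of a strong dilation\<close>

locale strong_dilation_measure = representing_measure \<mu> \<phi>
  for \<mu> :: "('a::unital_cstar_algebra \<Rightarrow> complex) measure" and \<phi> +
  fixes S \<psi> \<Phi>
  assumes map: "dilation_map S \<phi> \<psi> \<Phi>"
    and range_bicommutant: "range \<Phi> \<subseteq> bicommutant (gns_space \<phi>) (range (gns_rep \<phi>))"
begin

lemma ucp: "ucp H \<Phi>" and \<Phi>_S: "s \<in> S \<Longrightarrow> \<Phi> s = gns_rep \<phi> s"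
  and \<psi>_eq: "\<psi> a = hinner H (\<Phi> a (vec 1)) (vec 1)"
  using map by (auto simp: dilation_map_def gns_vector_def)

lemma \<Phi>_bounded: "\<Phi> a \<in> bounded_operators H"
  and \<Phi>_add: "U \<in> hcarrier H \<Longrightarrow> \<Phi> (a + b) U = hadd H (\<Phi> a U) (\<Phi> b U)"
  and \<Phi>_scale: "U \<in> hcarrier H \<Longrightarrow> \<Phi> (l *\<^sub>C a) U = hscale H l (\<Phi> a U)"
  and \<Phi>_one: "U \<in> hcarrier H \<Longrightarrow> \<Phi> 1 U = U"
  and \<Phi>_cp: "completely_positive H \<Phi>"
  using ucp by (auto simp: ucp_def)

lemma vec_carrier [simp]: "vec c \<in> hcarrier H" by simp

lemma \<Phi>_vec [simp]: "\<Phi> a (vec c) \<in> hcarrier H"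
  by (rule operator_closed[OF \<Phi>_bounded vec_carrier])

lemma \<Phi>_vec_add: "\<Phi> a (vec (c + c')) = hadd H (\<Phi> a (vec c)) (\<Phi> a (vec c'))"
proof -
  have "vec (c + c') = hadd H (vec c) (vec c')" by (simp add: add_cls)
  moreover have "\<Phi> a (hadd H (vec c) (vec c')) = hadd H (\<Phi> a (vec c)) (\<Phi> a (vec c'))"
    using \<Phi>_bounded[of a] vec_carrier unfolding bounded_operators_def by blast
  ultimately show ?thesis by simp
qed

lemma \<Phi>_vec_scale: "\<Phi> a (vec (l *\<^sub>C c)) = hscale H l (\<Phi> a (vec c))"
proof -
  have "vec (l *\<^sub>C c) = hscale H l (vec c)" by (simp add: scale_cls)
  moreover have "\<Phi> a (hscale H l (vec c)) = hscale H l (\<Phi> a (vec c))"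
    using \<Phi>_bounded[of a] vec_carrier unfolding bounded_operators_def by blast
  ultimately show ?thesis by simp
qed

text \<open>Expressed through the form of E instead of the operator T_E, so that
  \<open>density_exists\<close> applies directly with U the vector \<Phi>(a) c.\<close>

definition kernel :: "('a \<Rightarrow> complex) set \<Rightarrow> 'a \<Rightarrow> 'a \<Rightarrow> 'a \<Rightarrow> complex" where
  "kernel E a c d = form_lim (\<lambda>c d. restricted E (d\<^sup>\<star> * c)) (\<Phi> a (vec c)) (vec d)"

context
  fixes E assumes E: "E \<in> sets \<mu>"
begin

lemmas form = bounded_dominated_form[OF restricted_positive[OF E] restricted_dominated[OF E]]

lemma kernel_add:
  shows "kernel E (a + b) c d = kernel E a c d + kernel E b c d"
    and "kernel E a (c + c') d = kernel E a c d + kernel E a c' d"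
    and "kernel E a c (d + d') = kernel E a c d + kernel E a c d'"
  by (simp_all add: kernel_def \<Phi>_add \<Phi>_vec_add form_lim_add_left[OF form] form_lim_vec_add[OF form])

lemma kernel_scale:
  shows "kernel E (l *\<^sub>C a) c d = l * kernel E a c d"
    and "kernel E a (l *\<^sub>C c) d = l * kernel E a c d"
    and "kernel E a c (l *\<^sub>C d) = cnj l * kernel E a c d"
  by (simp_all add: kernel_def \<Phi>_scale \<Phi>_vec_scale form_lim_scale_left[OF form] form_lim_vec_scale[OF form])

lemma kernel_diff:
  shows "kernel E (a - b) c d = kernel E a c d - kernel E b c d"
    and "kernel E a (c - c') d = kernel E a c d - kernel E a c' d"
    and "kernel E a c (d - d') = kernel E a c d - kernel E a c d'"
  by (simp_all add: eq_diff_eq flip: kernel_add)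

lemma kernel_one: "kernel E 1 c d = restricted E (d\<^sup>\<star> * c)"
  by (simp add: kernel_def \<Phi>_one form_lim_vec[OF form])

lemma kernel_S: "s \<in> S \<Longrightarrow> kernel E s c d = restricted E (d\<^sup>\<star> * (s * c))"
  by (simp add: kernel_def \<Phi>_S rep_cls form_lim_vec[OF form])

text \<open>
  Here the range condition enters: \<open>\<Phi>\<close> commutes with the operator of the functional
  \<open>a \<mapsto> \<integral>\<^sub>E \<alpha>(a) d\<mu>(\<alpha>)\<close>.
\<close>

lemma kernel_pos: "(\<Sum>i<n. \<Sum>j<n. kernel E ((y i)\<^sup>\<star> * y j) (c j) (c i)) \<in> \<real>\<^sub>\<ge>\<^sub>0" for n :: nat
proof (cases "n = 0")
  case False
  let ?T = "form_operator (\<lambda>c d. restricted E (d\<^sup>\<star> * c))"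
  let ?P = "\<lambda>i j. \<Phi> ((y i)\<^sup>\<star> * y j)"
  have comm: "\<Phi> a (?T U) = ?T (\<Phi> a U)" if "U \<in> hcarrier H" for a U
  proof -
    have "\<Phi> a \<in> commutant H (commutant H (range (gns_rep \<phi>)))"
      using range_bicommutant unfolding bicommutant_def by blast
    then have "\<forall>R\<in>commutant H (range (gns_rep \<phi>)). \<forall>x\<in>hcarrier H. \<Phi> a (R x) = R (\<Phi> a x)"
      by (subst (asm) commutant_def) (erule CollectE, erule conjunct2)
    from bspec[OF bspec[OF this dominated_commutant[OF restricted_positive[OF E] restricted_dominated[OF E]]] that]
    show ?thesis .
  qed
  \<comment> \<open>The factor Y carries the family y in row 0 and zeros elsewhere. A row 0 exists
    only for n > 0, hence the case distinction.\<close>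
  have "(\<Sum>k<n. (if k = 0 then y i else 0)\<^sup>\<star> * (if k = 0 then y j else 0)) = (y i)\<^sup>\<star> * y j" for i j
  proof -
    have "(\<Sum>k<n. (if k = 0 then y i else 0)\<^sup>\<star> * (if k = 0 then y j else 0)) =
        (\<Sum>k<n. if k = 0 then (y i)\<^sup>\<star> * y j else 0)"
      by (intro sum.cong) auto
    then show ?thesis using False by (simp add: sum.delta)
  qed
  then have "positive_matrix n (\<lambda>i j. (y i)\<^sup>\<star> * y j)"
    unfolding positive_matrix_def by (intro exI[of _ "\<lambda>k i. if k = 0 then y i else 0"]) simp
  then have pos: "positive_operator_matrix H n ?P"
    using \<Phi>_cp unfolding completely_positive_def by blast
  have "positive_operator_matrix H n (\<lambda>i j U. ?P i j (?T U))"
  proof (rule positive_operator_matrix_commuting[where P = ?P])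
    show "positive_contraction ?T"
      by (rule positive_contraction_dominated[OF restricted_positive[OF E] restricted_dominated[OF E]])
  qed (rule \<Phi>_bounded comm pos; assumption?)+
  then have "(\<Sum>i<n. \<Sum>j<n. hinner H (?P i j (?T (vec (c j)))) (vec (c i))) \<in> \<real>\<^sub>\<ge>\<^sub>0"
    unfolding positive_operator_matrix_def by (rule allE[of _ "\<lambda>i. vec (c i)"]) simp
  then show ?thesis
    by (simp add: comm form_operator_inner[OF form] kernel_def)
qed simp

text \<open>By the one-point case of \<open>kernel_pos\<close>, a \<mapsto> kernel E a c c is a
  positive functional, and its value at 1 is that of the functional of E at c* c; the general square
  bound does the rest.\<close>

lemma kernel_square: "Re (kernel E (a\<^sup>\<star> * a) c c) \<le> (norm a)\<^sup>2 * Re (restricted E (c\<^sup>\<star> * c))"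
proof -
  have "kernel E (a\<^sup>\<star> * a) c c \<in> \<real>\<^sub>\<ge>\<^sub>0" for a
    using kernel_pos[where n = "Suc 0" and y = "\<lambda>_. a" and c = "\<lambda>_. c"] by simp
  then have "positive_functional (\<lambda>a. kernel E a c c)"
    by (simp add: positive_functional_def kernel_add kernel_scale)
  from pf_square_bound[OF this, of a] show ?thesis by (simp add: kernel_one)
qed

end

text \<open>By the barycenter condition the functional of the whole space is \<phi>, so the kernel
  becomes the coefficient of \<Phi>(a) at the cyclic vector.\<close>

lemma kernel_space: "kernel (space \<mu>) a 1 1 = \<psi> a"
proof -
  have "restricted (space \<mu>) a = \<phi> a" for a
    unfolding restricted_def by (simp add: set_integral_space integrable_evaluation integral_evaluation)
  then show ?thesis by (simp add: kernel_def \<psi>_eq inner_eq)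
qed

text \<open>Chosen separately for each triple, so relations between different triples are available
  only almost everywhere.\<close>

definition kernel_density :: "'a \<Rightarrow> 'a \<Rightarrow> 'a \<Rightarrow> ('a \<Rightarrow> complex) \<Rightarrow> complex" where
  "kernel_density a c d = (SOME f. integrable \<mu> f \<and> (\<forall>E\<in>sets \<mu>. (LINT \<alpha>:E|\<mu>. f \<alpha>) = kernel E a c d))"

lemma integrable_kernel_density: "integrable \<mu> (kernel_density a c d)"
  and set_integral_kernel_density: "E \<in> sets \<mu> \<Longrightarrow> (LINT \<alpha>:E|\<mu>. kernel_density a c d \<alpha>) = kernel E a c d"
  using someI_ex[OF density_exists[OF \<Phi>_vec, of a c d, folded kernel_def]]
  by (auto simp: kernel_density_def)

lemma set_integrable_kernel_density: "E \<in> sets \<mu> \<Longrightarrow> set_integrable \<mu> E (kernel_density a c d)"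
  by (rule set_integrable[OF _ integrable_kernel_density])

lemmas kernel_density_simps = set_integral_kernel_density set_integrable_kernel_density kernel_diff kernel_scale

text \<open>The kernels satisfy these equations over every E, so both sides have the same integrals
  over all measurable sets.\<close>

lemma kernel_density_diff:
  shows "AE \<alpha> in \<mu>. kernel_density (a - b) c d \<alpha> = kernel_density a c d \<alpha> - kernel_density b c d \<alpha>"
    and "AE \<alpha> in \<mu>. kernel_density a (c - c') d \<alpha> = kernel_density a c d \<alpha> - kernel_density a c' d \<alpha>"
    and "AE \<alpha> in \<mu>. kernel_density a c (d - d') \<alpha> = kernel_density a c d \<alpha> - kernel_density a c d' \<alpha>"
  by (rule AE_eq_of_set_integral;
      simp add: integrable_kernel_density kernel_density_simps set_integral_diff)+

lemma kernel_density_scale: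
  shows "AE \<alpha> in \<mu>. kernel_density (l *\<^sub>C a) c d \<alpha> = l * kernel_density a c d \<alpha>"
    and "AE \<alpha> in \<mu>. kernel_density a (l *\<^sub>C c) d \<alpha> = l * kernel_density a c d \<alpha>"
    and "AE \<alpha> in \<mu>. kernel_density a c (l *\<^sub>C d) \<alpha> = cnj l * kernel_density a c d \<alpha>"
  by (rule AE_eq_of_set_integral; simp add: integrable_kernel_density kernel_density_simps)+

lemma kernel_density_one: "AE \<alpha> in \<mu>. kernel_density 1 c d \<alpha> = \<alpha> (d\<^sup>\<star> * c)"
  and kernel_density_S: "s \<in> S \<Longrightarrow> AE \<alpha> in \<mu>. kernel_density s c d \<alpha> = \<alpha> (d\<^sup>\<star> * (s * c))"
  by (rule AE_eq_of_set_integral;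
      simp add: integrable_kernel_density integrable_evaluation kernel_density_simps kernel_one kernel_S restricted_def)+

lemma kernel_density_pos:
  fixes n :: nat
  shows "AE \<alpha> in \<mu>. (\<Sum>i<n. \<Sum>j<n. kernel_density ((y i)\<^sup>\<star> * y j) (c j) (c i) \<alpha>) \<in> \<real>\<^sub>\<ge>\<^sub>0"
proof (rule AE_nonneg_Reals_of_set_integral)
  fix E assume E: "E \<in> sets \<mu>"
  have "(LINT \<alpha>:E|\<mu>. (\<Sum>i<n. \<Sum>j<n. kernel_density ((y i)\<^sup>\<star> * y j) (c j) (c i) \<alpha>)) =
      (\<Sum>i<n. \<Sum>j<n. LINT \<alpha>:E|\<mu>. kernel_density ((y i)\<^sup>\<star> * y j) (c j) (c i) \<alpha>)"
    using set_integrable_kernel_density[OF E]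
    by (simp only: set_lebesgue_integral_def set_integrable_def scaleR_sum_right
        Bochner_Integration.integral_sum Bochner_Integration.integrable_sum)
  also have "\<dots> \<in> \<real>\<^sub>\<ge>\<^sub>0" using kernel_pos[OF E] by (simp add: set_integral_kernel_density E)
  finally show "(LINT \<alpha>:E|\<mu>. (\<Sum>i<n. \<Sum>j<n. kernel_density ((y i)\<^sup>\<star> * y j) (c j) (c i) \<alpha>)) \<in> \<real>\<^sub>\<ge>\<^sub>0" .
qed (intro Bochner_Integration.integrable_sum integrable_kernel_density)

lemma kernel_density_square:
  "AE \<alpha> in \<mu>. Re (kernel_density (a\<^sup>\<star> * a) c c \<alpha>) \<le> (norm a)\<^sup>2 * Re (\<alpha> (c\<^sup>\<star> * c))"
proof -
  let ?h = "\<lambda>\<alpha>. (norm a)\<^sup>2 * Re (\<alpha> (c\<^sup>\<star> * c)) - Re (kernel_density (a\<^sup>\<star> * a) c c \<alpha>)"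
  have int: "integrable \<mu> (\<lambda>\<alpha>. (norm a)\<^sup>2 * Re (\<alpha> (c\<^sup>\<star> * c)))" "integrable \<mu> (\<lambda>\<alpha>. Re (kernel_density (a\<^sup>\<star> * a) c c \<alpha>))"
    by (simp_all add: integrable_evaluation integrable_kernel_density)
  have "AE \<alpha> in \<mu>. 0 \<le> ?h \<alpha>"
  proof (rule AE_nonneg_of_set_integral)
    show "integrable \<mu> ?h" using int by (rule Bochner_Integration.integrable_diff)
    fix E assume E: "E \<in> sets \<mu>"
    have "(LINT \<alpha>:E|\<mu>. ?h \<alpha>) = (LINT \<alpha>:E|\<mu>. (norm a)\<^sup>2 * Re (\<alpha> (c\<^sup>\<star> * c))) - (LINT \<alpha>:E|\<mu>. Re (kernel_density (a\<^sup>\<star> * a) c c \<alpha>))"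
      by (intro set_integral_diff; unfold set_integrable_def; intro integrable_mult_indicator E int)
    also have "\<dots> = (norm a)\<^sup>2 * Re (restricted E (c\<^sup>\<star> * c)) - Re (kernel E (a\<^sup>\<star> * a) c c)"
      by (simp add: restricted_def E set_integral_kernel_density[symmetric] Re_set_integral integrable_evaluation
          integrable_kernel_density)
    finally show "0 \<le> (LINT \<alpha>:E|\<mu>. ?h \<alpha>)" using kernel_square[OF E, of a c] by simp
  qed
  then show ?thesis by simp
qed

lemma AE_dense_kernel:
  assumes countable: "countable D" "countable L"
    and closed: "star_closed L D"
    and dense: "closure D = UNIV" "closure L = UNIV" "S \<subseteq> closure (S \<inter> D)"
  shows "AE \<alpha> in \<mu>. dense_kernel \<alpha> S D L (\<lambda>a c d. kernel_density a c d \<alpha>)"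
proof -
  have "countable (S \<inter> D)" "countable (lists (D \<times> D))" using countable by auto
  note AE_I = AE_ball_countable[OF countable(1), THEN iffD2] AE_ball_countable[OF countable(2), THEN iffD2]
    this[THEN AE_ball_countable, THEN iffD2]
  have "AE \<alpha> in \<mu>. \<forall>a\<in>D. \<forall>b\<in>D. \<forall>c\<in>D. \<forall>d\<in>D. kernel_density (a - b) c d \<alpha> = kernel_density a c d \<alpha> - kernel_density b c d \<alpha>"
    "AE \<alpha> in \<mu>. \<forall>a\<in>D. \<forall>c\<in>D. \<forall>c'\<in>D. \<forall>d\<in>D. kernel_density a (c - c') d \<alpha> = kernel_density a c d \<alpha> - kernel_density a c' d \<alpha>"
    "AE \<alpha> in \<mu>. \<forall>a\<in>D. \<forall>c\<in>D. \<forall>d\<in>D. \<forall>d'\<in>D. kernel_density a c (d - d') \<alpha> = kernel_density a c d \<alpha> - kernel_density a c d' \<alpha>"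
    "AE \<alpha> in \<mu>. \<forall>l\<in>L. \<forall>a\<in>D. \<forall>c\<in>D. \<forall>d\<in>D. kernel_density (l *\<^sub>C a) c d \<alpha> = l * kernel_density a c d \<alpha>"
    "AE \<alpha> in \<mu>. \<forall>l\<in>L. \<forall>a\<in>D. \<forall>c\<in>D. \<forall>d\<in>D. kernel_density a (l *\<^sub>C c) d \<alpha> = l * kernel_density a c d \<alpha>"
    "AE \<alpha> in \<mu>. \<forall>l\<in>L. \<forall>a\<in>D. \<forall>c\<in>D. \<forall>d\<in>D. kernel_density a c (l *\<^sub>C d) \<alpha> = cnj l * kernel_density a c d \<alpha>"
    by (intro AE_I ballI kernel_density_diff kernel_density_scale)+
  moreover have "AE \<alpha> in \<mu>. \<forall>c\<in>D. \<forall>d\<in>D. kernel_density 1 c d \<alpha> = \<alpha> (d\<^sup>\<star> * c)"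
    "AE \<alpha> in \<mu>. \<forall>s\<in>S \<inter> D. \<forall>c\<in>D. \<forall>d\<in>D. kernel_density s c d \<alpha> = \<alpha> (d\<^sup>\<star> * (s * c))"
    "AE \<alpha> in \<mu>. \<forall>a\<in>D. \<forall>c\<in>D. Re (kernel_density (a\<^sup>\<star> * a) c c \<alpha>) \<le> (norm a)\<^sup>2 * Re (\<alpha> (c\<^sup>\<star> * c))"
    by (intro AE_I ballI kernel_density_one kernel_density_S kernel_density_square; blast)+
  \<comment> \<open>Positivity concerns families of every finite length; coded as lists over D
    \<times> D they form a countable set.\<close>
  moreover have "AE \<alpha> in \<mu>. \<forall>ps\<in>lists (D \<times> D). (\<Sum>i<length ps. \<Sum>j<length ps.
      kernel_density ((fst (ps ! i))\<^sup>\<star> * fst (ps ! j)) (snd (ps ! j)) (snd (ps ! i)) \<alpha>) \<in> \<real>\<^sub>\<ge>\<^sub>0"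
    by (intro AE_I ballI kernel_density_pos)
  ultimately show ?thesis
    using AE_space
  proof eventually_elim
    case (elim \<alpha>)
    have pos: "(\<Sum>i<n. \<Sum>j<n. kernel_density ((y i)\<^sup>\<star> * y j) (c j) (c i) \<alpha>) \<in> \<real>\<^sub>\<ge>\<^sub>0"
      if "\<And>i. i < n \<Longrightarrow> y i \<in> D \<and> c i \<in> D" for n :: nat and y c
    proof -
      let ?ps = "map (\<lambda>i. (y i, c i)) [0..<n]"
      have "?ps \<in> lists (D \<times> D)" using that by auto
      from bspec[OF elim(10) this] show ?thesis by simp
    qed
    have "gns_functional \<alpha>" by unfold_locales (rule space_positive[OF elim(11)])
    moreover have "dense_kernel_axioms \<alpha> S D L (\<lambda>a c d. kernel_density a c d \<alpha>)"
    proof (rule dense_kernel_axioms.intro)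
      show "(\<Sum>i<n. \<Sum>j<n. kernel_density ((y i)\<^sup>\<star> * y j) (c j) (c i) \<alpha>) \<in> \<real>\<^sub>\<ge>\<^sub>0"
        if "\<And>i. i < n \<Longrightarrow> y i \<in> D \<and> c i \<in> D" for n :: nat and y c
        using that by (rule pos)
    qed (rule space_one[OF elim(11)] closed dense elim(1-7)[rule_format]
        elim(8)[rule_format, OF IntI] elim(9)[rule_format]; assumption)+
    ultimately show ?case by (rule dense_kernel.intro)
  qed
qed

end

section \<open>A countable dense *-closed set\<close>

text \<open>Terms for all elements obtained by finitely many operations. Countability passes to the
  range of \<open>decode\<close>, which is closed under the operations because each is a
  constructor.\<close>

datatype code = Unit | Generator nat | Difference code code | Product code code | Adjoint code | Scaled nat code

instance code :: countable by countable_datatype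

primrec decode :: "(nat \<Rightarrow> 'a::unital_cstar_algebra) \<Rightarrow> (nat \<Rightarrow> complex) \<Rightarrow> code \<Rightarrow> 'a" where
  "decode g l Unit = 1"
| "decode g l (Generator n) = g n"
| "decode g l (Difference s t) = decode g l s - decode g l t"
| "decode g l (Product s t) = decode g l s * decode g l t"
| "decode g l (Adjoint s) = (decode g l s)\<^sup>\<star>"
| "decode g l (Scaled n s) = l n *\<^sub>C decode g l s"

lemma countable_star_closed_superset:
  fixes G :: "'a::unital_cstar_algebra set" and L :: "complex set"
  assumes "countable G" "countable L" "G \<noteq> {}" "L \<noteq> {}"
  obtains D where "countable D" "G \<subseteq> D" "star_closed L D"
proof -
  obtain g :: "nat \<Rightarrow> 'a" and l :: "nat \<Rightarrow> complex" where gl: "G = range g" "L = range l"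
    using assms by (metis range_from_nat_into)
  let ?e = "decode g l"
  have e: "?e t \<in> range ?e" for t by simp
  have "G \<subseteq> range ?e" using e[of "Generator _"] by (auto simp: gl)
  moreover have "star_closed L (range ?e)"
    unfolding star_closed_def gl
    using e[of Unit] e[of "Difference _ _"] e[of "Product _ _"] e[of "Scaled _ _"] e[of "Adjoint _"]
    by (auto simp del: rangeI)
  ultimately show ?thesis by (intro that[of "range ?e"]) auto
qed

text \<open>Separability passes to subsets of metric spaces. Points of C need not lie in S, so for
  each c and k a point of S within 1 / (k + 1) of c is chosen whenever there is one.\<close>

lemma countable_dense_in_subset:
  fixes S C :: "'b::metric_space set"
  assumes C: "countable C" "closure C = UNIV"
  obtains T where "countable T" "T \<subseteq> S" "S \<subseteq> closure T"
proof -
  define t where "t = (\<lambda>(c, k::nat). SOME s. s \<in> S \<and> dist s c < 1 / Suc k)"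
  define T where "T = t ` {(c, k). c \<in> C \<and> (\<exists>s\<in>S. dist s c < 1 / Suc k)}"
  have t: "t (c, k) \<in> S \<and> dist (t (c, k)) c < 1 / Suc k" if "\<exists>s\<in>S. dist s c < 1 / Suc k" for c k
    unfolding t_def using that by (auto intro: someI2_bex)
  have "countable T"
    unfolding T_def
    by (intro countable_image countable_subset[OF _ countable_SIGMA[OF C(1), of "\<lambda>_. UNIV"]]) auto
  moreover have "T \<subseteq> S" using t by (auto simp: T_def)
  moreover have "S \<subseteq> closure T"
  proof
    fix s assume s: "s \<in> S"
    show "s \<in> closure T"
      unfolding closure_approachable
    proof (intro allI impI)
      fix e :: real assume "e > 0"
      \<comment> \<open>Half of e, because s and the chosen point are each this close to c.\<close>
      then obtain k :: nat where k: "1 / Suc k < e / 2"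
        using nat_approx_posE[of "e / 2"] by auto
      have "s \<in> closure C" by (simp add: C)
      then obtain c where c: "c \<in> C" "dist c s < 1 / Suc k"
        unfolding closure_approachable by (metis divide_pos_pos of_nat_0_less_iff zero_less_Suc zero_less_one)
      then have ex: "\<exists>s\<in>S. dist s c < 1 / Suc k" using s by (metis dist_commute)
      have "t (c, k) \<in> T" unfolding T_def using c ex by blast
      moreover have "dist (t (c, k)) s < e"
        using t[OF ex] c(2) k dist_triangle[of "t (c, k)" s c] by linarith
      ultimately show "\<exists>y\<in>T. dist y s < e" by blast
    qed
  qed
  ultimately show ?thesis by (rule that)
qed

lemma countable_dense_star_closed:
  fixes S :: "'a::unital_cstar_algebra set"
  assumes "separable_space (euclidean :: 'a topology)"
  obtains D :: "'a set" and L :: "complex set" where "countable D" "countable L" "star_closed L D"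
    "closure D = UNIV" "closure L = UNIV" "S \<subseteq> closure (S \<inter> D)"
proof -
  obtain C :: "'a set" where C: "countable C" "closure C = UNIV"
    using assms by (auto simp: separable_space_def)
  obtain T where T: "countable T" "T \<subseteq> S" "S \<subseteq> closure T"
    using countable_dense_in_subset[OF C] by blast
  obtain L :: "complex set" where L: "countable L" "\<And>X. open X \<Longrightarrow> X \<noteq> {} \<Longrightarrow> \<exists>d\<in>L. d \<in> X"
    using countable_dense_exists by blast
  have L_dense: "closure L = UNIV"
  proof -
    have "z \<in> closure L" for z
      unfolding closure_approachable
    proof (intro allI impI)
      fix e :: real assume "e > 0"
      then show "\<exists>y\<in>L. dist y z < e" using L(2)[of "ball z e"] by (auto simp: dist_commute)
    qed
    then show ?thesis by blast
  qed
  have ne: "C \<union> T \<noteq> {}" "L \<noteq> {}" using C(2) L_dense by auto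
  \<comment> \<open>C makes D dense in A, and T makes S \<inter> D dense in S.\<close>
  obtain D where D: "countable D" "C \<union> T \<subseteq> D" "star_closed L D"
    using countable_star_closed_superset[OF countable_Un[OF C(1) T(1)] L(1) ne] by blast
  have "closure C \<subseteq> closure D" using D(2) by (intro closure_mono) auto
  then have "closure D = UNIV" using C(2) by blast
  moreover have "S \<subseteq> closure (S \<inter> D)"
    using T D(2) closure_mono[of T "S \<inter> D"] by blast
  ultimately show ?thesis
    using that[OF D(1) L(1) D(3) _ L_dense] by blast
qed

section \<open>Measurability for the completion and the two implications\<close>

lemma borel_measurable_completion_AE:
  assumes g: "g \<in> borel_measurable M" and eq: "AE x in M. f x = g x"
  shows "f \<in> borel_measurable (completion M)"
proof (rule measurableI)
  fix A :: "'b set" assume "A \<in> sets borel"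
  then have "g -` A \<inter> space (completion M) \<in> sets (completion M)"
    using measurable_sets[OF measurable_completion[OF g]] by blast
  \<comment> \<open>The preimages under f and g agree up to a null set, which the completion
    absorbs.\<close>
  then show "f -` A \<inter> space (completion M) \<in> sets (completion M)"
  proof (rule completion.in_sets_AE[rotated])
    show "AE x in completion M. (x \<in> g -` A \<inter> space (completion M)) = (x \<in> f -` A \<inter> space (completion M))"
      using AE_completion[OF eq] by eventually_elim auto
  qed auto
qed simp

lemma strong_dilation_imp_integral_subdivision:
  fixes S :: "'a::unital_cstar_algebra set"
  assumes separable: "separable_space (euclidean :: 'a topology)"
    and state: "\<phi> \<in> state_space" and \<psi>: "\<psi> \<in> state_space"
    and strong: "strong_dilation S \<phi> \<psi>"
  shows "integral_subdivision S \<phi> \<psi>"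
  unfolding integral_subdivision_def
proof (intro allI impI, elim conjE)
  fix \<mu> assume \<mu>: "borel_prob_on_states \<mu>" "barycenter \<mu> = \<phi>"
  obtain \<Phi> where \<Phi>: "dilation_map S \<phi> \<psi> \<Phi>"
    "range \<Phi> \<subseteq> bicommutant (gns_space \<phi>) (range (gns_rep \<phi>))"
    using strong by (auto simp: strong_dilation_def)
  interpret strong_dilation_measure \<mu> \<phi> S \<psi> \<Phi>
    by unfold_locales (fact \<mu> \<Phi> state)+
  obtain D :: "'a set" and L :: "complex set" where D: "countable D" "countable L" "star_closed L D"
    "closure D = UNIV" "closure L = UNIV" "S \<subseteq> closure (S \<inter> D)"
    using countable_dense_star_closed[OF separable, of S] by blast
  define good where "good \<alpha> \<psi>' \<longleftrightarrow> \<psi>' \<in> state_space \<and> dilation_order S \<alpha> \<psi>' \<and>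
    (\<forall>a\<in>D. \<psi>' a = kernel_density a 1 1 \<alpha>)" for \<alpha> \<psi>'
  \<comment> \<open>The default \<alpha> makes the value a state at exceptional \<alpha> too, so
    that \<Psi> maps all of the state space into itself.\<close>
  define \<Psi> where "\<Psi> \<alpha> = (if \<exists>\<psi>'. good \<alpha> \<psi>' then SOME \<psi>'. good \<alpha> \<psi>' else \<alpha>)" for \<alpha>
  have good: "AE \<alpha> in \<mu>. good \<alpha> (\<Psi> \<alpha>)"
    using AE_dense_kernel[OF D]
  proof eventually_elim
    case (elim \<alpha>)
    have "\<exists>\<psi>'. good \<alpha> \<psi>'"
      using dense_kernel.dilation_exists[OF elim] by (auto simp: good_def)
    then show ?case by (simp add: \<Psi>_def someI_ex)
  qed
  have \<Psi>_state: "\<Psi> \<alpha> \<in> state_space" if "\<alpha> \<in> state_space" for \<alpha>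
  proof (cases "\<exists>\<psi>'. good \<alpha> \<psi>'")
    case True
    with someI_ex[OF this] have "good \<alpha> (\<Psi> \<alpha>)" by (simp add: \<Psi>_def)
    then show ?thesis by (simp add: good_def)
  qed (simp add: \<Psi>_def that)
  have \<Psi>_D: "AE \<alpha> in \<mu>. \<Psi> \<alpha> a = kernel_density a 1 1 \<alpha>" if "a \<in> D" for a
    using good by eventually_elim (simp add: good_def that)
  have meas_D: "(\<lambda>\<alpha>. \<Psi> \<alpha> a) \<in> borel_measurable (completion \<mu>)" if "a \<in> D" for a
    by (rule borel_measurable_completion_AE[OF borel_measurable_integrable[OF integrable_kernel_density] \<Psi>_D[OF that]])
  have int_D: "(LINT \<alpha>|completion \<mu>. \<Psi> \<alpha> a) = \<psi> a" if "a \<in> D" for a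
  proof -
    have meas: "kernel_density a 1 1 \<in> borel_measurable \<mu>"
      by (rule borel_measurable_integrable[OF integrable_kernel_density])
    have "(LINT \<alpha>|completion \<mu>. \<Psi> \<alpha> a) = (LINT \<alpha>|completion \<mu>. kernel_density a 1 1 \<alpha>)"
      by (intro integral_cong_AE meas_D that measurable_completion meas AE_completion \<Psi>_D)
    also have "\<dots> = (LINT \<alpha>|\<mu>. kernel_density a 1 1 \<alpha>)" by (rule integral_completion[OF meas])
    also have "\<dots> = (LINT \<alpha>:space \<mu>|\<mu>. kernel_density a 1 1 \<alpha>)"
      by (rule set_integral_space[OF integrable_kernel_density, symmetric])
    also have "\<dots> = \<psi> a" by (simp add: set_integral_kernel_density kernel_space)
    finally show ?thesis .
  qed
  have bound: "cmod (\<Psi> \<alpha> a) \<le> norm a" if "\<alpha> \<in> space \<mu>" for \<alpha> a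
    using evaluation_bound[of "\<Psi> \<alpha>" a] \<Psi>_state that by (simp add: space_eq)
  \<comment> \<open>From D to all a: each \<Psi> \<alpha> is a state, hence norm continuous, so
    measurability passes to the pointwise limit and the integral formula follows by dominated
    convergence with a constant majorant.\<close>
  have "(\<lambda>\<alpha>. \<Psi> \<alpha> a) \<in> borel_measurable (completion \<mu>) \<and> \<psi> a = (LINT \<alpha>|completion \<mu>. \<Psi> \<alpha> a)" for a
  proof -
    have "a \<in> closure D" using D(4) by simp
    then obtain x where x: "\<And>k. x k \<in> D" and lim: "x \<longlonglongrightarrow> a"
      unfolding closure_sequential by blast
    have pointwise: "(\<lambda>k. \<Psi> \<alpha> (x k)) \<longlonglongrightarrow> \<Psi> \<alpha> a" if "\<alpha> \<in> space \<mu>" for \<alpha>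
      using \<Psi>_state that lim by (intro pf_tendsto) (simp_all add: space_eq state_space_iff)
    have meas: "(\<lambda>\<alpha>. \<Psi> \<alpha> a) \<in> borel_measurable (completion \<mu>)"
      by (rule borel_measurable_LIMSEQ_metric[where f = "\<lambda>k \<alpha>. \<Psi> \<alpha> (x k)"])
        (simp_all add: pointwise meas_D x)
    obtain K where K: "\<And>k. norm (x k) \<le> K"
      using convergent_imp_Bseq[OF convergentI[OF lim]] by (auto simp: Bseq_def)
    have "(\<lambda>k. LINT \<alpha>|completion \<mu>. \<Psi> \<alpha> (x k)) \<longlonglongrightarrow> (LINT \<alpha>|completion \<mu>. \<Psi> \<alpha> a)"
    proof (rule integral_dominated_convergence[where w = "\<lambda>_. K"])
      show "integrable (completion \<mu>) (\<lambda>_. K)" by (simp add: integrable_completion)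
      show "AE \<alpha> in completion \<mu>. norm (\<Psi> \<alpha> (x k)) \<le> K" for k
        by (rule AE_I2) (simp add: order_trans[OF bound K])
      show "AE \<alpha> in completion \<mu>. (\<lambda>k. \<Psi> \<alpha> (x k)) \<longlonglongrightarrow> \<Psi> \<alpha> a"
        by (rule AE_I2) (simp add: pointwise)
    qed (rule meas meas_D x)+
    then have "(\<lambda>k. \<psi> (x k)) \<longlonglongrightarrow> (LINT \<alpha>|completion \<mu>. \<Psi> \<alpha> a)"
      by (simp only: int_D x)
    moreover have "(\<lambda>k. \<psi> (x k)) \<longlonglongrightarrow> \<psi> a"
      by (rule pf_tendsto[OF _ lim]) (use \<psi> in \<open>simp add: state_space_iff\<close>)
    ultimately have "\<psi> a = (LINT \<alpha>|completion \<mu>. \<Psi> \<alpha> a)"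
      by (rule LIMSEQ_unique[rotated])
    with meas show ?thesis by blast
  qed
  moreover have "AE \<alpha> in completion \<mu>. dilation_order S \<alpha> (\<Psi> \<alpha>)"
    using AE_completion[OF good] by eventually_elim (simp add: good_def)
  ultimately show "\<exists>\<Psi>. (\<forall>\<alpha>\<in>state_space. \<Psi> \<alpha> \<in> state_space) \<and>
      (\<forall>a. (\<lambda>\<alpha>. \<Psi> \<alpha> a) \<in> borel_measurable (completion \<mu>)) \<and>
      (AE \<alpha> in completion \<mu>. dilation_order S \<alpha> (\<Psi> \<alpha>)) \<and>
      (\<forall>a. \<psi> a = (LINT \<alpha>|completion \<mu>. \<Psi> \<alpha> a))"
    using \<Psi>_state by blast
qed

lemma integral_subdivision_imp_dilation_order:
  fixes S :: "'a::unital_cstar_algebra set"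
  assumes state: "\<phi> \<in> state_space" and isd: "integral_subdivision S \<phi> \<psi>"
  shows "dilation_order S \<phi> \<psi>"
proof -
  let ?\<mu> = "return state_borel \<phi>"
  have space: "\<phi> \<in> space state_borel"
    using state by (simp add: state_borel_def space_restrict_space)
  \<comment> \<open>A null set of the point mass cannot contain \<phi>.\<close>
  have AE_point: "P \<phi>" if AE_P: "AE \<alpha> in ?\<mu>. P \<alpha>" for P
  proof -
    obtain N where N: "{\<alpha> \<in> space ?\<mu>. \<not> P \<alpha>} \<subseteq> N" "emeasure ?\<mu> N = 0" "N \<in> sets ?\<mu>"
      using AE_P by (rule AE_E)
    then have "\<phi> \<notin> N" by (auto simp: emeasure_return indicator_def)
    with N(1) space show ?thesis by auto
  qed
  have meas: "(\<lambda>\<alpha>. \<alpha> a) \<in> borel_measurable state_borel" for a :: 'a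
  proof -
    have "continuous_on UNIV (\<lambda>\<alpha> :: 'a \<Rightarrow> complex. \<alpha> a)" by simp
    then show ?thesis
      unfolding state_borel_def by (intro measurable_restrict_space1 borel_measurable_continuous_onI)
  qed
  have "borel_prob_on_states ?\<mu>"
    by (simp add: borel_prob_on_states_def prob_space_return[OF space])
  moreover have "barycenter ?\<mu> = \<phi>"
    by (rule ext) (simp add: barycenter_def integral_return[OF space meas])
  ultimately obtain \<Psi> where
    meas_\<Psi>: "\<And>a. (\<lambda>\<alpha>. \<Psi> \<alpha> a) \<in> borel_measurable (completion ?\<mu>)" and
    dil: "AE \<alpha> in completion ?\<mu>. dilation_order S \<alpha> (\<Psi> \<alpha>)" and
    int: "\<And>a. \<psi> a = (LINT \<alpha>|completion ?\<mu>. \<Psi> \<alpha> a)"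
    using isd unfolding integral_subdivision_def by blast
  have "dilation_order S \<phi> (\<Psi> \<phi>)"
    using dil AE_point by (simp add: AE_completion_iff)
  moreover have "\<psi> = \<Psi> \<phi>"
  proof
    fix a
    \<comment> \<open>\<Psi> is measurable for the completion only, so the point mass is evaluated
      on the Borel main part of the set where the value differs from that at \<phi>; \<phi> is not
      in this set.\<close>
    let ?B = "(\<lambda>\<alpha>. \<Psi> \<alpha> a) -` (- {\<Psi> \<phi> a}) \<inter> space (completion ?\<mu>)"
    have B: "?B \<in> sets (completion ?\<mu>)"
      by (rule measurable_sets[OF meas_\<Psi>]) simp
    have "main_part ?\<mu> ?B \<subseteq> ?B" using main_part_null_part_Un[OF B] by blast
    then have "\<phi> \<notin> main_part ?\<mu> ?B" by blast
    moreover have "main_part ?\<mu> ?B \<in> sets state_borel" using main_part_sets[OF B] by simp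
    ultimately have "emeasure ?\<mu> (main_part ?\<mu> ?B) = 0"
      by (simp add: emeasure_return)
    then have "emeasure (completion ?\<mu>) ?B = 0" by (simp only: emeasure_completion[OF B])
    then have "AE \<alpha> in completion ?\<mu>. \<Psi> \<alpha> a = \<Psi> \<phi> a"
      using B by (intro AE_I[of _ _ ?B]) auto
    then have "(LINT \<alpha>|completion ?\<mu>. \<Psi> \<alpha> a) = (LINT \<alpha>|completion ?\<mu>. \<Psi> \<phi> a)"
      by (intro integral_cong_AE meas_\<Psi>) auto
    also have "\<dots> = (LINT \<alpha>|?\<mu>. \<Psi> \<phi> a)" by (rule integral_completion) simp
    also have "\<dots> = \<Psi> \<phi> a"
      by (rule integral_return) (simp_all add: space)
    finally show "\<psi> a = \<Psi> \<phi> a" by (simp add: int)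
  qed
  ultimately show ?thesis by simp
qed

theorem theoremB:
  fixes S :: "'a::unital_cstar_algebra set" and \<phi> \<psi> :: "'a \<Rightarrow> complex"
  assumes "separable_space (euclidean :: 'a topology)"
    and "operator_system S" and "generated_cstar_algebra S = UNIV"
    and "\<phi> \<in> state_space" and "\<psi> \<in> state_space"
  shows "(strong_dilation S \<phi> \<psi> \<longrightarrow> integral_subdivision S \<phi> \<psi>) \<and>
         (integral_subdivision S \<phi> \<psi> \<longrightarrow> dilation_order S \<phi> \<psi>)"
  using strong_dilation_imp_integral_subdivision[OF assms(1,4,5)]
    integral_subdivision_imp_dilation_order[OF assms(4)] by blast

end
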